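(* Let $K_2$ be a genus 2 function field over $\mathbb{C}$ and $K_1\subset K_2$ a genus 1 subfield with $[K_2:K_1]=5$. Let $x,t\in K_2$ and $a,b\in\mathbb{C}\setminus\{0\}$, $a+b\neq-1$, be normalized as in the context, and assume further that if $\mathbb{C}(x)/\mathbb{C}(t)$ is of degenerate type I or II (see context), then its exceptional ramification occurs over $t=1$. Then the polynomial $$F_4(X)=(2a+1)X^2+(2b-2ba-2a-a^2)X+b^2+2ab$$ has a root $z\neq1$ such that the field $K_2$ is generated over $\mathbb{C}$ by $x$ together with an element $y$ satisfying $$y^2=x(x-1)\,g_3(x),$$ where $g_3(x)=a_3x^3+a_2x^2+a_1x+a_0$ has coefficients that are the following polynomials in $a,b,z$: $a_0=-b^4\big(2b^3a+4b^3-2zab^2+7b^2a^2+8zb^2+4b^2+16ab^2+16zba+6a^3b+8ba+2za^2b+12zb+16ba^2+13za^2+za^4+6za^3+4z+12za\big)$, $a_1=-b^2\big(12b^3+12b^4a+32zba-6a^4b^2+44b^2a^3+6ba^2+24ab^2+10a^3b+44b^3a^2+2ba+52b^3a+61b^2a^2-12ba^5-7za^2-2za+12zb-4a^6+12b^4-a^4-40za^3b^2-16zb^3a^2-12za^5+36zb^2-18za^3-26za^4+56zab^2+4azb^3+2za^2b^2-20za^3b+28za^2b+2za^6+24zb^3+4zba^5-4a^5-32za^4b\big)$, $a_2=5b^2a^6+20b^2a^5+8ba^6-61b^4a^2-18b^5a-56b^4a+4zba+5a^4b^2-18b^2a^3-24zb^4-14zb^4a-4ab^2+8b^3a^4+2b^3a^5-54b^3a^3-70b^3a^2-24b^3a-14b^2a^2+4a^4b+10ba^5-6za^7+64za^3b^3+38za^4b^2+54za^3b^2+12zb^3a^2-14za^6b-10zb^2a^5-4za^7b-4a^6zb^2+32a^2b^4z+2a^7b-za^8-36zb^3-12za^5-12zb^2-4za^4-28zab^2-64azb^3-5za^2b^2+16za^2b+28za^4b-4zba^5-13za^6-12b^5-12b^4+34za^3b$,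 $a_3=(2a+1)\big(za^4-2a^3b+4za^3+6za^3b-4ba^2+12za^2b^2+10za^2b-9b^2a^2+5za^2-2ba+2za-8ab^2-12b^3a+8azb^3-4b^3-4zb-4b^4-12zb^2-8zb^3\big)$.
   Context: Normalization: $x,t\in K_2$ and $a,b\in\mathbb{C}\setminus\{0\}$ with $a+b\ne-1$ are chosen so that $\mathbb{C}(x)$ is the unique rational subfield of $K_2$ with $[K_2:\mathbb{C}(x)]=2$, $\mathbb{C}(t)=K_1\cap\mathbb{C}(x)$, and $$t=\varphi(x)=x\left(\frac{F_1(x)}{F_2(x)}\right)^2,\qquad t-1=(x-1)\left(\frac{F_3(x)}{F_2(x)}\right)^2,$$ with $F_1(x)=x^2+(2a+2b+a^2)x+2ab+b^2$, $F_2(x)=(2a+1)x^2+(a^2+2ab+2b)x+b^2$, $F_3(x)=x^2-(a^2-2b)x+b^2$. Such $x,t,a,b$ always exist; $(x,t)$ is unique up to the $S_3$ generated by $(x,t)\mapsto(1/x,1/t)$ and $(x,t)\mapsto(1-x,1-t)$. Ramification types: the degree 5 extension $\mathbb{C}(x)/\mathbb{C}(t)$ (equivalently the cover $\varphi:\mathbb{P}^1\to\mathbb{P}^1$) has one of the following ramification structures, where for each branch point the ramification indices $>1$ over it are listed (exponents denote multiplicity): non-degenerate: $((2)^2,(2)^2,(2)^2,(2),(2))$; degenerate I: $((2)^2,(2)^2,(4),(2))$; degenerate II: $((2)^2,(2)^2,(2)\cdot(3),(2))$; degenerate III: $((2)^2,(2)^2,(2)^2,(3))$. The "exceptional ramification"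 in type I is the branch point of type $(4)$, and in type II the branch point of type $(2)\cdot(3)$. *)

theory Defs
  imports
    "HOL-Algebra.Algebraic_Closure_Type"
    "HOL-Algebra.Finite_Extensions"
    "HOL-Algebra.Generated_Fields"
    "HOL-Library.Multiset"
    Complex_Main
begin

section \<open>Function fields over the complex numbers\<close>

text \<open>
  The ambient field is a type \<open>'k\<close> of class \<open>field\<close>, made into an extension of the complex
  numbers by a ring homomorphism \<open>\<iota>\<close>; its subfields are sets.  Subfields, generated fields,
  dimensions and transcendence are those of HOL-Algebra, for the ring structure of \<open>'k\<close>.
\<close>

abbreviation fld :: "'k::field ring" where
  "fld \<equiv> ring_of_type_algebra"

abbreviation ext_degree :: "'k::field set \<Rightarrow> 'k set \<Rightarrow> nat \<Rightarrow> bool" where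
  "ext_degree L M n \<equiv> ring.dimension fld n M L"

definition adjoin :: "(complex \<Rightarrow> 'k::field) \<Rightarrow> 'k set \<Rightarrow> 'k set" where
  "adjoin \<iota> S = generate_field fld (range \<iota> \<union> S)"

abbreviation transcendental_over_C :: "(complex \<Rightarrow> 'k::field) \<Rightarrow> 'k \<Rightarrow> bool" where
  "transcendental_over_C \<iota> u \<equiv> ring.transcendental fld (range \<iota>) u"

definition function_field :: "(complex \<Rightarrow> 'k::field) \<Rightarrow> 'k set \<Rightarrow> bool" where
  "function_field \<iota> L \<longleftrightarrow> subfield L fld \<and> range \<iota> \<subseteq> L \<and>
     (\<exists>u\<in>L. transcendental_over_C \<iota> u \<and> (\<exists>n. ext_degree L (adjoin \<iota> {u}) n))"

definition rational_subfield :: "(complex \<Rightarrow> 'k::field) \<Rightarrow> 'k set \<Rightarrow> bool" where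
  "rational_subfield \<iota> M \<longleftrightarrow> (\<exists>u. transcendental_over_C \<iota> u \<and> M = adjoin \<iota> {u})"


section \<open>Places, divisors and genus\<close>

text \<open>
  A place of \<open>L\<close> is represented by its normalized discrete valuation, trivial on the constants.
  The value 0 at the zero element and outside \<open>L\<close> is a convention, which makes the function
  representing a place unique.
\<close>

definition is_place :: "(complex \<Rightarrow> 'k::field) \<Rightarrow> 'k set \<Rightarrow> ('k \<Rightarrow> int) \<Rightarrow> bool" where
  "is_place \<iota> L v \<longleftrightarrow>
     (\<forall>f. f \<notin> L - {0} \<longrightarrow> v f = 0) \<and>
     (\<forall>f\<in>L - {0}. \<forall>g\<in>L - {0}. v (f * g) = v f + v g) \<and>
     (\<forall>f\<in>L - {0}. \<forall>g\<in>L - {0}. f + g \<noteq> 0 \<longrightarrow> min (v f) (v g) \<le> v (f + g)) \<and>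
     (\<forall>c. v (\<iota> c) = 0) \<and>
     (\<exists>f\<in>L. v f = 1)"

definition divisors :: "(complex \<Rightarrow> 'k::field) \<Rightarrow> 'k set \<Rightarrow> (('k \<Rightarrow> int) \<Rightarrow> int) set" where
  "divisors \<iota> L = {D. finite {v. D v \<noteq> 0} \<and> (\<forall>v. D v \<noteq> 0 \<longrightarrow> is_place \<iota> L v)}"

text \<open>All places have degree 1, the complex numbers being algebraically closed.\<close>

definition div_degree :: "(('k \<Rightarrow> int) \<Rightarrow> int) \<Rightarrow> int" where
  "div_degree D = (\<Sum>v | D v \<noteq> 0. D v)"

definition riemann_roch_space ::
    "(complex \<Rightarrow> 'k::field) \<Rightarrow> 'k set \<Rightarrow> (('k \<Rightarrow> int) \<Rightarrow> int) \<Rightarrow> 'k set" where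
  "riemann_roch_space \<iota> L D = {f \<in> L. f = 0 \<or> (\<forall>v. is_place \<iota> L v \<longrightarrow> v f + D v \<ge> 0)}"

definition div_dim :: "(complex \<Rightarrow> 'k::field) \<Rightarrow> 'k set \<Rightarrow> (('k \<Rightarrow> int) \<Rightarrow> int) \<Rightarrow> nat" where
  "div_dim \<iota> L D = ring.dim fld (range \<iota>) (riemann_roch_space \<iota> L D)"

text \<open>The genus is the maximum of \<open>deg D - l(D) + 1\<close> over all divisors \<open>D\<close>.\<close>

definition has_genus :: "(complex \<Rightarrow> 'k::field) \<Rightarrow> 'k set \<Rightarrow> nat \<Rightarrow> bool" where
  "has_genus \<iota> L g \<longleftrightarrow>
     (\<forall>D\<in>divisors \<iota> L. div_degree D - int (div_dim \<iota> L D) + 1 \<le> int g) \<and>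
     (\<exists>D\<in>divisors \<iota> L. div_degree D - int (div_dim \<iota> L D) + 1 = int g)"


section \<open>Ramification\<close>

text \<open>
  For a finite extension \<open>L\<close> of \<open>M\<close>, a place \<open>P\<close> of \<open>L\<close> lies over the place \<open>p\<close> of \<open>M\<close> if its
  valuation restricts to a positive multiple of the one of \<open>p\<close>; the factor is the ramification
  index.  In characteristic 0 only finitely many places ramify, so \<open>mset_set\<close> below is applied
  to finite sets.
\<close>

definition lies_over :: "'k::field set \<Rightarrow> ('k \<Rightarrow> int) \<Rightarrow> ('k \<Rightarrow> int) \<Rightarrow> bool" where
  "lies_over M P p \<longleftrightarrow> (\<exists>e>0. \<forall>f\<in>M. P f = int e * p f)"

definition ram_index :: "'k::field set \<Rightarrow> ('k \<Rightarrow> int) \<Rightarrow> ('k \<Rightarrow> int) \<Rightarrow> nat" where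
  "ram_index M P p = (THE e. e > 0 \<and> (\<forall>f\<in>M. P f = int e * p f))"

text \<open>The multiset of the ramification indices greater than 1 over the place \<open>p\<close>.\<close>

definition ram_type ::
    "(complex \<Rightarrow> 'k::field) \<Rightarrow> 'k set \<Rightarrow> 'k set \<Rightarrow> ('k \<Rightarrow> int) \<Rightarrow> nat multiset" where
  "ram_type \<iota> L M p = image_mset (\<lambda>P. ram_index M P p)
     (mset_set {P. is_place \<iota> L P \<and> lies_over M P p \<and> ram_index M P p > 1})"

text \<open>The multiset of the ramification types over the branch points.\<close>

definition ram_structure ::
    "(complex \<Rightarrow> 'k::field) \<Rightarrow> 'k set \<Rightarrow> 'k set \<Rightarrow> nat multiset multiset" where
  "ram_structure \<iota> L M = image_mset (ram_type \<iota> L M)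
     (mset_set {p. is_place \<iota> M p \<and> ram_type \<iota> L M p \<noteq> {#}})"

definition degenerate_type_I :: "(complex \<Rightarrow> 'k::field) \<Rightarrow> 'k set \<Rightarrow> 'k set \<Rightarrow> bool" where
  "degenerate_type_I \<iota> L M \<longleftrightarrow>
     ram_structure \<iota> L M = {# {#2, 2#}, {#2, 2#}, {#4#}, {#2#} #}"

definition degenerate_type_II :: "(complex \<Rightarrow> 'k::field) \<Rightarrow> 'k set \<Rightarrow> 'k set \<Rightarrow> bool" where
  "degenerate_type_II \<iota> L M \<longleftrightarrow>
     ram_structure \<iota> L M = {# {#2, 2#}, {#2, 2#}, {#2, 3#}, {#2#} #}"

text \<open>In \<open>M\<close>, the point where \<open>t = c\<close> is the place at which \<open>t - c\<close> vanishes.\<close>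

definition ram_type_at ::
    "(complex \<Rightarrow> 'k::field) \<Rightarrow> 'k set \<Rightarrow> 'k set \<Rightarrow> 'k \<Rightarrow> complex \<Rightarrow> nat multiset \<Rightarrow> bool" where
  "ram_type_at \<iota> L M t c T \<longleftrightarrow>
     (\<exists>p. is_place \<iota> M p \<and> p (t - \<iota> c) > 0 \<and> ram_type \<iota> L M p = T)"


section \<open>The polynomials of the normal form\<close>

definition F1 :: "complex \<Rightarrow> complex \<Rightarrow> complex poly" where
  "F1 a b = [: 2 * a * b + b^2, 2 * a + 2 * b + a^2, 1 :]"

definition F2 :: "complex \<Rightarrow> complex \<Rightarrow> complex poly" where
  "F2 a b = [: b^2, a^2 + 2 * a * b + 2 * b, 2 * a + 1 :]"

definition F3 :: "complex \<Rightarrow> complex \<Rightarrow> complex poly" where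
  "F3 a b = [: b^2, - (a^2 - 2 * b), 1 :]"

definition F4 :: "complex \<Rightarrow> complex \<Rightarrow> complex poly" where
  "F4 a b = [: b^2 + 2 * a * b, 2 * b - 2 * b * a - 2 * a - a^2, 2 * a + 1 :]"

definition g3_coeff0 :: "complex \<Rightarrow> complex \<Rightarrow> complex \<Rightarrow> complex" where
  "g3_coeff0 a b z =
     - (b^4) * (2 * b^3 * a + 4 * b^3 - 2 * z * a * b^2 + 7 * b^2 * a^2 + 8 * z * b^2
     + 4 * b^2 + 16 * a * b^2 + 16 * z * b * a + 6 * a^3 * b + 8 * b * a + 2 * z * a^2 * b
     + 12 * z * b + 16 * b * a^2 + 13 * z * a^2 + z * a^4 + 6 * z * a^3 + 4 * z + 12 * z * a)"

definition g3_coeff1 :: "complex \<Rightarrow> complex \<Rightarrow> complex \<Rightarrow> complex" where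
  "g3_coeff1 a b z =
     - (b^2) * (12 * b^3 + 12 * b^4 * a + 32 * z * b * a - 6 * a^4 * b^2 + 44 * b^2 * a^3
     + 6 * b * a^2 + 24 * a * b^2 + 10 * a^3 * b + 44 * b^3 * a^2 + 2 * b * a + 52 * b^3 * a
     + 61 * b^2 * a^2 - 12 * b * a^5 - 7 * z * a^2 - 2 * z * a + 12 * z * b - 4 * a^6
     + 12 * b^4 - a^4 - 40 * z * a^3 * b^2 - 16 * z * b^3 * a^2 - 12 * z * a^5 + 36 * z * b^2
     - 18 * z * a^3 - 26 * z * a^4 + 56 * z * a * b^2 + 4 * a * z * b^3 + 2 * z * a^2 * b^2
     - 20 * z * a^3 * b + 28 * z * a^2 * b + 2 * z * a^6 + 24 * z * b^3 + 4 * z * b * a^5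
     - 4 * a^5 - 32 * z * a^4 * b)"

definition g3_coeff2 :: "complex \<Rightarrow> complex \<Rightarrow> complex \<Rightarrow> complex" where
  "g3_coeff2 a b z =
     5 * b^2 * a^6 + 20 * b^2 * a^5 + 8 * b * a^6 - 61 * b^4 * a^2 - 18 * b^5 * a
     - 56 * b^4 * a + 4 * z * b * a + 5 * a^4 * b^2 - 18 * b^2 * a^3 - 24 * z * b^4
     - 14 * z * b^4 * a - 4 * a * b^2 + 8 * b^3 * a^4 + 2 * b^3 * a^5 - 54 * b^3 * a^3
     - 70 * b^3 * a^2 - 24 * b^3 * a - 14 * b^2 * a^2 + 4 * a^4 * b + 10 * b * a^5
     - 6 * z * a^7 + 64 * z * a^3 * b^3 + 38 * z * a^4 * b^2 + 54 * z * a^3 * b^2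
     + 12 * z * b^3 * a^2 - 14 * z * a^6 * b - 10 * z * b^2 * a^5 - 4 * z * a^7 * b
     - 4 * a^6 * z * b^2 + 32 * a^2 * b^4 * z + 2 * a^7 * b - z * a^8 - 36 * z * b^3
     - 12 * z * a^5 - 12 * z * b^2 - 4 * z * a^4 - 28 * z * a * b^2 - 64 * a * z * b^3
     - 5 * z * a^2 * b^2 + 16 * z * a^2 * b + 28 * z * a^4 * b - 4 * z * b * a^5
     - 13 * z * a^6 - 12 * b^5 - 12 * b^4 + 34 * z * a^3 * b"

definition g3_coeff3 :: "complex \<Rightarrow> complex \<Rightarrow> complex \<Rightarrow> complex" where
  "g3_coeff3 a b z =
     (2 * a + 1) * (z * a^4 - 2 * a^3 * b + 4 * z * a^3 + 6 * z * a^3 * b - 4 * b * a^2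
     + 12 * z * a^2 * b^2 + 10 * z * a^2 * b - 9 * b^2 * a^2 + 5 * z * a^2 - 2 * b * a
     + 2 * z * a - 8 * a * b^2 - 12 * b^3 * a + 8 * a * z * b^3 - 4 * b^3 - 4 * z * b
     - 4 * b^4 - 12 * z * b^2 - 8 * z * b^3)"

definition g3 :: "complex \<Rightarrow> complex \<Rightarrow> complex \<Rightarrow> complex poly" where
  "g3 a b z = [: g3_coeff0 a b z, g3_coeff1 a b z, g3_coeff2 a b z, g3_coeff3 a b z :]"

abbreviation ev :: "(complex \<Rightarrow> 'k::field) \<Rightarrow> complex poly \<Rightarrow> 'k \<Rightarrow> 'k" where
  "ev \<iota> p u \<equiv> poly (map_poly \<iota> p) u"

end

theory Submission
  imports Defs
begin

text \<open>
  Idea of the proof. Comparing degrees in the square of fields \<open>\<complex>(t) \<subseteq> K1, \<complex>(x) \<subseteq> K2\<close> gives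
  \<open>[\<complex>(x) : \<complex>(t)] = 5\<close> and \<open>[K1 : \<complex>(t)] = 2\<close>. So \<open>K1 = \<complex>(t, s)\<close> with \<open>s\<^sup>2 = f(t)\<close> for a squarefree
  polynomial \<open>f\<close>, and \<open>K2 = \<complex>(x, s)\<close>. A quadratic extension \<open>\<complex>(u, w)\<close>, \<open>w\<^sup>2 = h(u)\<close> with \<open>h\<close>
  squarefree of degree \<open>2 g + 1\<close> or \<open>2 g + 2\<close>, has genus \<open>g\<close> (\<open>has_genus_iff\<close>). Hence \<open>f\<close>
  has degree 3 or 4, while \<open>f(\<phi>(x))\<close> has a squarefree part of degree 5 or 6. The roots of that
  squarefree part are the points of odd multiplicity of \<open>\<phi>\<close> over the roots of \<open>f\<close>.

  The polynomial \<open>fibre a b p = X F1\<^sup>2 - p F2\<^sup>2\<close> describes the points over \<open>p\<close>. Over 0 and 1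
  it is \<open>X F1\<^sup>2\<close> and \<open>(X - 1) F3\<^sup>2\<close>, with a single root of odd order, and the derivative of \<open>\<phi>\<close> has
  the numerator \<open>F1 F3 F4\<close>. The degrees above force that one root \<open>\<lambda>\<close> of \<open>f\<close> has three points of odd
  multiplicity above it and that every other root has a single one. Such another root outside of
  \<open>{0, 1}\<close> and \<open>\<lambda>\<close> together would need at least three zeros of \<open>F4\<close>, whose degree is at most 2. Thus
  \<open>f\<close> is a multiple of \<open>X (X - 1) (X - \<lambda>)\<close>, and \<open>\<lambda> = \<phi>(z)\<close> for a root \<open>z\<close> of \<open>F4\<close>
  (\<open>branch_points\<close>). Up to squares in \<open>\<complex>(x)\<close>, \<open>s\<^sup>2\<close> is then \<open>x (x - 1)\<close> times the cubic
  \<open>(X F1\<^sup>2 - \<lambda> F2\<^sup>2) / (X - z)\<^sup>2\<close>, evaluated at \<open>x\<close>.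

  Modulo \<open>F4(z)\<close>, the polynomial \<open>g3\<close> is this cubic times \<open>(2 a + 1)\<^sup>2 F2(z)\<^sup>2 / (2 a)\<^sup>2\<close>
  (\<open>g3_proportional\<close>). The factor vanishes only for \<open>2 a + 1 = 0\<close>. But then \<open>F2\<close> is linear (as \<open>F4\<close> has a root), \<open>\<phi>\<close>
  has multiplicity 3 at infinity, and the cover is of the degenerate type II with the exceptional
  ramification over \<open>t = \<infinity>\<close> (\<open>exceptional_over_infinity\<close>), contrary to the normalization.

  For the genus, places are constructed and classified by local rings (\<open>curve_point\<close>). The functions
  whose only poles lie over \<open>u = \<infinity>\<close>, of order at most \<open>N\<close>, are the \<open>p(u) + q(u) w\<close> with bounded
  degrees (\<open>RR_pole_div\<close>), and any divisor is dominated by a divisor equivalent to such a polar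
  one; adding a point to a divisor increases the dimension by at most 1 (\<open>riemann_inequality\<close>).
\<close>

hide_const (open) Polynomials.degree Polynomials.lead_coeff Coset.order

section \<open>Subfields, adjunction and rational functions\<close>

lemma fld_simps [simp]:
  "carrier fld = UNIV" "f \<otimes>\<^bsub>fld\<^esub> g = f * g" "f \<oplus>\<^bsub>fld\<^esub> g = f + g" "\<one>\<^bsub>fld\<^esub> = 1" "\<zero>\<^bsub>fld\<^esub> = 0"
  by (simp_all add: ring_of_type_algebra_def)

lemma field_fld: "field (fld :: 'k::field ring)"
  by (rule field_from_type_algebra)

interpretation F: domain "fld :: 'k::field ring"
  by (rule field.axioms(1)[OF field_fld])

lemma fld_a_inv [simp]: "\<ominus>\<^bsub>fld\<^esub> f = - (f::'k::field)"
  by (rule F.minus_equality) auto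

lemma fld_inv [simp]: "(f::'k::field) \<noteq> 0 \<Longrightarrow> inv\<^bsub>fld\<^esub> f = inverse f"
  using F.inv_unique'[of f "inverse f"] by simp

lemma fld_pow [simp]: "(f::'k::field) [^]\<^bsub>fld\<^esub> (n::nat) = f ^ n"
  by (induction n) (simp_all add: mult.commute)

lemma subfield_fldI:
  assumes "1 \<in> L" "\<And>f g. f \<in> L \<Longrightarrow> g \<in> L \<Longrightarrow> f - g \<in> L" "\<And>f g. f \<in> L \<Longrightarrow> g \<in> L \<Longrightarrow> f * g \<in> L"
    "\<And>f. f \<in> L \<Longrightarrow> f \<noteq> 0 \<Longrightarrow> inverse f \<in> L"
  shows "subfield L (fld :: 'k::field ring)"
proof -
  have 0: "0 \<in> L" using assms(2)[OF assms(1,1)] by simp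
  have m: "- f \<in> L" if "f \<in> L" for f using assms(2)[OF 0 that] by simp
  have a: "f + g \<in> L" if "f \<in> L" "g \<in> L" for f g using assms(2)[OF that(1) m[OF that(2)]] by simp
  show ?thesis
    by (rule field.subfieldI'[OF field_fld], rule F.subringI) (use assms 0 m a in auto)
qed

lemma subfield_fldD:
  assumes "subfield L (fld :: 'k::field ring)"
  shows "1 \<in> L" "0 \<in> L" "\<And>f g. f \<in> L \<Longrightarrow> g \<in> L \<Longrightarrow> f - g \<in> L" "\<And>f g. f \<in> L \<Longrightarrow> g \<in> L \<Longrightarrow> f + g \<in> L"
    "\<And>f. f \<in> L \<Longrightarrow> - f \<in> L"
    "\<And>f g. f \<in> L \<Longrightarrow> g \<in> L \<Longrightarrow> f * g \<in> L" "\<And>f. f \<in> L \<Longrightarrow> inverse f \<in> L"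
    "\<And>f g. f \<in> L \<Longrightarrow> g \<in> L \<Longrightarrow> f / g \<in> L" "\<And>f n. f \<in> L \<Longrightarrow> f ^ n \<in> L"
    "\<And>f n. f \<in> L \<Longrightarrow> f powi n \<in> L"
proof -
  note E = subringE[OF subfieldE(1)[OF assms]]
  show 1: "1 \<in> L" and 0: "0 \<in> L" using E(2,3) by auto
  show m: "- f \<in> L" if "f \<in> L" for f using E(5)[OF that] by simp
  show a: "f + g \<in> L" if "f \<in> L" "g \<in> L" for f g using E(7)[OF that] by simp
  show "f - g \<in> L" if "f \<in> L" "g \<in> L" for f g using a[OF that(1) m[OF that(2)]] by simp
  show t: "f * g \<in> L" if "f \<in> L" "g \<in> L" for f g using E(6)[OF that] by simp
  show i: "inverse f \<in> L" if "f \<in> L" for f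
    using F.subfield_m_inv(1)[OF assms, of f] that 0 by (cases "f = 0") auto
  show "f / g \<in> L" if "f \<in> L" "g \<in> L" for f g
    using t[OF that(1) i[OF that(2)]] by (simp add: divide_inverse)
  show p: "f ^ n \<in> L" if "f \<in> L" for f n
    by (induction n) (auto simp: 1 t that)
  show "f powi n \<in> L" if "f \<in> L" for f n
    unfolding power_int_def using p i that by auto
qed

lemma subfield_UNIV: "subfield UNIV (fld :: 'k::field ring)"
  by (rule subfield_fldI) auto

locale const_embedding =
  fixes \<iota> :: "complex \<Rightarrow> 'k::field"
  assumes hom: "\<iota> \<in> ring_hom fld fld"
begin

lemma emb_mult [simp]: "\<iota> (c * d) = \<iota> c * \<iota> d"
  and emb_add [simp]: "\<iota> (c + d) = \<iota> c + \<iota> d"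
  and emb_1 [simp]: "\<iota> 1 = 1"
  using hom by (auto simp: ring_hom_def)

lemma emb_0 [simp]: "\<iota> 0 = 0"
  by (metis emb_add add_0 add_cancel_right_right)

lemma emb_minus [simp]: "\<iota> (- c) = - \<iota> c"
  using emb_add[of c "- c"] by (simp add: eq_neg_iff_add_eq_0 add.commute)

lemma emb_diff [simp]: "\<iota> (c - d) = \<iota> c - \<iota> d"
  using emb_add[of c "- d"] by simp

lemma emb_eq_0 [simp]: "\<iota> c = 0 \<longleftrightarrow> c = 0"
proof
  assume "\<iota> c = 0"
  show "c = 0"
  proof (rule ccontr)
    assume "c \<noteq> 0"
    then have "\<iota> (c * inverse c) = 1" by (subst right_inverse) auto
    then show False using \<open>\<iota> c = 0\<close> by simp
  qed
qed auto

lemma emb_inj [simp]: "\<iota> c = \<iota> d \<longleftrightarrow> c = d"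
  using emb_eq_0[of "c - d"] by simp

lemma emb_inverse [simp]: "\<iota> (inverse c) = inverse (\<iota> c)"
proof (cases "c = 0")
  case False
  then have "\<iota> (c * inverse c) = 1" by (subst right_inverse) auto
  then show ?thesis by (simp add: inverse_unique)
qed auto

lemma emb_divide [simp]: "\<iota> (c / d) = \<iota> c / \<iota> d"
  by (simp add: divide_inverse)

lemma emb_power [simp]: "\<iota> (c ^ n) = \<iota> c ^ n"
  by (induction n) auto

lemma emb_numeral [simp]: "\<iota> (numeral n) = numeral n"
proof -
  have "\<iota> (of_nat n) = of_nat n" for n by (induction n) auto
  from this[of "numeral n"] show ?thesis by simp
qed

lemma char_0: "(2::'k) \<noteq> 0"
  using emb_eq_0[of 2] by (simp del: emb_eq_0)

lemma subfield_range: "subfield (range \<iota>) fld"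
  by (rule subfield_fldI)
     (auto simp: image_iff intro: exI[of _ 1],
      metis emb_diff, metis emb_mult, metis emb_inverse)

lemma ev_0 [simp]: "ev \<iota> 0 u = 0"
  by simp

lemma ev_pCons [simp]: "ev \<iota> (pCons c p) u = \<iota> c + u * ev \<iota> p u"
  by (simp add: map_poly_pCons)

lemma ev_1 [simp]: "ev \<iota> 1 u = 1"
  by (simp add: one_pCons map_poly_pCons)

lemma ev_add [simp]: "ev \<iota> (p + q) u = ev \<iota> p u + ev \<iota> q u"
proof (induction p arbitrary: q)
  case (pCons c p)
  obtain b r where q: "q = pCons b r" by (cases q)
  show ?case unfolding q using pCons.IH[of r] by (simp add: map_poly_pCons algebra_simps)
qed auto

lemma ev_smult [simp]: "ev \<iota> (smult c p) u = \<iota> c * ev \<iota> p u"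
  by (induction p) (auto simp: map_poly_pCons algebra_simps)

lemma ev_uminus [simp]: "ev \<iota> (- p) u = - ev \<iota> p u"
  using ev_smult[of "-1" p u] by simp

lemma ev_diff [simp]: "ev \<iota> (p - q) u = ev \<iota> p u - ev \<iota> q u"
  using ev_add[of p "-q" u] by simp

lemma ev_mult [simp]: "ev \<iota> (p * q) u = ev \<iota> p u * ev \<iota> q u"
  by (induction p) (auto simp: map_poly_pCons algebra_simps)

lemma ev_power [simp]: "ev \<iota> (p ^ n) u = ev \<iota> p u ^ n"
  by (induction n) auto

lemma ev_monom [simp]: "ev \<iota> (Polynomial.monom c n) u = \<iota> c * u ^ n"
  by (induction n) (auto simp: monom_0 monom_Suc map_poly_pCons)

lemma ev_prod [simp]: "ev \<iota> (\<Prod>i\<in>A. p i) u = (\<Prod>i\<in>A. ev \<iota> (p i) u)"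
  by (induction A rule: infinite_finite_induct) auto

text \<open>Over the algebraically closed field of constants, an element is transcendental as soon as
  it is not constant: a polynomial that vanishes at it has a linear factor that does.\<close>

lemma ev_eq_0_iff:
  assumes "u \<notin> range \<iota>"
  shows "ev \<iota> p u = 0 \<longleftrightarrow> p = 0"
proof (induction "degree p" arbitrary: p)
  case 0
  then obtain c where "p = [:c:]" by (metis degree_eq_zeroE)
  then show ?case by auto
next
  case (Suc n)
  then obtain c where "poly p c = 0"
    using fundamental_theorem_of_algebra[of p] constant_degree[of p] by auto
  then obtain q where q: "p = [:- c, 1:] * q"
    by (meson dvd_def poly_eq_0_iff_dvd)
  then have "q \<noteq> 0" using Suc(2) by auto
  then have "degree q = n" using Suc(2) unfolding q by (subst (asm) degree_mult_eq) auto
  then have "ev \<iota> q u \<noteq> 0" using Suc(1) \<open>q \<noteq> 0\<close> by blast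
  moreover have "u - \<iota> c \<noteq> 0" using assms by auto
  moreover have "ev \<iota> p u = (u - \<iota> c) * ev \<iota> q u"
    unfolding q ev_mult by simp
  ultimately show ?case using q \<open>q \<noteq> 0\<close> by (metis ev_0 mult_eq_0_iff)
qed

lemma subfield_ev:
  assumes "subfield L fld" "range \<iota> \<subseteq> L" "u \<in> L"
  shows "ev \<iota> p u \<in> L"
proof (induction p)
  case (pCons c p)
  have "\<iota> c \<in> L" using assms(2) by auto
  then show ?case using pCons by (auto intro!: subfield_fldD(4,6)[OF assms(1)] assms(3))
qed (simp add: subfield_fldD(2)[OF assms(1)])

lemma
  shows subfield_adjoin: "subfield (adjoin \<iota> S) fld"
    and range_subset_adjoin: "range \<iota> \<subseteq> adjoin \<iota> S"
    and subset_adjoin: "S \<subseteq> adjoin \<iota> S"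
    and adjoin_least: "subfield L fld \<Longrightarrow> range \<iota> \<subseteq> L \<Longrightarrow> S \<subseteq> L \<Longrightarrow> adjoin \<iota> S \<subseteq> L"
proof -
  note E = field.generate_fieldE[OF field_fld _ refl, of "range \<iota> \<union> S"]
  show "subfield (adjoin \<iota> S) fld" "range \<iota> \<subseteq> adjoin \<iota> S" "S \<subseteq> adjoin \<iota> S"
    "subfield L fld \<Longrightarrow> range \<iota> \<subseteq> L \<Longrightarrow> S \<subseteq> L \<Longrightarrow> adjoin \<iota> S \<subseteq> L"
    using E by (auto simp: adjoin_def)
qed

lemma adjoin_singleton:
  assumes "u \<notin> range \<iota>"
  shows "adjoin \<iota> {u} = {ev \<iota> p u / ev \<iota> q u | p q. q \<noteq> 0}" (is "_ = ?R")
proof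
  have I: "ev \<iota> p u / ev \<iota> q u \<in> ?R" if "q \<noteq> 0" for p q using that by auto
  have "subfield ?R fld"
  proof (rule subfield_fldI)
    show "1 \<in> ?R" using I[of 1 1] by simp
    fix f assume "f \<in> ?R"
    then obtain p q where f: "f = ev \<iota> p u / ev \<iota> q u" "q \<noteq> 0" by auto
    show "inverse f \<in> ?R" if "f \<noteq> 0"
      using I[of p q] that f I[of p q] by (cases "p = 0") (use I[of p q] in auto)
    fix g assume "g \<in> ?R"
    then obtain r s where g: "g = ev \<iota> r u / ev \<iota> s u" "s \<noteq> 0" by auto
    have "f * g = ev \<iota> (p * r) u / ev \<iota> (q * s) u" by (simp add: f g)
    then show "f * g \<in> ?R" using I[of "q * s" "p * r"] f g by simp
    have "f - g = ev \<iota> (p * s - r * q) u / ev \<iota> (q * s) u"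
      using f(2) g(2) by (simp add: f(1) g(1) diff_frac_eq ev_eq_0_iff[OF assms])
    then show "f - g \<in> ?R" using I[of "q * s" "p * s - r * q"] f g by simp
  qed
  moreover have "\<iota> c \<in> ?R" for c using I[of 1 "[:c:]"] by simp
  moreover have "u \<in> ?R" using I[of 1 "[:0, 1:]"] by simp
  ultimately show "adjoin \<iota> {u} \<subseteq> ?R" by (intro adjoin_least) auto
  show "?R \<subseteq> adjoin \<iota> {u}"
    using subfield_ev[OF subfield_adjoin range_subset_adjoin, of u "{u}"] subset_adjoin[of "{u}"]
      subfield_fldD(8)[OF subfield_adjoin] by fastforce
qed

end

section \<open>Places\<close>

text \<open>The convention that a place takes the value 0 at 0 makes the natural condition
  \<open>v f \<ge> n\<close> wrong for \<open>f = 0\<close>; the following predicate repairs this.\<close>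

definition val_ge :: "('k::field \<Rightarrow> int) \<Rightarrow> int \<Rightarrow> 'k \<Rightarrow> bool" where
  "val_ge v n f \<longleftrightarrow> f = 0 \<or> n \<le> v f"

lemma val_ge_mono: "val_ge v n f \<Longrightarrow> m \<le> n \<Longrightarrow> val_ge v m f"
  by (auto simp: val_ge_def)

lemma val_ge_0_right [simp]: "val_ge v n 0"
  by (simp add: val_ge_def)

lemma poly_split_root:
  assumes "p \<noteq> (0::complex poly)"
  obtains q where "p = [:- c, 1:] ^ order c p * q" "poly q c \<noteq> 0"
  using order_decomp[OF assms, of c] that by (auto simp flip: poly_eq_0_iff_dvd)

locale field_over_C = const_embedding \<iota> for \<iota> :: "complex \<Rightarrow> 'k::field" +
  fixes L :: "'k set"
  assumes L: "subfield L fld" and const_L: "range \<iota> \<subseteq> L"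
begin

lemma L_closed [simp, intro]:
  "1 \<in> L" "0 \<in> L" "f \<in> L \<Longrightarrow> g \<in> L \<Longrightarrow> f - g \<in> L" "f \<in> L \<Longrightarrow> g \<in> L \<Longrightarrow> f + g \<in> L"
  "f \<in> L \<Longrightarrow> - f \<in> L" "f \<in> L \<Longrightarrow> g \<in> L \<Longrightarrow> f * g \<in> L" "f \<in> L \<Longrightarrow> inverse f \<in> L"
  "f \<in> L \<Longrightarrow> g \<in> L \<Longrightarrow> f / g \<in> L" "f \<in> L \<Longrightarrow> f ^ n \<in> L" "f \<in> L \<Longrightarrow> f powi k \<in> L"
  "\<iota> c \<in> L" "f \<in> L \<Longrightarrow> ev \<iota> p f \<in> L"
  using subfield_fldD[OF L] const_L subfield_ev[OF L const_L] by auto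

context
  fixes v
  assumes v: "is_place \<iota> L v"
begin

lemma place_0 [simp]: "v 0 = 0"
  and place_outside: "f \<notin> L \<Longrightarrow> v f = 0"
  and place_const [simp]: "v (\<iota> c) = 0"
  using v by (auto simp: is_place_def)

lemma place_mult: "f \<in> L \<Longrightarrow> g \<in> L \<Longrightarrow> f \<noteq> 0 \<Longrightarrow> g \<noteq> 0 \<Longrightarrow> v (f * g) = v f + v g"
  using v by (auto simp: is_place_def)

lemma place_1 [simp]: "v 1 = 0"
  using place_const[of 1] by simp

lemma place_inverse: "f \<in> L \<Longrightarrow> v (inverse f) = - v f"
  using place_mult[of f "inverse f"] by (cases "f = 0") auto

lemma place_divide: "f \<in> L \<Longrightarrow> g \<in> L \<Longrightarrow> f \<noteq> 0 \<Longrightarrow> g \<noteq> 0 \<Longrightarrow> v (f / g) = v f - v g"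
  using place_mult[of f "inverse g"] place_inverse[of g] by (simp add: divide_inverse)

lemma place_power: "f \<in> L \<Longrightarrow> v (f ^ n) = int n * v f"
proof (cases "f = 0")
  case False
  assume "f \<in> L"
  then show ?thesis using False by (induction n) (auto simp: place_mult algebra_simps)
qed (cases n; simp)

lemma place_powi: "f \<in> L \<Longrightarrow> v (f powi n) = n * v f"
  by (simp add: power_int_def place_power place_inverse)

lemma place_minus: "f \<in> L \<Longrightarrow> v (- f) = v f"
  using place_mult[of "\<iota> (-1)" f] place_const[of "-1"] by (cases "f = 0") (auto simp: place_const[of "-1"])

lemma val_ge_add:
  "f \<in> L \<Longrightarrow> g \<in> L \<Longrightarrow> val_ge v n f \<Longrightarrow> val_ge v n g \<Longrightarrow> val_ge v n (f + g)"
  using v unfolding is_place_def val_ge_def by fastforce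

lemma val_ge_mult:
  "f \<in> L \<Longrightarrow> g \<in> L \<Longrightarrow> val_ge v n f \<Longrightarrow> val_ge v m g \<Longrightarrow> val_ge v (n + m) (f * g)"
  using place_mult[of f g] by (cases "f = 0 \<or> g = 0") (auto simp: val_ge_def)

lemma val_ge_minus: "f \<in> L \<Longrightarrow> val_ge v n (- f) \<longleftrightarrow> val_ge v n f"
  by (auto simp: val_ge_def place_minus)

lemma val_ge_diff:
  "f \<in> L \<Longrightarrow> g \<in> L \<Longrightarrow> val_ge v n f \<Longrightarrow> val_ge v n g \<Longrightarrow> val_ge v n (f - g)"
  using val_ge_add[of f "- g" n] by (simp add: val_ge_minus)

lemma val_ge_const: "val_ge v 0 (\<iota> c)"
  by (simp add: val_ge_def)

lemma place_add_dominant: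
  assumes "f \<in> L" "g \<in> L" "f \<noteq> 0" "val_ge v (v f + 1) g"
  shows "f + g \<noteq> 0" "v (f + g) = v f"
proof -
  show n: "f + g \<noteq> 0"
  proof
    assume "f + g = 0"
    then have "g = - f" by (simp add: eq_neg_iff_add_eq_0 add.commute)
    then show False using assms by (simp add: val_ge_def place_minus)
  qed
  have "val_ge v (v f) (f + g)"
    using assms by (intro val_ge_add) (auto simp: val_ge_def)
  moreover have "\<not> val_ge v (v f + 1) (f + g)"
  proof
    assume "val_ge v (v f + 1) (f + g)"
    then have "val_ge v (v f + 1) (f + g - g)" using assms by (intro val_ge_diff) auto
    then show False using assms(3) by (simp add: val_ge_def)
  qed
  ultimately show "v (f + g) = v f" using n by (auto simp: val_ge_def)
qed

lemma val_ge_ev: "u \<in> L \<Longrightarrow> val_ge v 0 u \<Longrightarrow> val_ge v 0 (ev \<iota> p u)"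
proof (induction p)
  case (pCons c p)
  then show ?case using val_ge_mult[of u "ev \<iota> p u" 0 0]
    by (auto intro!: val_ge_add val_ge_const)
qed auto

lemma val_ge_of_shift:
  assumes "u \<in> L" "v (u - \<iota> c) > 0" shows "val_ge v 0 u"
  using val_ge_add[of "u - \<iota> c" "\<iota> c" 0] assms val_ge_const[of c] by (auto simp: val_ge_def)

lemma not_const_of_place: "v (u - \<iota> c) \<noteq> 0 \<Longrightarrow> u \<notin> range \<iota>"
proof
  assume "u \<in> range \<iota>" and a: "v (u - \<iota> c) \<noteq> 0"
  then obtain d where "u = \<iota> d" by auto
  then show False using a place_const[of "d - c"] by simp
qed

text \<open>Splitting off all factors \<open>X - c\<close> leaves a polynomial with a nonzero constant term at \<open>c\<close>,
  whose value at \<open>u\<close> is a unit.\<close>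

lemma place_ev:
  assumes u: "u \<in> L" and c: "v (u - \<iota> c) > 0" and p: "p \<noteq> 0"
  shows "v (ev \<iota> p u) = int (order c p) * v (u - \<iota> c)"
proof -
  have nc: "u \<notin> range \<iota>" by (rule not_const_of_place[of _ c]) (use c in auto)
  obtain q where q: "p = [:- c, 1:] ^ order c p * q" "poly q c \<noteq> 0"
    using poly_split_root[OF p] .
  have q0: "q \<noteq> 0" using q(2) by auto
  obtain r where "q = [:poly q c:] + [:- c, 1:] * r"
  proof -
    have "[:- c, 1:] dvd q - [:poly q c:]" by (simp flip: poly_eq_0_iff_dvd)
    then show ?thesis using that by (metis dvdE add.commute diff_add_cancel)
  qed
  then have "ev \<iota> q u = ev \<iota> [:poly q c:] u + ev \<iota> [:- c, 1:] u * ev \<iota> r u"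
    by (metis ev_add ev_mult)
  then have eq: "ev \<iota> q u = \<iota> (poly q c) + (u - \<iota> c) * ev \<iota> r u" by simp
  moreover have "val_ge v 1 ((u - \<iota> c) * ev \<iota> r u)"
    using val_ge_mult[of "u - \<iota> c" "ev \<iota> r u" 1 0] val_ge_ev[OF u val_ge_of_shift[OF u c]] c u
    by (auto simp: val_ge_def)
  ultimately have "v (ev \<iota> q u) = 0"
    using place_add_dominant[of "\<iota> (poly q c)" "(u - \<iota> c) * ev \<iota> r u"] u q(2) by auto
  moreover have "ev \<iota> p u = (u - \<iota> c) ^ order c p * ev \<iota> q u"
    by (subst q(1)) simp
  moreover have "u - \<iota> c \<noteq> 0" using c by auto
  ultimately show ?thesis
    using place_mult[of "(u - \<iota> c) ^ order c p" "ev \<iota> q u"] u q0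
    by (simp add: place_power ev_eq_0_iff[OF nc])
qed

text \<open>At a pole of \<open>u\<close> the leading term dominates all others.\<close>

lemma place_ev_pole:
  assumes u: "u \<in> L" and neg: "v u < 0"
  shows "p \<noteq> 0 \<Longrightarrow> v (ev \<iota> p u) = int (degree p) * v u"
proof (induction p)
  case (pCons c p)
  have nc: "u \<notin> range \<iota>" using not_const_of_place[of u 0] neg by auto
  show ?case
  proof (cases "p = 0")
    case False
    then have e: "ev \<iota> p u \<noteq> 0" by (simp add: ev_eq_0_iff[OF nc])
    have u0: "u \<noteq> 0" using neg by auto
    have 1: "v (u * ev \<iota> p u) = int (Suc (degree p)) * v u"
      using pCons.IH[OF False] place_mult[of u "ev \<iota> p u"] u u0 e by (simp add: algebra_simps)
    moreover have "v (u * ev \<iota> p u) < 0"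
      unfolding 1 using neg by (simp add: mult_pos_neg)
    then have "v (u * ev \<iota> p u + \<iota> c) = v (u * ev \<iota> p u)"
      using u u0 e by (intro place_add_dominant) (auto simp: val_ge_def)
    ultimately show ?thesis using False by (simp add: add.commute)
  qed (use pCons in auto)
qed simp

text \<open>An element without zeros or poles along all \<open>u - c\<close> would make the place trivial.\<close>

lemma place_lies_over_point:
  assumes u: "u \<in> L" and nc: "u \<notin> range \<iota>"
    and nt: "\<exists>p. p \<noteq> 0 \<and> v (ev \<iota> p u) \<noteq> 0"
  shows "v (inverse u) > 0 \<or> (\<exists>c. v (u - \<iota> c) > 0)"
proof (cases "v u < 0")
  case False
  show ?thesis
  proof (rule ccontr)
    assume "\<not> ?thesis"
    then have *: "v (u - \<iota> c) \<le> 0" for c by (meson not_less)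
    have "val_ge v 0 (u - \<iota> c)" for c
      using False u val_ge_const by (intro val_ge_diff) (auto simp: val_ge_def)
    then have z: "v (u - \<iota> c) = 0" for c
      using *[of c] by (metis val_ge_def order_antisym place_0)
    have "p \<noteq> 0 \<Longrightarrow> v (ev \<iota> p u) = 0" for p
    proof (induction "degree p" arbitrary: p)
      case 0
      then obtain c where "p = [:c:]" by (metis degree_eq_zeroE)
      then show ?case by simp
    next
      case (Suc n)
      then obtain c where "poly p c = 0"
        using fundamental_theorem_of_algebra[of p] constant_degree[of p] by auto
      then obtain q where q: "p = [:- c, 1:] * q"
        by (meson dvd_def poly_eq_0_iff_dvd)
      then have q0: "q \<noteq> 0" using Suc by auto
      then have "degree q = n" using Suc(2) unfolding q by (subst (asm) degree_mult_eq) auto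
      then have "v (ev \<iota> q u) = 0" using Suc q0 by blast
      moreover have "u - \<iota> c \<noteq> 0" using nc by auto
      moreover have "ev \<iota> p u = (u - \<iota> c) * ev \<iota> q u" unfolding q ev_mult by simp
      ultimately show ?case
        using place_mult[of "u - \<iota> c" "ev \<iota> q u"] u q0 z by (simp add: ev_eq_0_iff[OF nc])
    qed
    then show False using nt by blast
  qed
qed (use u in \<open>simp add: place_inverse\<close>)

end

end


subsection \<open>Places from local rings\<close>

text \<open>
  A point of a curve is given by the relation \<open>S f c\<close>: the function \<open>f\<close> is regular at the point
  and has the value \<open>c\<close> there.  It suffices that \<open>S\<close> holds on a subring whose fractions with
  nonvanishing denominators form the local ring.  If every nonzero function is a power of a
  uniformizer \<open>\<pi>\<close> times a unit, the exponents form a place, and every place of the field that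
  is centred at the point is this one.
\<close>

locale regular_functions = field_over_C \<iota> L for \<iota> :: "complex \<Rightarrow> 'k::field" and L +
  fixes S :: "'k \<Rightarrow> complex \<Rightarrow> bool" and \<pi> :: 'k
  assumes S_L: "S f c \<Longrightarrow> f \<in> L"
    and S_const: "S (\<iota> c) c"
    and S_add: "S f c \<Longrightarrow> S g d \<Longrightarrow> S (f + g) (c + d)"
    and S_mult: "S f c \<Longrightarrow> S g d \<Longrightarrow> S (f * g) (c * d)"
    and S_0: "S 0 c \<Longrightarrow> c = 0"
    and S_\<pi>: "S \<pi> 0" and \<pi>_nz: "\<pi> \<noteq> 0"
begin

definition ord_is :: "'k \<Rightarrow> int \<Rightarrow> bool" where
  "ord_is f n \<longleftrightarrow> f \<in> L \<and> (\<exists>g b m c. S g b \<and> b \<noteq> 0 \<and> S m c \<and> c \<noteq> 0 \<and> f * g = \<pi> powi n * m)"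

lemma S_unique: "S f c \<Longrightarrow> S f d \<Longrightarrow> c = d"
proof -
  assume a: "S f c" "S f d"
  have "S (\<iota> (-1) * f) (-1 * d)" by (rule S_mult[OF S_const a(2)])
  from S_add[OF a(1) this] show "c = d" using S_0[of "c - d"] by simp
qed

lemma S_nz: "S f c \<Longrightarrow> c \<noteq> 0 \<Longrightarrow> f \<noteq> 0"
  using S_0 by blast

lemma S_power: "S f c \<Longrightarrow> S (f ^ n) (c ^ n)"
  by (induction n) (use S_const[of 1] S_mult in auto)

text \<open>If \<open>n < n'\<close>, dividing the two representations by each other gives an identity in which one side
  has a nonzero value at the point and the other one is a multiple of \<open>\<pi>\<close>.\<close>

lemma ord_is_unique_aux:
  assumes "ord_is f n" "ord_is f n'" "n < n'"
  shows False
proof -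
  obtain g b m c where 1: "S g b" "b \<noteq> 0" "S m c" "c \<noteq> 0" "f * g = \<pi> powi n * m"
    using assms(1) by (auto simp: ord_is_def)
  obtain g' b' m' c' where 2: "S g' b'" "b' \<noteq> 0" "S m' c'" "c' \<noteq> 0" "f * g' = \<pi> powi n' * m'"
    using assms(2) by (auto simp: ord_is_def)
  define k where "k = nat (n' - n)"
  have k: "n' = n + int k" "k > 0" using assms(3) by (auto simp: k_def)
  have "\<pi> powi n * (m * g') = \<pi> powi n * (\<pi> ^ k * (m' * g))"
  proof -
    have "\<pi> powi n * (m * g') = f * g * g'" by (simp add: 1(5))
    also have "\<dots> = f * g' * g" by simp
    also have "\<dots> = \<pi> powi n * (\<pi> ^ k * (m' * g))"
      unfolding 2(5) k(1) using \<pi>_nz by (simp add: power_int_add)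
    finally show ?thesis .
  qed
  then have "m * g' = \<pi> ^ k * (m' * g)" using \<pi>_nz by simp
  moreover have "S (m * g') (c * b')" using 1 2 S_mult by blast
  moreover have "S (\<pi> ^ k * (m' * g)) (0 ^ k * (c' * b))" using 1 2 S_mult S_power S_\<pi> by blast
  ultimately have "c * b' = 0 ^ k * (c' * b)" using S_unique by metis
  then show False using k(2) 1(4) 2(2) by (simp add: power_0_left)
qed

lemma ord_is_unique: "ord_is f n \<Longrightarrow> ord_is f n' \<Longrightarrow> n = n'"
  using ord_is_unique_aux by (meson linorder_neqE)

lemma ord_is_unit: "S f c \<Longrightarrow> c \<noteq> 0 \<Longrightarrow> ord_is f 0"
  unfolding ord_is_def
  using S_const[of 1] S_L by (intro conjI exI[of _ 1] exI[of _ f] exI[of _ c]) auto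

lemma ord_is_mult: "ord_is f n \<Longrightarrow> ord_is g m \<Longrightarrow> ord_is (f * g) (n + m)"
proof -
  assume "ord_is f n" "ord_is g m"
  then obtain a b c d a' b' c' d' where
    1: "f \<in> L" "S a b" "b \<noteq> 0" "S c d" "d \<noteq> 0" "f * a = \<pi> powi n * c" and
    2: "g \<in> L" "S a' b'" "b' \<noteq> 0" "S c' d'" "d' \<noteq> 0" "g * a' = \<pi> powi m * c'"
    unfolding ord_is_def by blast
  have "(f * g) * (a * a') = \<pi> powi (n + m) * (c * c')"
    using 1(6) 2(6) \<pi>_nz
    by (metis (no_types, lifting) mult.assoc mult.left_commute power_int_add)
  moreover have "S (a * a') (b * b')" "S (c * c') (d * d')" using 1 2 S_mult by auto
  ultimately show ?thesis unfolding ord_is_def using 1 2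
    by (intro conjI exI[of _ "a * a'"] exI[of _ "b * b'"] exI[of _ "c * c'"] exI[of _ "d * d'"]) auto
qed

lemma ord_is_\<pi>: "ord_is \<pi> 1"
  unfolding ord_is_def
  using S_const[of 1] S_L[OF S_\<pi>] by (intro conjI exI[of _ 1]) auto

lemma ord_is_inverse: "ord_is f n \<Longrightarrow> ord_is (inverse f) (- n)"
proof -
  assume "ord_is f n"
  then obtain g b m c where 1: "f \<in> L" "S g b" "b \<noteq> 0" "S m c" "c \<noteq> 0" "f * g = \<pi> powi n * m"
    unfolding ord_is_def by blast
  then have "f \<noteq> 0" using S_nz \<pi>_nz by (metis mult_eq_0_iff power_int_eq_0_iff)
  moreover from this have "\<pi> powi n * (inverse f * m) = g"
    using 1(6) by (simp add: field_simps)
  ultimately have "inverse f * m = \<pi> powi (- n) * g"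
    using \<pi>_nz by (metis mult.assoc mult.left_commute mult.right_neutral power_int_minus right_inverse power_int_eq_0_iff)
  then show ?thesis unfolding ord_is_def using 1(1-5)
    by (intro conjI exI[of _ m] exI[of _ c] exI[of _ g] exI[of _ b]) auto
qed

lemma ord_is_power: "ord_is f n \<Longrightarrow> ord_is (f ^ k) (int k * n)"
proof (induction k)
  case 0
  then show ?case using ord_is_unit[OF S_const[of 1]] by simp
next
  case (Suc k)
  then show ?case using ord_is_mult[of f n "f ^ k" "int k * n"] by (simp add: algebra_simps)
qed

end

locale curve_point = regular_functions \<iota> L S \<pi>
  for \<iota> :: "complex \<Rightarrow> 'k::field" and L S \<pi> +
  assumes S_decomp: "f \<in> L \<Longrightarrow> f \<noteq> 0 \<Longrightarrow> \<exists>n. ord_is f n"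
begin

definition point_val :: "'k \<Rightarrow> int" where
  "point_val f = (if f \<in> L - {0} then (THE n. ord_is f n) else 0)"

lemma point_val_eqI: "ord_is f n \<Longrightarrow> f \<noteq> 0 \<Longrightarrow> point_val f = n"
  unfolding point_val_def using ord_is_unique[of f] by (metis DiffI empty_iff insert_iff ord_is_def the_equality)

lemma ord_is_point_val: "f \<in> L \<Longrightarrow> f \<noteq> 0 \<Longrightarrow> ord_is f (point_val f)"
  using S_decomp[of f] point_val_eqI[of f] by metis

lemma point_val_unit: "S f c \<Longrightarrow> c \<noteq> 0 \<Longrightarrow> point_val f = 0"
  using point_val_eqI[OF ord_is_unit] S_nz by blast

lemma point_val_\<pi>: "point_val \<pi> = 1"
  using point_val_eqI[OF ord_is_\<pi> \<pi>_nz] .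

lemma point_val_mult:
  "f \<in> L \<Longrightarrow> g \<in> L \<Longrightarrow> f \<noteq> 0 \<Longrightarrow> g \<noteq> 0 \<Longrightarrow> point_val (f * g) = point_val f + point_val g"
  by (intro point_val_eqI ord_is_mult ord_is_point_val) auto

lemma point_val_regular:
  assumes "S f c" "f \<noteq> 0"
  shows "point_val f \<ge> 0" "c = 0 \<Longrightarrow> point_val f \<ge> 1"
proof -
  have "f \<in> L" using S_L assms by blast
  from ord_is_point_val[OF this assms(2)]
  obtain g b m d where 1: "S g b" "b \<noteq> 0" "S m d" "d \<noteq> 0" "f * g = \<pi> powi (point_val f) * m"
    by (auto simp: ord_is_def)
  have fg: "S (f * g) (c * b)" by (intro S_mult 1 assms)
  show nn: "point_val f \<ge> 0"
  proof (rule ccontr)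
    assume n: "\<not> point_val f \<ge> 0"
    define k where "k = nat (- point_val f)"
    have k: "point_val f = - int k" "k > 0" using n by (auto simp: k_def)
    have "\<pi> ^ k * (f * g) = m" unfolding 1(5) k(1) using \<pi>_nz
      by (simp add: power_int_minus)
    moreover have "S (\<pi> ^ k * (f * g)) (0 ^ k * (c * b))" using fg S_mult S_power S_\<pi> by blast
    ultimately have "d = 0 ^ k * (c * b)" using S_unique 1(3) by metis
    then show False using k(2) 1(4) by simp
  qed
  show "point_val f \<ge> 1" if "c = 0"
  proof (rule ccontr)
    assume "\<not> point_val f \<ge> 1"
    then have "point_val f = 0" using nn by simp
    then have "f * g = m" using 1(5) by simp
    then show False using fg 1(3,4) S_unique that by fastforce
  qed
qed

lemma point_val_add:
  assumes f: "f \<in> L" "f \<noteq> 0" and g: "g \<in> L" "g \<noteq> 0" and fg: "f + g \<noteq> 0"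
    and le: "point_val f \<le> point_val g"
  shows "point_val f \<le> point_val (f + g)"
proof -
  obtain a b c d where 1: "S a b" "b \<noteq> 0" "S c d" "d \<noteq> 0" "f * a = \<pi> powi (point_val f) * c"
    using ord_is_point_val[OF f] unfolding ord_is_def by blast
  obtain a' b' c' d' where 2: "S a' b'" "b' \<noteq> 0" "S c' d'" "d' \<noteq> 0" "g * a' = \<pi> powi (point_val g) * c'"
    using ord_is_point_val[OF g] unfolding ord_is_def by blast
  define k where "k = nat (point_val g - point_val f)"
  have k: "point_val g = point_val f + int k" using le by (simp add: k_def)
  define M where "M = c * a' + \<pi> ^ k * (c' * a)"
  have "(f + g) * (a * a') = (f * a) * a' + (g * a') * a" by (simp add: algebra_simps)
  also have "\<dots> = \<pi> powi (point_val f) * M"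
    unfolding 1(5) 2(5) k M_def using \<pi>_nz by (simp add: power_int_add algebra_simps)
  finally have eq: "(f + g) * (a * a') = \<pi> powi (point_val f) * M" .
  have aa: "S (a * a') (b * b')" by (intro S_mult 1 2)
  have aa0: "a * a' \<noteq> 0" using S_nz[OF aa] 1 2 by simp
  have M0: "M \<noteq> 0" using eq fg aa0 by auto
  have SM: "S M (d * b' + 0 ^ k * (d' * b))"
    unfolding M_def by (intro S_add S_mult S_power S_\<pi> 1 2)
  have pk: "ord_is (\<pi> powi (point_val f)) (point_val f)"
    unfolding ord_is_def using S_L[OF S_\<pi>] S_const[of 1]
    by (intro conjI exI[of _ 1]) (auto intro!: L_closed)
  have "point_val (\<pi> powi (point_val f)) = point_val f" using point_val_eqI[OF pk] \<pi>_nz by simp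
  moreover have "point_val (a * a') = 0" using point_val_unit[OF aa] 1 2 by simp
  moreover have "point_val ((f + g) * (a * a')) = point_val (f + g) + point_val (a * a')"
    using point_val_mult f g fg aa0 S_L[OF aa] by blast
  moreover have "point_val (\<pi> powi (point_val f) * M) = point_val (\<pi> powi (point_val f)) + point_val M"
    using point_val_mult M0 S_L[OF SM] \<pi>_nz S_L[OF S_\<pi>] by auto
  ultimately show ?thesis using eq point_val_regular(1)[OF SM M0] by simp
qed

lemma is_place_point_val: "is_place \<iota> L point_val"
  unfolding is_place_def
proof (intro conjI allI ballI impI)
  show "point_val f = 0" if "f \<notin> L - {0}" for f using that by (auto simp: point_val_def)
  show "point_val (f * g) = point_val f + point_val g" if "f \<in> L - {0}" "g \<in> L - {0}" for f g
    using that point_val_mult by auto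
  show "min (point_val f) (point_val g) \<le> point_val (f + g)"
    if "f \<in> L - {0}" "g \<in> L - {0}" "f + g \<noteq> 0" for f g
    using that point_val_add[of f g] point_val_add[of g f] by (auto simp: add.commute min_def)
  show "point_val (\<iota> c) = 0" for c
  proof (cases "c = 0")
    case False
    then show ?thesis using point_val_unit[OF S_const] by auto
  qed (simp add: point_val_def)
  show "\<exists>f\<in>L. point_val f = 1" using point_val_\<pi> S_L[OF S_\<pi>] by blast
qed

text \<open>A place at which the units of the local ring are units is determined by its value at \<open>\<pi>\<close>, and
  this value is 1 because the place is normalized.\<close>

lemma place_unique:
  assumes v: "is_place \<iota> L v" and units: "\<And>f c. S f c \<Longrightarrow> c \<noteq> 0 \<Longrightarrow> v f = 0" and pos: "v \<pi> > 0"
  shows "v = point_val"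
proof -
  have *: "v f = point_val f * v \<pi>" if f: "f \<in> L" "f \<noteq> 0" for f
  proof -
    obtain g b m c where 1: "S g b" "b \<noteq> 0" "S m c" "c \<noteq> 0" "f * g = \<pi> powi (point_val f) * m"
      using ord_is_point_val[OF f] by (auto simp: ord_is_def)
    have "v f + v g = v (\<pi> powi (point_val f)) + v m"
      using arg_cong[OF 1(5), of v] f place_mult[OF v] S_L S_nz 1 S_\<pi> \<pi>_nz L_closed(10)
      by (metis power_int_eq_0_iff)
    then show ?thesis using units 1 place_powi[OF v S_L[OF S_\<pi>]] by simp
  qed
  obtain f where "f \<in> L" "v f = 1" using v by (auto simp: is_place_def)
  moreover from this have "f \<noteq> 0" using v by (auto simp: is_place_def)
  ultimately have "v \<pi> dvd 1" using * by (metis dvd_triv_right)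
  then have "v \<pi> = 1" using pos by simp
  then show ?thesis
    using * place_outside[OF v] place_0[OF v]
    by (intro ext) (auto simp: point_val_def)
qed

text \<open>The residue field is the field of constants.\<close>

lemma point_val_residue:
  assumes "f \<in> L" "f \<noteq> 0" "point_val f = 0"
  shows "\<exists>c. val_ge point_val 1 (f - \<iota> c)"
proof -
  obtain g b m c where 1: "S g b" "b \<noteq> 0" "S m c" "c \<noteq> 0" "f * g = m"
    using ord_is_point_val[OF assms(1,2)] assms(3) by (auto simp: ord_is_def)
  define r where "r = m + \<iota> (- (c / b)) * g"
  have r: "S r 0" unfolding r_def using S_add[OF 1(3) S_mult[OF S_const 1(1)], of "- (c / b)"] 1 by simp
  have g: "g \<noteq> 0" "g \<in> L" "point_val g = 0" using S_nz S_L 1 point_val_unit by auto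
  have eq: "(f - \<iota> (c / b)) * g = r"
    unfolding r_def 1(5)[symmetric] by (simp add: algebra_simps)
  have "val_ge point_val 1 (f - \<iota> (c / b))"
  proof (cases "f - \<iota> (c / b) = 0")
    case False
    then have "r \<noteq> 0" using eq g by auto
    then have "point_val r \<ge> 1" using point_val_regular[OF r] by simp
    moreover have "f - \<iota> (c / b) \<in> L" using assms(1) by (intro L_closed) 
    ultimately show ?thesis
      using False g point_val_mult[of "f - \<iota> (c / b)" g] eq by (simp add: val_ge_def)
  qed simp
  then show ?thesis by blast
qed

end

section \<open>Places of a rational function field\<close>

context const_embedding
begin

lemma field_over_C_adjoin: "field_over_C \<iota> (adjoin \<iota> S)"
  by (intro field_over_C.intro const_embedding_axioms field_over_C_axioms.intro subfield_adjoin range_subset_adjoin)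

lemma adjoin_singletonE:
  assumes "u \<notin> range \<iota>" "f \<in> adjoin \<iota> {u}" "f \<noteq> 0"
  obtains p q where "f = ev \<iota> p u / ev \<iota> q u" "q \<noteq> 0" "p \<noteq> 0"
proof -
  obtain p q where *: "f = ev \<iota> p u / ev \<iota> q u" "q \<noteq> 0"
    using assms(2) unfolding adjoin_singleton[OF assms(1)] by blast
  have "p \<noteq> 0" using * assms(3) by auto
  then show ?thesis using that * by blast
qed

lemma curve_point_rational:
  assumes u: "u \<notin> range \<iota>"
  shows "curve_point \<iota> (adjoin \<iota> {u}) (\<lambda>f a. \<exists>p. f = ev \<iota> p u \<and> a = poly p c) (u - \<iota> c)"
    (is "curve_point _ ?M ?S ?\<pi>")
proof -
  interpret M: field_over_C \<iota> ?M by (rule field_over_C_adjoin)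
  have uM: "u \<in> ?M" using subset_adjoin by blast
  interpret regular_functions \<iota> ?M ?S ?\<pi>
  proof
    show "f \<in> ?M" if "?S f a" for f a using that uM by auto
    show "?S (\<iota> a) a" for a by (intro exI[of _ "[:a:]"]) simp
    show "?S (f + g) (a + b)" if "?S f a" "?S g b" for f g a b
      using that by (metis ev_add poly_add)
    show "?S (f * g) (a * b)" if "?S f a" "?S g b" for f g a b
      using that by (metis ev_mult poly_mult)
    show "a = 0" if "?S 0 a" for a using that ev_eq_0_iff[OF u] by (metis poly_0)
    show "?S ?\<pi> 0" by (intro exI[of _ "[:- c, 1:]"]) simp
    show "?\<pi> \<noteq> 0" using u by auto
  qed
  have poly: "\<exists>n. ord_is (ev \<iota> p u) n" if p: "p \<noteq> 0" for p
  proof -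
    obtain q where q: "p = [:- c, 1:] ^ order c p * q" "poly q c \<noteq> 0"
      using poly_split_root[OF p] .
    have "ord_is (ev \<iota> q u) 0" by (rule ord_is_unit[of _ "poly q c"]) (use q(2) in auto)
    moreover have "ev \<iota> p u = ?\<pi> ^ order c p * ev \<iota> q u" by (subst q(1)) simp
    ultimately show ?thesis
      using ord_is_mult[OF ord_is_power[OF ord_is_\<pi>, of "order c p"], of "ev \<iota> q u" 0]
      by auto
  qed
  show ?thesis
  proof
    fix f assume "f \<in> ?M" "f \<noteq> 0"
    then obtain p q where "f = ev \<iota> p u / ev \<iota> q u" "q \<noteq> 0" "p \<noteq> 0"
      using adjoin_singletonE[OF u] by metis
    then show "\<exists>n. ord_is f n"
      using poly[of p] poly[of q] ord_is_mult ord_is_inverse unfolding divide_inverse by blast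
  qed
qed

lemma place_restrict_rational:
  assumes "is_place \<iota> L P" "subfield L fld" "range \<iota> \<subseteq> L" "u \<in> L" "P (u - \<iota> c) > 0"
    and "p \<noteq> 0" "q \<noteq> 0"
  shows "P (ev \<iota> p u / ev \<iota> q u)
    = (int (order c p) - int (order c q)) * P (u - \<iota> c)"
proof -
  interpret field_over_C \<iota> L by (intro field_over_C.intro const_embedding_axioms field_over_C_axioms.intro; fact)
  have u: "u \<notin> range \<iota>" by (rule not_const_of_place[OF assms(1), of _ c]) (use assms in auto)
  show ?thesis
    using place_ev[OF assms(1,4,5)] assms(4-) place_divide[OF assms(1), of "ev \<iota> p u" "ev \<iota> q u"]
    by (simp add: ev_eq_0_iff[OF u] algebra_simps)
qed

lemma rational_place_ex1:
  assumes u: "u \<notin> range \<iota>"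
  shows "\<exists>!v. is_place \<iota> (adjoin \<iota> {u}) v \<and> v (u - \<iota> c) > 0"
    and "is_place \<iota> (adjoin \<iota> {u}) v \<Longrightarrow> v (u - \<iota> c) > 0 \<Longrightarrow> v (u - \<iota> c) = 1"
proof -
  interpret curve_point \<iota> "adjoin \<iota> {u}" "\<lambda>f a. \<exists>p. f = ev \<iota> p u \<and> a = poly p c" "u - \<iota> c"
    by (rule curve_point_rational[OF u])
  have uM: "u \<in> adjoin \<iota> {u}" using subset_adjoin by blast
  have uniq: "v = point_val" if v: "is_place \<iota> (adjoin \<iota> {u}) v" "v (u - \<iota> c) > 0" for v
  proof (rule place_unique[OF v(1) _ v(2)])
    fix f a assume "\<exists>p. f = ev \<iota> p u \<and> a = poly p c" and a: "a \<noteq> 0"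
    then obtain p where p: "f = ev \<iota> p u" "a = poly p c" by blast
    then have p0: "p \<noteq> 0" using a by auto
    have "order c p = 0" using p a by (intro order_0I) simp
    then show "v f = 0" using place_ev[OF v(1) uM v(2) p0] p(1) by simp
  qed
  show "\<exists>!v. is_place \<iota> (adjoin \<iota> {u}) v \<and> v (u - \<iota> c) > 0"
  proof (rule ex1I[of _ point_val])
    show "is_place \<iota> (adjoin \<iota> {u}) point_val \<and> point_val (u - \<iota> c) > 0"
      using is_place_point_val point_val_\<pi> by simp
  qed (rule uniq, auto)
  show "v (u - \<iota> c) = 1" if "is_place \<iota> (adjoin \<iota> {u}) v" "v (u - \<iota> c) > 0"
    using uniq[OF that] point_val_\<pi> by simp
qed

definition finite_place :: "'k \<Rightarrow> complex \<Rightarrow> 'k \<Rightarrow> int" where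
  "finite_place u c = (THE v. is_place \<iota> (adjoin \<iota> {u}) v \<and> v (u - \<iota> c) > 0)"

text \<open>The point at infinity is the zero of the generator \<open>1/u\<close> of the same field, so that facts about
  finite points also serve for it.\<close>

definition infinite_place :: "'k \<Rightarrow> 'k \<Rightarrow> int" where
  "infinite_place u = finite_place (inverse u) 0"

lemma adjoin_inverse: "adjoin \<iota> {inverse u} = adjoin \<iota> {u}"
proof -
  have "adjoin \<iota> {inverse f} \<subseteq> adjoin \<iota> {f}" for f
    using subfield_fldD(7)[OF subfield_adjoin] subset_adjoin[of "{f}"]
    by (intro adjoin_least subfield_adjoin range_subset_adjoin) auto
  from this[of u] this[of "inverse u"] show ?thesis by auto
qed

lemma inverse_not_const: "u \<notin> range \<iota> \<Longrightarrow> inverse u \<notin> range \<iota>"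
  using subfield_fldD(7)[OF subfield_range, of "inverse u"] by auto

lemma finite_place:
  assumes "u \<notin> range \<iota>"
  shows "is_place \<iota> (adjoin \<iota> {u}) (finite_place u c)" "finite_place u c (u - \<iota> c) = 1"
    and "is_place \<iota> (adjoin \<iota> {u}) v \<Longrightarrow> v (u - \<iota> c) > 0 \<Longrightarrow> v = finite_place u c"
proof -
  have *: "is_place \<iota> (adjoin \<iota> {u}) (finite_place u c) \<and> finite_place u c (u - \<iota> c) > 0"
    unfolding finite_place_def by (rule theI'[OF rational_place_ex1(1)[OF assms]])
  then show "is_place \<iota> (adjoin \<iota> {u}) (finite_place u c)" "finite_place u c (u - \<iota> c) = 1"
    using rational_place_ex1(2)[OF assms] by auto
  show "is_place \<iota> (adjoin \<iota> {u}) v \<Longrightarrow> v (u - \<iota> c) > 0 \<Longrightarrow> v = finite_place u c"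
    unfolding finite_place_def by (rule the1_equality[OF rational_place_ex1(1)[OF assms], symmetric]) simp
qed

lemma infinite_place:
  assumes "u \<notin> range \<iota>"
  shows "is_place \<iota> (adjoin \<iota> {u}) (infinite_place u)" "infinite_place u (inverse u) = 1"
    and "is_place \<iota> (adjoin \<iota> {u}) v \<Longrightarrow> v (inverse u) > 0 \<Longrightarrow> v = infinite_place u"
proof -
  note * = finite_place[OF inverse_not_const[OF assms], where c = 0, unfolded adjoin_inverse emb_0 diff_zero]
  show "is_place \<iota> (adjoin \<iota> {u}) (infinite_place u)" "infinite_place u (inverse u) = 1"
    using *(1,2) by (simp_all add: infinite_place_def)
  show "v = infinite_place u" if "is_place \<iota> (adjoin \<iota> {u}) v" "v (inverse u) > 0"
    unfolding infinite_place_def by (rule *(3)[OF that])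
qed

lemma rational_place_cases:
  assumes u: "u \<notin> range \<iota>" and v: "is_place \<iota> (adjoin \<iota> {u}) v"
  obtains c where "v = finite_place u c" | "v = infinite_place u"
proof -
  interpret field_over_C \<iota> "adjoin \<iota> {u}" by (rule field_over_C_adjoin)
  have uM: "u \<in> adjoin \<iota> {u}" using subset_adjoin by blast
  obtain f where f: "f \<in> adjoin \<iota> {u}" "v f = 1" using v by (auto simp: is_place_def)
  then have "f \<noteq> 0" using v by (auto simp: is_place_def)
  then obtain p q where pq: "f = ev \<iota> p u / ev \<iota> q u" "q \<noteq> 0" "p \<noteq> 0"
    using adjoin_singletonE[OF u f(1)] by metis
  then have "v (ev \<iota> p u) \<noteq> 0 \<or> v (ev \<iota> q u) \<noteq> 0"
    using f place_divide[OF v, of "ev \<iota> p u" "ev \<iota> q u"] uM by (auto simp: ev_eq_0_iff[OF u])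
  then have "\<exists>p. p \<noteq> 0 \<and> v (ev \<iota> p u) \<noteq> 0" using pq by blast
  from place_lies_over_point[OF v uM u this] show ?thesis
    using finite_place(3)[OF u v] infinite_place(3)[OF u v] that by blast
qed

text \<open>A rational function has the same orders at \<open>c\<close> for both valuations, up to the value at the
  local parameter \<open>u - c\<close>; this makes ramification indices computable.\<close>

lemma place_restrict_finite:
  assumes P: "is_place \<iota> L P" "subfield L fld" "range \<iota> \<subseteq> L" "u \<in> L" "P (u - \<iota> c) > 0"
    and f: "f \<in> adjoin \<iota> {u}"
  shows "P f = P (u - \<iota> c) * finite_place u c f"
proof (cases "f = 0")
  case True
  interpret field_over_C \<iota> L by (intro field_over_C.intro const_embedding_axioms field_over_C_axioms.intro; fact)
  have "u \<notin> range \<iota>" by (rule not_const_of_place[OF P(1), of _ c]) (use P in auto)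
  then show ?thesis using True P(1) finite_place(1)[of u c] by (auto simp: is_place_def)
next
  case False
  interpret field_over_C \<iota> L by (intro field_over_C.intro const_embedding_axioms field_over_C_axioms.intro; fact)
  have u: "u \<notin> range \<iota>" by (rule not_const_of_place[OF P(1), of _ c]) (use P in auto)
  obtain p q where pq: "f = ev \<iota> p u / ev \<iota> q u" "q \<noteq> 0" "p \<noteq> 0"
    using adjoin_singletonE[OF u f False] by metis
  have "finite_place u c f = (int (order c p) - int (order c q)) * finite_place u c (u - \<iota> c)"
    unfolding pq(1) by (rule place_restrict_rational[OF finite_place(1)[OF u] subfield_adjoin range_subset_adjoin])
      (use pq subset_adjoin finite_place(2)[OF u] in auto)
  moreover have "P f = (int (order c p) - int (order c q)) * P (u - \<iota> c)"
    unfolding pq(1) using place_restrict_rational[OF P] pq by blast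
  ultimately show ?thesis using finite_place(2)[OF u] by simp
qed

end


section \<open>Quadratic extensions of a rational function field\<close>

text \<open>Squarefreeness of \<open>h\<close> enters only locally, as a hypothesis at the points over which a statement is made;
  so the chart at infinity is a second instance of this locale.\<close>

locale quadratic_field = const_embedding \<iota> for \<iota> :: "complex \<Rightarrow> 'k::field" +
  fixes u w :: 'k and h :: "complex poly"
  assumes u_nc: "u \<notin> range \<iota>" and w_notin: "w \<notin> adjoin \<iota> {u}" and w_sq: "w^2 = ev \<iota> h u"
begin

definition Q :: "'k set" where
  "Q = {(ev \<iota> p u + ev \<iota> q u * w) / ev \<iota> r u | p q r. r \<noteq> 0}"

lemma ev_u_eq_0 [simp]: "ev \<iota> p u = 0 \<longleftrightarrow> p = 0"
  by (rule ev_eq_0_iff[OF u_nc])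

lemma lin_eq_0 [simp]: "ev \<iota> p u + ev \<iota> q u * w = 0 \<longleftrightarrow> p = 0 \<and> q = 0"
proof
  assume a: "ev \<iota> p u + ev \<iota> q u * w = 0"
  have "q = 0"
  proof (rule ccontr)
    assume "q \<noteq> 0"
    then have "w = ev \<iota> (- p) u / ev \<iota> q u" using a by (simp add: field_simps eq_neg_iff_add_eq_0)
    then show False using w_notin \<open>q \<noteq> 0\<close> unfolding adjoin_singleton[OF u_nc] by blast
  qed
  then show "p = 0 \<and> q = 0" using a by simp
qed simp

lemma lin_mult:
  "(ev \<iota> p u + ev \<iota> q u * w) * (ev \<iota> p' u + ev \<iota> q' u * w)
    = ev \<iota> (p * p' + q * q' * h) u + ev \<iota> (p * q' + q * p') u * w"
  using w_sq by (simp add: algebra_simps power2_eq_square)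

lemma Q_I: "r \<noteq> 0 \<Longrightarrow> (ev \<iota> p u + ev \<iota> q u * w) / ev \<iota> r u \<in> Q"
  by (auto simp: Q_def)

lemma Q_lin: "ev \<iota> p u + ev \<iota> q u * w \<in> Q"
  using Q_I[of 1 p q] by simp

lemma h_nz: "h \<noteq> 0"
proof
  assume "h = 0"
  then have "w = 0" using w_sq by simp
  then show False using w_notin subfield_fldD(2)[OF subfield_adjoin] by auto
qed

lemma w_nz: "w \<noteq> 0"
  using h_nz w_sq by auto

lemma norm_nz: "p \<noteq> 0 \<or> q \<noteq> 0 \<Longrightarrow> p * p - q * q * h \<noteq> 0"
proof
  assume a: "p \<noteq> 0 \<or> q \<noteq> 0" and "p * p - q * q * h = 0"
  then have "(ev \<iota> p u + ev \<iota> q u * w) * (ev \<iota> p u + ev \<iota> (- q) u * w) = 0"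
    unfolding lin_mult by (simp add: algebra_simps)
  then show False unfolding mult_eq_0_iff lin_eq_0 using a by auto
qed

sublocale field_over_C \<iota> Q
proof (intro field_over_C.intro const_embedding_axioms field_over_C_axioms.intro)
  show "subfield Q fld"
  proof (rule subfield_fldI)
    show "1 \<in> Q" using Q_I[of 1 1 0] by simp
    fix f assume "f \<in> Q"
    then obtain p q r where f: "f = (ev \<iota> p u + ev \<iota> q u * w) / ev \<iota> r u" "r \<noteq> 0"
      by (auto simp: Q_def)
    show "inverse f \<in> Q" if "f \<noteq> 0"
    proof -
      have nz: "p \<noteq> 0 \<or> q \<noteq> 0" using that f by auto
      have "(ev \<iota> p u + ev \<iota> q u * w) * (ev \<iota> p u + ev \<iota> (- q) u * w)
          = ev \<iota> (p * p - q * q * h) u"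
        unfolding lin_mult by (simp add: algebra_simps)
      moreover have "inverse (A / R) = R * B / N" if "A * B = N" "N \<noteq> 0" for A B R N :: 'k
        using that by (auto simp: field_simps)
      ultimately have "inverse f = ev \<iota> r u * (ev \<iota> p u + ev \<iota> (- q) u * w) / ev \<iota> (p * p - q * q * h) u"
        unfolding f(1) using norm_nz[OF nz] by (simp del: ev_diff ev_mult)
      also have "\<dots> = (ev \<iota> (r * p) u + ev \<iota> (- (r * q)) u * w) / ev \<iota> (p * p - q * q * h) u"
        by (simp add: algebra_simps)
      finally have "inverse f = (ev \<iota> (r * p) u + ev \<iota> (- (r * q)) u * w) / ev \<iota> (p * p - q * q * h) u" .
      then show ?thesis using Q_I[OF norm_nz[OF nz]] by (simp del: ev_diff ev_mult ev_uminus)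
    qed
    fix g assume "g \<in> Q"
    then obtain p' q' r' where g: "g = (ev \<iota> p' u + ev \<iota> q' u * w) / ev \<iota> r' u" "r' \<noteq> 0"
      by (auto simp: Q_def)
    have fg: "f * g = (ev \<iota> (p * p' + q * q' * h) u + ev \<iota> (p * q' + q * p') u * w) / ev \<iota> (r * r') u"
      unfolding f(1) g(1) lin_mult[symmetric] by simp
    show "f * g \<in> Q" unfolding fg by (rule Q_I) (use f g in simp)
    have fg: "f - g = (ev \<iota> (p * r' - p' * r) u + ev \<iota> (q * r' - q' * r) u * w) / ev \<iota> (r * r') u"
      using f(2) g(2) unfolding f(1) g(1) by (simp add: diff_frac_eq algebra_simps)
    show "f - g \<in> Q" unfolding fg by (rule Q_I) (use f g in simp)
  qed
  show "range \<iota> \<subseteq> Q"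
  proof
    fix f assume "f \<in> range \<iota>"
    then obtain c where "f = \<iota> c" by auto
    then show "f \<in> Q" using Q_I[of 1 "[:c:]" 0] by simp
  qed
qed

lemma u_Q [simp]: "u \<in> Q" and w_Q [simp]: "w \<in> Q"
  using Q_lin[of "[:0, 1:]" 0] Q_lin[of 0 1] by simp_all

lemma adjoin_uw: "adjoin \<iota> {u, w} = Q"
proof
  show "adjoin \<iota> {u, w} \<subseteq> Q" by (rule adjoin_least[OF L const_L]) auto
  interpret A: field_over_C \<iota> "adjoin \<iota> {u, w}" by (rule field_over_C_adjoin)
  have "u \<in> adjoin \<iota> {u, w}" "w \<in> adjoin \<iota> {u, w}" using subset_adjoin[of "{u, w}"] by auto
  then show "Q \<subseteq> adjoin \<iota> {u, w}" by (auto simp: Q_def)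
qed

end

context quadratic_field
begin

text \<open>The points of the curve \<open>w\<^sup>2 = h(u)\<close> are the pairs \<open>(c, d)\<close> with \<open>d\<^sup>2 = h(c)\<close>; its regular functions are
  the polynomials in \<open>u\<close> and \<open>w\<close>.\<close>

definition regular_at :: "complex \<Rightarrow> complex \<Rightarrow> 'k \<Rightarrow> complex \<Rightarrow> bool" where
  "regular_at c d f a \<longleftrightarrow> (\<exists>p q. f = ev \<iota> p u + ev \<iota> q u * w \<and> a = poly p c + poly q c * d)"

definition uniformizer :: "complex \<Rightarrow> complex \<Rightarrow> 'k" where
  "uniformizer c d = (if d = 0 then w else u - \<iota> c)"

lemma regular_at_lin: "regular_at c d (ev \<iota> p u + ev \<iota> q u * w) (poly p c + poly q c * d)"
  unfolding regular_at_def by blast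

lemma regular_at_ev: "regular_at c d (ev \<iota> p u) (poly p c)"
  using regular_at_lin[of c d p 0] by simp

lemma regular_functions:
  assumes cd: "poly h c = d^2"
  shows "regular_functions \<iota> Q (regular_at c d) (uniformizer c d)"
proof (intro regular_functions.intro field_over_C_axioms regular_functions_axioms.intro)
  show "f \<in> Q" if "regular_at c d f a" for f a using that Q_lin by (auto simp: regular_at_def)
  show "regular_at c d (\<iota> a) a" for a using regular_at_ev[of c d "[:a:]"] by simp
  show "regular_at c d (f + g) (a + b)" if fg: "regular_at c d f a" "regular_at c d g b" for f g a b
  proof -
    obtain p q p' q' where 1: "f = ev \<iota> p u + ev \<iota> q u * w" "a = poly p c + poly q c * d"
      "g = ev \<iota> p' u + ev \<iota> q' u * w" "b = poly p' c + poly q' c * d"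
      using fg unfolding regular_at_def by blast
    show ?thesis using regular_at_lin[of c d "p + p'" "q + q'"] by (simp add: 1 algebra_simps)
  qed
  show "regular_at c d (f * g) (a * b)" if fg: "regular_at c d f a" "regular_at c d g b" for f g a b
  proof -
    obtain p q p' q' where 1: "f = ev \<iota> p u + ev \<iota> q u * w" "a = poly p c + poly q c * d"
      "g = ev \<iota> p' u + ev \<iota> q' u * w" "b = poly p' c + poly q' c * d"
      using fg unfolding regular_at_def by blast
    have "a * b = poly (p * p' + q * q' * h) c + poly (p * q' + q * p') c * d"
      using cd by (simp add: 1 algebra_simps power2_eq_square)
    then show ?thesis unfolding regular_at_def 1(1,3) lin_mult by blast
  qed
  show "a = 0" if S0: "regular_at c d 0 a" for a
  proof -
    obtain p q where 1: "0 = ev \<iota> p u + ev \<iota> q u * w" "a = poly p c + poly q c * d"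
      using S0 unfolding regular_at_def by metis
    from 1(1)[symmetric] show ?thesis using 1(2) by simp
  qed
  show "regular_at c d (uniformizer c d) 0"
    using regular_at_lin[of c d 0 1] regular_at_ev[of c d "[:- c, 1:]"] by (auto simp: uniformizer_def)
  show "uniformizer c d \<noteq> 0" using w_nz u_nc by (auto simp: uniformizer_def)
qed

lemma pair_split_root:
  assumes "p \<noteq> 0 \<or> q \<noteq> (0::complex poly)"
  obtains k p' q' where "p = [:- c, 1:] ^ k * p'" "q = [:- c, 1:] ^ k * q'"
    "poly p' c \<noteq> 0 \<or> poly q' c \<noteq> 0"
proof -
  consider "p = 0" | "q = 0" | "p \<noteq> 0" "q \<noteq> 0" by blast
  then show ?thesis
  proof cases
    case 1
    with assms have "q \<noteq> 0" by simp
    then obtain q' where "q = [:- c, 1:] ^ order c q * q'" "poly q' c \<noteq> 0"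
      using poly_split_root by metis
    then show ?thesis using that[of "order c q" 0 q'] 1 by simp
  next
    case 2
    with assms have "p \<noteq> 0" by simp
    then obtain p' where "p = [:- c, 1:] ^ order c p * p'" "poly p' c \<noteq> 0"
      using poly_split_root by metis
    then show ?thesis using that[of "order c p" p' 0] 2 by simp
  next
    case 3
    obtain p' where p: "p = [:- c, 1:] ^ order c p * p'" "poly p' c \<noteq> 0"
      using poly_split_root[OF 3(1)] .
    obtain q' where q: "q = [:- c, 1:] ^ order c q * q'" "poly q' c \<noteq> 0"
      using poly_split_root[OF 3(2)] .
    show ?thesis
    proof (cases "order c p \<le> order c q")
      case True
      then obtain j where j: "order c q = order c p + j" by (metis le_add_diff_inverse)
      have "q = [:- c, 1:] ^ order c p * ([:- c, 1:] ^ j * q')"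
        using q(1) unfolding j power_add by (simp only: mult.assoc)
      then show ?thesis using that p by blast
    next
      case False
      then obtain j where j: "order c p = order c q + j"
        by (metis le_add_diff_inverse nat_le_linear)
      have "p = [:- c, 1:] ^ order c q * ([:- c, 1:] ^ j * p')"
        using p(1) unfolding j power_add by (simp only: mult.assoc)
      then show ?thesis using that q by blast
    qed
  qed
qed

text \<open>A polynomial function without common factor \<open>X - c\<close> can vanish at \<open>(c, d)\<close> in two ways. If \<open>d \<noteq> 0\<close>, it does
  not vanish at \<open>(c, -d)\<close>, so that its order is that of its norm. If \<open>d = 0\<close>, it is a multiple of
  \<open>w\<close> by a unit, because \<open>X - c\<close> divides \<open>h\<close> exactly once.\<close>

lemma curve_point:
  assumes cd: "poly h c = d^2" and h1: "order c h \<le> 1"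
  shows "curve_point \<iota> Q (regular_at c d) (uniformizer c d)"
proof -
  interpret R: regular_functions \<iota> Q "regular_at c d" "uniformizer c d"
    by (rule regular_functions[OF cd])
  have unit_ev: "R.ord_is (ev \<iota> p u) 0" if "poly p c \<noteq> 0" for p
    using R.ord_is_unit[OF regular_at_ev that] .
  have w0: "\<exists>n. R.ord_is (u - \<iota> c) n \<and> (d = 0 \<longrightarrow> (\<exists>h'. ev \<iota> h' u * (u - \<iota> c) = w * w \<and> poly h' c \<noteq> 0))"
  proof (cases "d = 0")
    case False
    then show ?thesis using R.ord_is_\<pi> by (auto simp: uniformizer_def)
  next
    case True
    have "poly h c = 0" using cd True by simp
    then have o: "order c h = 1" using h1 order_root[of h c] h_nz by linarith
    obtain h' where h': "h = [:- c, 1:] ^ order c h * h'" "poly h' c \<noteq> 0"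
      using poly_split_root[OF h_nz] .
    then have hh: "h = [:- c, 1:] * h'" unfolding o by simp
    have "ev \<iota> h u = (u - \<iota> c) * ev \<iota> h' u" by (subst hh, subst ev_mult) simp
    then have e: "ev \<iota> h' u * (u - \<iota> c) = w * w" using w_sq by (simp add: power2_eq_square mult.commute)
    moreover have "ev \<iota> h' u \<noteq> 0" using h'(2) by auto
    ultimately have "u - \<iota> c = inverse (ev \<iota> h' u) * (w * w)" by (simp flip: e)
    moreover have "R.ord_is (w * w) 2"
      using R.ord_is_mult[OF R.ord_is_\<pi> R.ord_is_\<pi>] True by (simp add: uniformizer_def)
    ultimately have "R.ord_is (u - \<iota> c) (- 0 + 2)"
      using R.ord_is_mult[OF R.ord_is_inverse[OF unit_ev[OF h'(2)]]] by metis
    then show ?thesis using e h'(2) by blast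
  qed
  then obtain n0 where n0: "R.ord_is (u - \<iota> c) n0" by blast
  have ev: "\<exists>n. R.ord_is (ev \<iota> p u) n" if p: "p \<noteq> 0" for p
  proof -
    obtain q where q: "p = [:- c, 1:] ^ order c p * q" "poly q c \<noteq> 0"
      using poly_split_root[OF p] .
    have "ev \<iota> p u = (u - \<iota> c) ^ order c p * ev \<iota> q u" by (subst q(1)) simp
    then show ?thesis using R.ord_is_mult[OF R.ord_is_power[OF n0, of "order c p"] unit_ev[OF q(2)]]
      by auto
  qed
  have lin: "\<exists>n. R.ord_is (ev \<iota> p u + ev \<iota> q u * w) n" if nz: "poly p c \<noteq> 0 \<or> poly q c \<noteq> 0" for p q
  proof (cases "poly p c + poly q c * d = 0")
    case False
    then show ?thesis using R.ord_is_unit[OF regular_at_lin] by blast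
  next
    case True
    show ?thesis
    proof (cases "d = 0")
      case d: False
      (* at the conjugate point the function does not vanish, and the norm is a function of u *)
      have "regular_at c d (ev \<iota> p u + ev \<iota> (- q) u * w) (poly p c + poly (- q) c * d)"
        by (rule regular_at_lin)
      moreover have "poly p c + poly (- q) c * d \<noteq> 0"
      proof
        assume "poly p c + poly (- q) c * d = 0"
        then have "(poly p c + poly q c * d) - (poly p c - poly q c * d) = 0" using True by simp
        then have "2 * (poly q c * d) = 0" by (simp add: algebra_simps)
        then show False using nz d True by simp
      qed
      ultimately have bar: "R.ord_is (ev \<iota> p u + ev \<iota> (- q) u * w) 0"
        and bar_nz: "ev \<iota> p u + ev \<iota> (- q) u * w \<noteq> 0"
        using R.ord_is_unit R.S_nz by blast+
      have "p \<noteq> 0 \<or> q \<noteq> 0" using nz by auto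
      then obtain n where n: "R.ord_is (ev \<iota> (p * p - q * q * h) u) n"
        using ev[OF norm_nz] by blast
      have "(ev \<iota> p u + ev \<iota> q u * w) * (ev \<iota> p u + ev \<iota> (- q) u * w) = ev \<iota> (p * p - q * q * h) u"
        unfolding lin_mult by (simp add: algebra_simps)
      then have "ev \<iota> p u + ev \<iota> q u * w
          = ev \<iota> (p * p - q * q * h) u * inverse (ev \<iota> p u + ev \<iota> (- q) u * w)"
        using bar_nz by (simp add: eq_divide_eq flip: divide_inverse)
      then show ?thesis using R.ord_is_mult[OF n R.ord_is_inverse[OF bar]] by metis
    next
      case d: True
      then have "poly p c = 0" "poly q c \<noteq> 0" using True nz by auto
      obtain h' where h': "ev \<iota> h' u * (u - \<iota> c) = w * w" "poly h' c \<noteq> 0" using w0 d by blast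
      obtain r where r: "p = [:- c, 1:] * r" using \<open>poly p c = 0\<close> by (meson dvdE poly_eq_0_iff_dvd)
      have "(ev \<iota> p u + ev \<iota> q u * w) * ev \<iota> h' u = (ev \<iota> h' u * (u - \<iota> c)) * ev \<iota> r u + ev \<iota> q u * ev \<iota> h' u * w"
        unfolding r ev_mult by (simp add: algebra_simps)
      also have "\<dots> = w * (ev \<iota> (q * h') u + ev \<iota> r u * w)"
        unfolding h'(1) by (simp add: algebra_simps)
      finally have e: "(ev \<iota> p u + ev \<iota> q u * w) * ev \<iota> h' u = w * (ev \<iota> (q * h') u + ev \<iota> r u * w)" .
      have "ev \<iota> h' u \<noteq> 0" using h'(2) by auto
      with e have "ev \<iota> p u + ev \<iota> q u * w = w * (ev \<iota> (q * h') u + ev \<iota> r u * w) * inverse (ev \<iota> h' u)"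
        by (simp add: eq_divide_eq flip: divide_inverse)
      moreover have "R.ord_is w 1" using R.ord_is_\<pi> d by (simp add: uniformizer_def)
      moreover have "R.ord_is (ev \<iota> (q * h') u + ev \<iota> r u * w) 0"
        by (rule R.ord_is_unit[OF regular_at_lin]) (use d h' \<open>poly q c \<noteq> 0\<close> in simp)
      ultimately show ?thesis
        using R.ord_is_mult R.ord_is_inverse[OF unit_ev[OF h'(2)]] by metis
    qed
  qed
  show ?thesis
  proof (intro curve_point.intro R.regular_functions_axioms curve_point_axioms.intro)
    fix f assume "f \<in> Q" "f \<noteq> 0"
    then obtain p q r where f: "f = (ev \<iota> p u + ev \<iota> q u * w) / ev \<iota> r u" "r \<noteq> 0" "p \<noteq> 0 \<or> q \<noteq> 0"
      by (auto simp: Q_def)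
    obtain k p' q' where pq: "p = [:- c, 1:] ^ k * p'" "q = [:- c, 1:] ^ k * q'" "poly p' c \<noteq> 0 \<or> poly q' c \<noteq> 0"
      using pair_split_root[OF f(3)] .
    have "ev \<iota> p u + ev \<iota> q u * w = (u - \<iota> c) ^ k * (ev \<iota> p' u + ev \<iota> q' u * w)"
      unfolding pq(1,2) by (simp add: algebra_simps)
    then have "f = (u - \<iota> c) ^ k * (ev \<iota> p' u + ev \<iota> q' u * w) * inverse (ev \<iota> r u)"
      unfolding f(1) by (simp add: divide_inverse)
    then show "\<exists>n. R.ord_is f n"
      using R.ord_is_mult R.ord_is_inverse ev[OF f(2)] lin[OF pq(3)] R.ord_is_power[OF n0] by metis
  qed
qed


text \<open>At a point with \<open>d = 0\<close> the projection to the \<open>u\<close>-line ramifies, since then \<open>w\<close> is a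
  uniformizer and \<open>w\<^sup>2 = h(u)\<close> has a simple zero in \<open>u\<close>.\<close>

lemma branch_place:
  assumes cd: "poly h c = d^2" and h1: "order c h \<le> 1"
  obtains V where "is_place \<iota> Q V" "V (u - \<iota> c) = (if d = 0 then 2 else 1)" "d = 0 \<Longrightarrow> V w = 1"
    "val_ge V 1 (w - \<iota> d)"
    "\<And>p q. poly p c + poly q c * d \<noteq> 0 \<Longrightarrow> V (ev \<iota> p u + ev \<iota> q u * w) = 0"
    "\<And>f. f \<in> Q \<Longrightarrow> f \<noteq> 0 \<Longrightarrow> V f = 0 \<Longrightarrow> \<exists>a. val_ge V 1 (f - \<iota> a)"
    "\<And>V'. is_place \<iota> Q V' \<Longrightarrow> V' (u - \<iota> c) > 0 \<Longrightarrow> val_ge V' 1 (w - \<iota> d) \<Longrightarrow> V' = V"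
proof -
  interpret P: curve_point \<iota> Q "regular_at c d" "uniformizer c d" by (rule curve_point[OF cd h1])
  note pl = P.is_place_point_val
  have uc: "u - \<iota> c \<noteq> 0" using u_nc by auto
  have Suc0: "regular_at c d (u - \<iota> c) 0" using regular_at_ev[of c d "[:- c, 1:]"] by simp
  have Swd0: "regular_at c d (w - \<iota> d) 0"
    using regular_at_lin[of c d "[:- d:]" 1] by simp
  have pos: "P.point_val (u - \<iota> c) \<ge> 1" using P.point_val_regular[OF Suc0 uc] by simp
  have w1: "P.point_val w = 1" if "d = 0"
    using P.point_val_\<pi> that by (simp add: uniformizer_def)
  have e: "P.point_val (u - \<iota> c) = (if d = 0 then 2 else 1)"
  proof (cases "d = 0")
    case True
    have o: "order c h = 1" using cd True h1 order_root[of h c] h_nz by simp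
    have "2 * P.point_val w = P.point_val (ev \<iota> h u)"
      unfolding w_sq[symmetric] using place_power[OF pl w_Q, of 2] by simp
    also have "\<dots> = P.point_val (u - \<iota> c)" using place_ev[OF pl u_Q _ h_nz, of c] pos o by simp
    finally show ?thesis using w1 True by simp
  qed (use P.point_val_\<pi> in \<open>simp add: uniformizer_def\<close>)
  show ?thesis
  proof (rule that[of P.point_val, OF pl e w1])
    show "val_ge P.point_val 1 (w - \<iota> d)"
      using P.point_val_regular[OF Swd0] by (auto simp: val_ge_def)
    show "P.point_val (ev \<iota> p u + ev \<iota> q u * w) = 0" if "poly p c + poly q c * d \<noteq> 0" for p q
      using P.point_val_unit[OF regular_at_lin that] .
    show "\<exists>a. val_ge P.point_val 1 (f - \<iota> a)" if "f \<in> Q" "f \<noteq> 0" "P.point_val f = 0" for f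
      using P.point_val_residue that by blast
    fix V' assume V': "is_place \<iota> Q V'" "V' (u - \<iota> c) > 0" "val_ge V' 1 (w - \<iota> d)"
    have ev: "val_ge V' 1 (ev \<iota> p u - \<iota> (poly p c))" for p
    proof (cases "p = [:poly p c:]")
      case True
      then have "ev \<iota> p u = \<iota> (poly p c)" by (metis ev_pCons ev_0 add_0_right mult_zero_right)
      then show ?thesis by simp
    next
      case False
      then have nz: "p - [:poly p c:] \<noteq> 0" by simp
      have "order c (p - [:poly p c:]) \<noteq> 0" using nz order_root[of "p - [:poly p c:]" c] by simp
      moreover have "V' (ev \<iota> (p - [:poly p c:]) u) = int (order c (p - [:poly p c:])) * V' (u - \<iota> c)"
        by (rule place_ev[OF V'(1) u_Q V'(2) nz])
      ultimately have "V' (ev \<iota> (p - [:poly p c:]) u) \<ge> 1" using V'(2)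
        by (metis int_one_le_iff_zero_less mult_pos_pos of_nat_0_less_iff gr0I)
      then show ?thesis by (simp add: val_ge_def)
    qed
    have w0: "val_ge V' 0 w"
      using val_ge_add[OF V'(1), of "w - \<iota> d" "\<iota> d" 0] val_ge_const[OF V'(1)] val_ge_mono[OF V'(3), of 0] by simp
    show "V' = P.point_val"
    proof (rule P.place_unique[OF V'(1)])
      fix f a assume "regular_at c d f a" "a \<noteq> 0"
      then obtain p q where f: "f = ev \<iota> p u + ev \<iota> q u * w" "a = poly p c + poly q c * d"
        unfolding regular_at_def by metis
      define g where "g = (ev \<iota> p u - \<iota> (poly p c)) + ((ev \<iota> q u - \<iota> (poly q c)) * w + \<iota> (poly q c) * (w - \<iota> d))"
      have "val_ge V' 1 g" unfolding g_def
        using val_ge_mult[OF V'(1) _ _ ev[of q] w0] val_ge_mult[OF V'(1) _ _ val_ge_const[OF V'(1)] V'(3), of "poly q c"]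
        by (intro val_ge_add[OF V'(1)] ev) auto
      moreover have "f = \<iota> a + g" unfolding f g_def by (simp add: algebra_simps)
      ultimately show "V' f = 0"
        using place_add_dominant[OF V'(1), of "\<iota> a" g] \<open>a \<noteq> 0\<close> place_const[OF V'(1)]
        by (simp add: g_def)
    next
      show "V' (uniformizer c d) > 0"
        using V'(2,3) w_nz by (auto simp: uniformizer_def val_ge_def)
    qed
  qed
qed

text \<open>From \<open>w\<^sup>2 - d\<^sup>2 = h(u) - h(c)\<close>, one of the factors \<open>w - d\<close> and \<open>w + d\<close> vanishes at the place.\<close>

lemma place_centre:
  assumes V: "is_place \<iota> Q V" and pos: "V (u - \<iota> c) > 0"
  obtains d where "poly h c = d^2" "val_ge V 1 (w - \<iota> d)"
proof -
  obtain d where d: "poly h c = d^2" by (metis power2_csqrt)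
  have h0: "val_ge V 0 (ev \<iota> h u)" by (rule val_ge_ev[OF V u_Q val_ge_of_shift[OF V u_Q pos]])
  have "2 * V w = V (ev \<iota> h u)" unfolding w_sq[symmetric] using place_power[OF V w_Q, of 2] by simp
  then have w0: "val_ge V 0 w" using h0 h_nz by (auto simp: val_ge_def)
  have "val_ge V 1 (w - \<iota> d) \<or> val_ge V 1 (w - \<iota> (- d))"
  proof (rule ccontr)
    assume "\<not> ?thesis"
    then have n: "w - \<iota> d \<noteq> 0" "w - \<iota> (- d) \<noteq> 0" "V (w - \<iota> d) \<le> 0" "V (w - \<iota> (- d)) \<le> 0"
      by (auto simp: val_ge_def)
    have eq: "(w - \<iota> d) * (w - \<iota> (- d)) = ev \<iota> (h - [:poly h c:]) u"
      unfolding d using w_sq by (simp add: algebra_simps power2_eq_square)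
    then have nz: "h - [:poly h c:] \<noteq> 0" using n(1,2) by (metis ev_0 mult_eq_0_iff)
    have "order c (h - [:poly h c:]) \<noteq> 0" using nz order_root[of "h - [:poly h c:]" c] by simp
    then have "V (ev \<iota> (h - [:poly h c:]) u) > 0"
      using place_ev[OF V u_Q pos nz] pos by simp
    then show False
      unfolding eq[symmetric] using place_mult[OF V, of "w - \<iota> d" "w - \<iota> (- d)"] n by simp
  qed
  then show ?thesis using that[of d] that[of "- d"] d by auto
qed

definition places_over :: "complex \<Rightarrow> ('k \<Rightarrow> int) set" where
  "places_over c = {V. is_place \<iota> Q V \<and> V (u - \<iota> c) > 0}"

text \<open>Either two points \<open>(c, d)\<close> and \<open>(c, -d)\<close>, or a single one of ramification index 2.\<close>

lemma places_over_sum: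
  assumes h1: "order c h \<le> 1"
  shows "finite (places_over c)" "(\<Sum>V\<in>places_over c. V (u - \<iota> c)) = 2" "places_over c \<noteq> {}"
proof -
  obtain d where d: "poly h c = d^2" by (metis power2_csqrt)
  then have d': "poly h c = (- d)^2" by simp
  obtain V where V: "is_place \<iota> Q V" "V (u - \<iota> c) = (if d = 0 then 2 else 1)" "val_ge V 1 (w - \<iota> d)"
    "\<And>V'. is_place \<iota> Q V' \<Longrightarrow> V' (u - \<iota> c) > 0 \<Longrightarrow> val_ge V' 1 (w - \<iota> d) \<Longrightarrow> V' = V"
    by (rule branch_place[OF d h1]) (rule that)
  obtain W where W: "is_place \<iota> Q W" "W (u - \<iota> c) = (if - d = 0 then 2 else 1)" "val_ge W 1 (w - \<iota> (- d))"
    "\<And>V'. is_place \<iota> Q V' \<Longrightarrow> V' (u - \<iota> c) > 0 \<Longrightarrow> val_ge V' 1 (w - \<iota> (- d)) \<Longrightarrow> V' = W"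
    by (rule branch_place[OF d' h1]) (rule that)
  have eq: "places_over c = {V, W}"
  proof (intro equalityI subsetI)
    fix U assume "U \<in> places_over c"
    then have U: "is_place \<iota> Q U" "U (u - \<iota> c) > 0" by (auto simp: places_over_def)
    obtain e where e: "poly h c = e^2" "val_ge U 1 (w - \<iota> e)" using place_centre[OF U] .
    then have "e = d \<or> e = - d" using d by (metis power2_eq_iff)
    then show "U \<in> {V, W}" using V(4)[OF U] W(4)[OF U] e(2) by blast
  next
    fix U assume "U \<in> {V, W}"
    then show "U \<in> places_over c" using V(1,2) W(1,2) by (auto simp: places_over_def)
  qed
  show "finite (places_over c)" "places_over c \<noteq> {}" unfolding eq by auto
  show "(\<Sum>V\<in>places_over c. V (u - \<iota> c)) = 2"
  proof (cases "d = 0")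
    case True
    have "V (u - \<iota> c) > 0" "val_ge V 1 (w - \<iota> (- d))" using V(2,3) True by simp_all
    then have VW: "V = W" by (rule W(4)[OF V(1)])
    show ?thesis unfolding eq VW using True W(2) by simp
  next
    case False
    have "V \<noteq> W"
    proof
      assume VW: "V = W"
      have "val_ge V 1 ((w - \<iota> (- d)) - (w - \<iota> d))"
        unfolding VW by (rule val_ge_diff[OF W(1) _ _ W(3) V(3)[unfolded VW]]) simp_all
      moreover have "(w - \<iota> (- d)) - (w - \<iota> d) = \<iota> (2 * d)" by simp
      ultimately show False using False place_const[OF V(1), of "2 * d"] char_0 by (simp add: val_ge_def)
    qed
    then show ?thesis unfolding eq using False V(2) W(2) by simp
  qed
qed

lemma place_residue:
  assumes h1: "order c h \<le> 1" and V: "V \<in> places_over c"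
    and f: "f \<in> Q" "f \<noteq> 0" "V f = 0"
  shows "\<exists>a. val_ge V 1 (f - \<iota> a)"
proof -
  have V': "is_place \<iota> Q V" "V (u - \<iota> c) > 0" using V by (auto simp: places_over_def)
  obtain d where d: "poly h c = d^2" "val_ge V 1 (w - \<iota> d)" using place_centre[OF V'] .
  obtain W where W: "\<And>f. f \<in> Q \<Longrightarrow> f \<noteq> 0 \<Longrightarrow> W f = 0 \<Longrightarrow> \<exists>a. val_ge W 1 (f - \<iota> a)"
    "\<And>V'. is_place \<iota> Q V' \<Longrightarrow> V' (u - \<iota> c) > 0 \<Longrightarrow> val_ge V' 1 (w - \<iota> d) \<Longrightarrow> V' = W"
    by (rule branch_place[OF d(1) h1]) (rule that)
  have "V = W" by (rule W(2)[OF V' d(2)])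
  then show ?thesis using W(1) f by blast
qed

text \<open>A function without poles over \<open>c\<close> can be written without \<open>X - c\<close> in the denominator:
  otherwise its numerator would vanish at all points over \<open>c\<close>, and \<open>X - c\<close> could be cancelled.\<close>

lemma regular_over:
  assumes h1: "order c h \<le> 1" and r: "r \<noteq> 0"
    and reg: "\<And>V. V \<in> places_over c \<Longrightarrow> val_ge V 0 ((ev \<iota> p u + ev \<iota> q u * w) / ev \<iota> r u)"
    and rc: "poly r c = 0"
  shows "poly p c = 0" "poly q c = 0"
proof -
  obtain d where d: "poly h c = d^2" by (metis power2_csqrt)
  have or: "order c r \<noteq> 0" using r rc by (simp add: order_root)
  have *: "poly p c + poly q c * e = 0 \<and> (e = 0 \<longrightarrow> poly q c = 0)" if e: "poly h c = e^2" for e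
  proof -
    obtain V where V: "is_place \<iota> Q V" "V (u - \<iota> c) = (if e = 0 then 2 else 1)" "e = 0 \<Longrightarrow> V w = 1"
      and unit: "\<And>p q. poly p c + poly q c * e \<noteq> 0 \<Longrightarrow> V (ev \<iota> p u + ev \<iota> q u * w) = 0"
      by (rule branch_place[OF e h1]) (rule that)
    have pos: "V (u - \<iota> c) > 0" using V(2) by simp
    then have "V \<in> places_over c" using V(1) by (simp add: places_over_def)
    from reg[OF this] have "val_ge V 0 ((ev \<iota> p u + ev \<iota> q u * w) / ev \<iota> r u)" .
    moreover have rv: "V (ev \<iota> r u) \<ge> V (u - \<iota> c)"
      using place_ev[OF V(1) u_Q pos r] or pos by (simp add: mult_le_cancel_right1)
    ultimately have num: "val_ge V (V (u - \<iota> c)) (ev \<iota> p u + ev \<iota> q u * w)"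
      using place_divide[OF V(1), of "ev \<iota> p u + ev \<iota> q u * w" "ev \<iota> r u"] Q_lin r
      by (cases "ev \<iota> p u + ev \<iota> q u * w = 0") (auto simp: val_ge_def simp del: lin_eq_0)
    have 1: "poly p c + poly q c * e = 0"
    proof (rule ccontr)
      assume n: "poly p c + poly q c * e \<noteq> 0"
      then have "p \<noteq> 0 \<or> q \<noteq> 0" by auto
      then show False using unit[OF n] num pos by (simp add: val_ge_def)
    qed
    moreover have "poly q c = 0" if e0: "e = 0"
    proof (rule ccontr)
      assume qc: "poly q c \<noteq> 0"
      have "poly p c = 0" using 1 e0 by simp
      then have "p = 0 \<or> order c p \<noteq> 0" by (simp add: order_root)
      then have "val_ge V 2 (ev \<iota> p u)" using place_ev[OF V(1) u_Q pos, of p] V(2) e0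
        by (cases "p = 0") (auto simp: val_ge_def)
      then have "val_ge V 2 ((ev \<iota> p u + ev \<iota> q u * w) - ev \<iota> p u)"
        using num V(2) e0 by (intro val_ge_diff[OF V(1) Q_lin]) simp_all
      then have "val_ge V 2 (ev \<iota> q u * w)" by simp
      moreover have "q \<noteq> 0" "V (ev \<iota> q u) = 0" using unit[of q 0] qc by auto
      ultimately show False using place_mult[OF V(1), of "ev \<iota> q u" w] V(3)[OF e0] w_nz by (simp add: val_ge_def)
    qed
    ultimately show ?thesis by blast
  qed
  have "poly q c * d = 0"
    using *[of d] *[of "- d"] d by (auto simp: add_eq_0_iff2)
  then show "poly q c = 0" using *[of d] d by auto
  then show "poly p c = 0" using *[of d] d by simp
qed

end

section \<open>Riemann-Roch spaces\<close>

lemma dimension_scale: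
  assumes "ring.dimension fld n K E" "(a::'k::field) \<noteq> 0"
  shows "ring.dimension fld n K ((*) a ` E)"
  using assms(1)
proof (induction rule: F.dimension.induct)
  case zero_dim
  then show ?case using F.zero_dim by simp
next
  case (Suc_dim v E n K)
  have "(*) a ` F.line_extension K v E = F.line_extension K (a * v) ((*) a ` E)"
  proof (intro equalityI subsetI)
    fix y assume "y \<in> (*) a ` F.line_extension K v E"
    then obtain k e where "k \<in> K" "e \<in> E" "y = a * (k * v + e)"
      by (auto simp: F.line_extension_mem_iff)
    then show "y \<in> F.line_extension K (a * v) ((*) a ` E)" unfolding F.line_extension_mem_iff
      by (intro bexI[of _ k] bexI[of _ "a * e"]) (auto simp: algebra_simps)
  next
    fix y assume "y \<in> F.line_extension K (a * v) ((*) a ` E)"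
    then obtain k e where "k \<in> K" "e \<in> E" "y = k * (a * v) + a * e"
      by (auto simp: F.line_extension_mem_iff)
    then show "y \<in> (*) a ` F.line_extension K v E"
      by (intro image_eqI[of _ _ "k * v + e"]) (auto simp: algebra_simps F.line_extension_mem_iff)
  qed
  moreover have "a * v \<notin> (*) a ` E" using Suc_dim assms(2) by auto
  ultimately show ?case using F.Suc_dim Suc_dim by (metis UNIV_I fld_simps(1))
qed

context field_over_C
begin

abbreviation RR :: "(('k \<Rightarrow> int) \<Rightarrow> int) \<Rightarrow> 'k set" where
  "RR \<equiv> riemann_roch_space \<iota> L"

lemma RR_iff: "f \<in> RR D \<longleftrightarrow> f \<in> L \<and> (\<forall>v. is_place \<iota> L v \<longrightarrow> val_ge v (- D v) f)"
  by (auto simp: riemann_roch_space_def val_ge_def)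

lemma RR_mono:
  assumes "\<And>v. D v \<le> D' v" shows "RR D \<subseteq> RR D'"
proof
  fix f assume f: "f \<in> RR D"
  have "val_ge v (- D' v) f" if "is_place \<iota> L v" for v
    by (rule val_ge_mono[of _ "- D v"]) (use f that assms[of v] in \<open>auto simp: RR_iff\<close>)
  then show "f \<in> RR D'" using f by (simp add: RR_iff)
qed

lemma RR_add: "f \<in> RR D \<Longrightarrow> g \<in> RR D \<Longrightarrow> f + g \<in> RR D"
  by (simp add: RR_iff val_ge_add)

lemma RR_smult: "f \<in> RR D \<Longrightarrow> \<iota> c * f \<in> RR D"
proof -
  assume f: "f \<in> RR D"
  have "val_ge v (- D v) (\<iota> c * f)" if v: "is_place \<iota> L v" for v
    using val_ge_mult[OF v L_closed(11) _ val_ge_const[OF v], where g = f and m = "- D v"] f v by (simp add: RR_iff)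
  then show "\<iota> c * f \<in> RR D" using f by (simp add: RR_iff)
qed

lemma subalgebra_fldI:
  assumes "0 \<in> E" "\<And>f g. f \<in> E \<Longrightarrow> g \<in> E \<Longrightarrow> f + g \<in> E" "\<And>c f. f \<in> E \<Longrightarrow> \<iota> c * f \<in> E"
  shows "subalgebra (range \<iota>) E fld"
proof (intro subalgebra.intro subalgebra_axioms.intro F.add.subgroupI)
  show "\<ominus>\<^bsub>fld\<^esub> f \<in> E" if "f \<in> E" for f
    using assms(3)[OF that, of "-1"] by simp
qed (use assms in auto)

lemma RR_subalgebra: "subalgebra (range \<iota>) (RR D) fld"
  by (rule subalgebra_fldI) (auto simp: RR_add RR_smult, simp add: RR_iff)

text \<open>Two functions with a pole of the maximal order allowed at \<open>P\<close> have a quotient with a constant value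
  at \<open>P\<close>; so some linear combination of them has a pole of lower order.\<close>

lemma RR_step:
  assumes P: "is_place \<iota> L P"
    and res: "\<And>f. f \<in> L \<Longrightarrow> f \<noteq> 0 \<Longrightarrow> P f = 0 \<Longrightarrow> \<exists>a. val_ge P 1 (f - \<iota> a)"
    and dim: "ring.dimension fld n (range \<iota>) (RR D)"
  shows "\<exists>n'\<le>Suc n. ring.dimension fld n' (range \<iota>) (RR (D(P := D P + 1)))"
proof -
  let ?D = "D(P := D P + 1)"
  have sub: "RR D \<subseteq> RR ?D" by (rule RR_mono) auto
  show ?thesis
  proof (cases "RR ?D \<subseteq> RR D")
    case True
    then show ?thesis using sub dim by (metis le_SucI le_refl subset_antisym)
  next
    case False
    have ex: "P f = - D P - 1 \<and> f \<noteq> 0" if f: "f \<in> RR ?D" "f \<notin> RR D" for f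
    proof -
      have "f \<noteq> 0" using f(2) by (auto simp: RR_iff)
      moreover have "\<not> val_ge P (- D P) f"
        using f unfolding RR_iff by (metis fun_upd_other)
      moreover have "val_ge P (- D P - 1) f" using f(1) P unfolding RR_iff by fastforce
      ultimately show ?thesis by (auto simp: val_ge_def)
    qed
    obtain f where f: "f \<in> RR ?D" "f \<notin> RR D" using False by blast
    have fL: "f \<in> L" using f by (simp add: RR_iff)
    note fP = ex[OF f]
    have "RR ?D = F.line_extension (range \<iota>) f (RR D)"
    proof (intro equalityI subsetI)
      fix g assume "g \<in> F.line_extension (range \<iota>) f (RR D)"
      then show "g \<in> RR ?D"
        using sub f by (auto simp: F.line_extension_mem_iff intro!: RR_add RR_smult)
    next
      fix g assume g: "g \<in> RR ?D"
      show "g \<in> F.line_extension (range \<iota>) f (RR D)"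
      proof (cases "g \<in> RR D")
        case True
        then show ?thesis unfolding F.line_extension_mem_iff
          by (intro bexI[of _ "\<iota> 0"] bexI[of _ g]) auto
      next
        case False
        note gP = ex[OF g False]
        have gL: "g \<in> L" using g by (simp add: RR_iff)
        have "P (g / f) = 0" using place_divide[OF P gL fL] fP gP by simp
        then obtain a where a: "val_ge P 1 (g / f - \<iota> a)" using res[of "g / f"] gL fL fP gP by auto
        have eq: "g - \<iota> a * f = f * (g / f - \<iota> a)" using fP by (simp add: field_simps)
        have "val_ge P (- D P) (g - \<iota> a * f)"
          using val_ge_mult[OF P fL _ _ a, of "- D P - 1"] gL fL fP unfolding eq
          by (simp add: val_ge_def[of P "- D P - 1" f])
        moreover have "g - \<iota> a * f \<in> RR ?D"
          using RR_add[OF g RR_smult[OF f(1), of "- a"]] by simp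
        ultimately have "g - \<iota> a * f \<in> RR D" unfolding RR_iff by (metis fun_upd_other)
        then show ?thesis unfolding F.line_extension_mem_iff
          by (intro bexI[of _ "\<iota> a"] bexI[of _ "g - \<iota> a * f"]) auto
      qed
    qed
    then show ?thesis using F.Suc_dim[OF _ f(2) dim] by (intro exI[of _ "Suc n"]) simp
  qed
qed

lemma RR_chain:
  assumes res: "\<And>P f. is_place \<iota> L P \<Longrightarrow> f \<in> L \<Longrightarrow> f \<noteq> 0 \<Longrightarrow> P f = 0 \<Longrightarrow> \<exists>a. val_ge P 1 (f - \<iota> a)"
    and S: "finite S" "\<And>v. v \<in> S \<Longrightarrow> is_place \<iota> L v"
    and dim: "ring.dimension fld n (range \<iota>) (RR D)"
  shows "(\<And>v. D v \<le> D' v) \<Longrightarrow> (\<And>v. v \<notin> S \<Longrightarrow> D' v = D v) \<Longrightarrow> (\<Sum>v\<in>S. D' v - D v) = int k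
    \<Longrightarrow> \<exists>n'\<le>n + k. ring.dimension fld n' (range \<iota>) (RR D')"
proof (induction k arbitrary: D')
  case 0
  have "\<forall>v\<in>S. D' v - D v = 0"
    using sum_nonneg_eq_0_iff[OF S(1), of "\<lambda>v. D' v - D v"] 0(1,3) by simp
  then have "D' = D" using 0(2) by (intro ext) (metis eq_iff_diff_eq_0)
  then show ?case using dim by auto
next
  case (Suc k)
  have "\<exists>v\<in>S. D' v - D v > 0"
  proof (rule ccontr)
    assume "\<not> ?thesis"
    then have "(\<Sum>v\<in>S. D' v - D v) \<le> 0" by (intro sum_nonpos) (auto simp: not_less)
    then show False using Suc by simp
  qed
  then obtain P where P: "P \<in> S" "D' P > D P" by auto
  define D1 where "D1 = D'(P := D' P - 1)"
  have D': "D' = D1(P := D1 P + 1)" by (auto simp: D1_def)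
  have "(\<Sum>v\<in>S. D' v - D v) = (D' P - D P) + (\<Sum>v\<in>S - {P}. D' v - D v)"
    using P S by (simp add: sum.remove)
  moreover have "(\<Sum>v\<in>S. D1 v - D v) = (D1 P - D P) + (\<Sum>v\<in>S - {P}. D1 v - D v)"
    using P S by (simp add: sum.remove)
  moreover have "(\<Sum>v\<in>S - {P}. D1 v - D v) = (\<Sum>v\<in>S - {P}. D' v - D v)"
    by (intro sum.cong) (auto simp: D1_def)
  ultimately have "(\<Sum>v\<in>S. D1 v - D v) = int k" using Suc.prems(3) by (simp add: D1_def)
  moreover have "D v \<le> D1 v" for v using Suc.prems(1)[of v] P by (auto simp: D1_def)
  moreover have "D1 v = D v" if "v \<notin> S" for v using Suc.prems(2)[of v] P that by (auto simp: D1_def)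
  ultimately obtain n1 where n1: "n1 \<le> n + k" "ring.dimension fld n1 (range \<iota>) (RR D1)"
    using Suc.IH by metis
  obtain n2 where "n2 \<le> Suc n1" "ring.dimension fld n2 (range \<iota>) (RR D')"
    using RR_step[OF S(2)[OF P(1)] res n1(2)] S(2)[OF P(1)] unfolding D'[symmetric] by blast
  then show ?case using n1(1) by (intro exI[of _ n2]) auto
qed

lemma div_degree_eq_sum:
  assumes "finite S" "\<And>v. v \<notin> S \<Longrightarrow> D v = 0"
  shows "div_degree D = (\<Sum>v\<in>S. D v)"
  unfolding div_degree_def using assms by (intro sum.mono_neutral_left) auto

lemma div_dim_eqI: "ring.dimension fld n (range \<iota>) (RR D) \<Longrightarrow> div_dim \<iota> L D = n"
  unfolding div_dim_def using F.dimI[OF subfield_range] by (simp add: over_def)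

end


section \<open>The genus of a quadratic extension\<close>

lemma map_poly_reflect_poly:
  fixes f :: "'a::zero \<Rightarrow> 'b::zero"
  assumes "\<And>x. f x = 0 \<longleftrightarrow> x = 0"
  shows "map_poly f (reflect_poly p) = reflect_poly (map_poly f p)"
  using assms by (intro poly_eqI) (auto simp: coeff_map_poly coeff_reflect_poly degree_map_poly)

context quadratic_field
begin

text \<open>Cancelling common zeros of the numerator and the denominator decreases the degree of the latter.\<close>

lemma lowest_terms:
  assumes "f \<in> Q"
  obtains p q r where "f = (ev \<iota> p u + ev \<iota> q u * w) / ev \<iota> r u" "r \<noteq> 0"
    "\<And>c. poly r c = 0 \<Longrightarrow> poly p c \<noteq> 0 \<or> poly q c \<noteq> 0"
proof -
  have "r \<noteq> 0 \<Longrightarrow> f = (ev \<iota> p u + ev \<iota> q u * w) / ev \<iota> r u \<Longrightarrow> \<exists>p q r. f = (ev \<iota> p u + ev \<iota> q u * w) / ev \<iota> r u \<and> r \<noteq> 0 \<and>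
    (\<forall>c. poly r c = 0 \<longrightarrow> poly p c \<noteq> 0 \<or> poly q c \<noteq> 0)" for p q r
  proof (induction "degree r" arbitrary: p q r rule: less_induct)
    case less
    show ?case
    proof (cases "\<exists>c. poly r c = 0 \<and> poly p c = 0 \<and> poly q c = 0")
      case True
      then obtain c p1 q1 r1 where 1: "p = [:- c, 1:] * p1" "q = [:- c, 1:] * q1" "r = [:- c, 1:] * r1"
        unfolding poly_eq_0_iff_dvd dvd_def by blast
      have r1: "r1 \<noteq> 0" using less(2) 1(3) by auto
      have "degree r = 1 + degree r1"
        unfolding 1(3) by (subst degree_mult_eq) (use r1 in auto)
      moreover have "f = (ev \<iota> p1 u + ev \<iota> q1 u * w) / ev \<iota> r1 u"
      proof -
        have "ev \<iota> p u + ev \<iota> q u * w = (u - \<iota> c) * (ev \<iota> p1 u + ev \<iota> q1 u * w)"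
          "ev \<iota> r u = (u - \<iota> c) * ev \<iota> r1 u"
          unfolding 1 by (simp_all add: algebra_simps)
        moreover have "u - \<iota> c \<noteq> 0" using u_nc by auto
        ultimately show ?thesis using less(3) by simp
      qed
      ultimately show ?thesis using less(1)[of r1 p1 q1] r1 by auto
    next
      case False
      then show ?thesis using less(2,3) by blast
    qed
  qed
  then show ?thesis using assms that unfolding Q_def by blast
qed

definition lin_space :: "nat \<Rightarrow> nat \<Rightarrow> 'k set" where
  "lin_space n m = {ev \<iota> p u + ev \<iota> q u * w | p q.
    (\<forall>i\<ge>n. Polynomial.coeff p i = 0) \<and> (\<forall>i\<ge>m. Polynomial.coeff q i = 0)}"

lemma lin_spaceI:
  "(\<And>i. i \<ge> n \<Longrightarrow> Polynomial.coeff p i = 0) \<Longrightarrow> (\<And>i. i \<ge> m \<Longrightarrow> Polynomial.coeff q i = 0) \<Longrightarrow>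
    ev \<iota> p u + ev \<iota> q u * w \<in> lin_space n m"
  unfolding lin_space_def by blast

lemma lin_space_unique:
  assumes "ev \<iota> p u + ev \<iota> q u * w \<in> lin_space n m"
  shows "i \<ge> n \<Longrightarrow> Polynomial.coeff p i = 0" "i \<ge> m \<Longrightarrow> Polynomial.coeff q i = 0"
proof -
  obtain p' q' where 1: "ev \<iota> p u + ev \<iota> q u * w = ev \<iota> p' u + ev \<iota> q' u * w"
    "\<forall>i\<ge>n. Polynomial.coeff p' i = 0" "\<forall>i\<ge>m. Polynomial.coeff q' i = 0"
    using assms unfolding lin_space_def by blast
  have "ev \<iota> (p - p') u + ev \<iota> (q - q') u * w = 0" using 1(1) by (simp add: algebra_simps)
  then have "p = p'" "q = q'" unfolding lin_eq_0 by simp_all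
  then show "i \<ge> n \<Longrightarrow> Polynomial.coeff p i = 0" "i \<ge> m \<Longrightarrow> Polynomial.coeff q i = 0" using 1 by auto
qed

lemma dimension_lin_space: "ring.dimension fld (n + m) (range \<iota>) (lin_space n m)"
proof (induction m)
  case 0
  show ?case
  proof (induction n)
    case 0
    have "lin_space 0 0 = {0}"
    proof (intro equalityI subsetI)
      fix f assume "f \<in> lin_space 0 0"
      then obtain p q where "f = ev \<iota> p u + ev \<iota> q u * w"
        "\<forall>i. Polynomial.coeff p i = 0" "\<forall>i. Polynomial.coeff q i = 0"
        unfolding lin_space_def by auto
      then show "f \<in> {0}" by (simp add: poly_eq_iff[symmetric] flip: coeff_0) (metis coeff_0 ev_0 poly_eqI add_0 mult_zero_left)
    qed (use lin_spaceI[of 0 0 0 0] in auto)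
    then show ?case using F.zero_dim by simp
  next
    case (Suc n)
    have "lin_space (Suc n) 0 = F.line_extension (range \<iota>) (u ^ n) (lin_space n 0)"
    proof (intro equalityI subsetI)
      fix f assume "f \<in> lin_space (Suc n) 0"
      then obtain p q where f: "f = ev \<iota> p u + ev \<iota> q u * w"
        "\<forall>i\<ge>Suc n. Polynomial.coeff p i = 0" "\<forall>i\<ge>0. Polynomial.coeff q i = 0"
        unfolding lin_space_def by blast
      let ?c = "Polynomial.coeff p n"
      have "ev \<iota> (p - Polynomial.monom ?c n) u + ev \<iota> q u * w \<in> lin_space n 0"
        using f(2,3) by (intro lin_spaceI) (auto simp: Suc_le_eq)
      moreover have "f = \<iota> ?c * u ^ n + (ev \<iota> (p - Polynomial.monom ?c n) u + ev \<iota> q u * w)"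
        unfolding f by simp
      ultimately show "f \<in> F.line_extension (range \<iota>) (u ^ n) (lin_space n 0)"
        unfolding F.line_extension_mem_iff fld_simps by blast
    next
      fix f assume "f \<in> F.line_extension (range \<iota>) (u ^ n) (lin_space n 0)"
      then obtain c p q where f: "f = \<iota> c * u ^ n + (ev \<iota> p u + ev \<iota> q u * w)"
        "\<forall>i\<ge>n. Polynomial.coeff p i = 0" "\<forall>i\<ge>0. Polynomial.coeff q i = 0"
        unfolding F.line_extension_mem_iff fld_simps lin_space_def by blast
      have "ev \<iota> (Polynomial.monom c n + p) u + ev \<iota> q u * w \<in> lin_space (Suc n) 0"
        using f(2,3) by (intro lin_spaceI) auto
      then show "f \<in> lin_space (Suc n) 0" unfolding f by (simp add: algebra_simps)
    qed
    moreover have "u ^ n \<notin> lin_space n 0"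
      using lin_space_unique(1)[of "Polynomial.monom 1 n" 0 n 0 n] by auto
    ultimately show ?case using F.Suc_dim[of "u ^ n" "lin_space n 0" "n + 0" "range \<iota>"] Suc by simp
  qed
next
  case (Suc m)
  have "lin_space n (Suc m) = F.line_extension (range \<iota>) (u ^ m * w) (lin_space n m)"
  proof (intro equalityI subsetI)
    fix f assume "f \<in> lin_space n (Suc m)"
    then obtain p q where f: "f = ev \<iota> p u + ev \<iota> q u * w"
      "\<forall>i\<ge>n. Polynomial.coeff p i = 0" "\<forall>i\<ge>Suc m. Polynomial.coeff q i = 0"
      unfolding lin_space_def by blast
    let ?c = "Polynomial.coeff q m"
    have "ev \<iota> p u + ev \<iota> (q - Polynomial.monom ?c m) u * w \<in> lin_space n m"
      using f(2,3) by (intro lin_spaceI) (auto simp: Suc_le_eq)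
    moreover have "f = \<iota> ?c * (u ^ m * w) + (ev \<iota> p u + ev \<iota> (q - Polynomial.monom ?c m) u * w)"
      unfolding f by (simp add: algebra_simps)
    ultimately show "f \<in> F.line_extension (range \<iota>) (u ^ m * w) (lin_space n m)"
      unfolding F.line_extension_mem_iff fld_simps by blast
  next
    fix f assume "f \<in> F.line_extension (range \<iota>) (u ^ m * w) (lin_space n m)"
    then obtain c p q where f: "f = \<iota> c * (u ^ m * w) + (ev \<iota> p u + ev \<iota> q u * w)"
      "\<forall>i\<ge>n. Polynomial.coeff p i = 0" "\<forall>i\<ge>m. Polynomial.coeff q i = 0"
      unfolding F.line_extension_mem_iff fld_simps lin_space_def by blast
    have "ev \<iota> p u + ev \<iota> (Polynomial.monom c m + q) u * w \<in> lin_space n (Suc m)"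
      using f(2,3) by (intro lin_spaceI) auto
    then show "f \<in> lin_space n (Suc m)" unfolding f by (simp add: algebra_simps)
  qed
  moreover have "u ^ m * w \<notin> lin_space n m"
    using lin_space_unique(2)[of 0 "Polynomial.monom 1 m" n m m] by auto
  ultimately show ?case
    using F.Suc_dim[of "u ^ m * w" "lin_space n m" "n + m" "range \<iota>"] Suc by simp
qed

end

locale hyperelliptic_field = quadratic_field \<iota> u w h
  for \<iota> :: "complex \<Rightarrow> 'k::field" and u w h +
  fixes g :: nat
  assumes deg_h: "degree h = 2 * g + 1 \<or> degree h = 2 * g + 2"
    and sqfree: "order c h \<le> 1"
begin

text \<open>The chart at infinity: \<open>1/u\<close> and \<open>w / u^(g + 1)\<close> generate the same field and satisfy an equation of the
  same form. The power of \<open>X\<close> in front, which is 0 or 1, makes infinity a branch point for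
  odd degree.\<close>

definition h_inf :: "complex poly" where
  "h_inf = Polynomial.monom 1 (2 * g + 2 - degree h) * reflect_poly h"

definition w_inf :: 'k where
  "w_inf = w * inverse u ^ (g + 1)"

lemma u_nz: "u \<noteq> 0"
  using u_nc by (metis emb_0 rangeI)

lemma ev_reflect: "ev \<iota> (reflect_poly p) (inverse u) = inverse u ^ degree p * ev \<iota> p u"
  using u_nz poly_reflect_poly_nz[of "inverse u" "map_poly \<iota> p"]
  by (simp add: map_poly_reflect_poly degree_map_poly)

lemma w_inf_sq: "w_inf ^ 2 = ev \<iota> h_inf (inverse u)"
proof -
  have "w_inf ^ 2 = inverse u ^ (2 * g + 2) * ev \<iota> h u"
  proof -
    have "(g + 1) * 2 = 2 * g + 2" by simp
    then have "(inverse u ^ (g + 1)) ^ 2 = inverse u ^ (2 * g + 2)" by (metis power_mult)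
    then show ?thesis unfolding w_inf_def power_mult_distrib w_sq by (simp only: mult.commute)
  qed
  also have "2 * g + 2 = (2 * g + 2 - degree h) + degree h" using deg_h by auto
  finally show ?thesis unfolding h_inf_def by (simp only: power_add ev_mult ev_monom ev_reflect) simp
qed

lemma order_h_inf: "order 0 h_inf \<le> 1"
proof -
  have r: "poly (reflect_poly h) 0 \<noteq> 0" using h_nz by simp
  show ?thesis
  proof (cases "degree h = 2 * g + 2")
    case True
    moreover have "lead_coeff h \<noteq> 0" using h_nz by simp
    ultimately have "poly h_inf 0 \<noteq> 0" by (simp add: h_inf_def monom_0)
    then show ?thesis by (simp add: order_0I)
  next
    case False
    then have e: "h_inf = [:- 0, 1:] * reflect_poly h" using deg_h by (simp add: h_inf_def monom_Suc)
    show ?thesis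
    proof (rule ccontr)
      assume "\<not> ?thesis"
      then have "[:- 0, 1:] ^ 2 dvd h_inf" by (intro order_divides[THEN iffD2]) auto
      then have "[:- 0, 1::complex:] * [:- 0, 1:] dvd [:- 0, 1:] * reflect_poly h"
        unfolding e power2_eq_square .
      then have "[:- 0, 1:] dvd reflect_poly h" by (subst (asm) dvd_mult_cancel_left) simp
      then show False using r by (simp only: poly_eq_0_iff_dvd[symmetric])
    qed
  qed
qed

lemma w_inf_notin: "w_inf \<notin> adjoin \<iota> {inverse u}"
proof
  assume "w_inf \<in> adjoin \<iota> {inverse u}"
  then have "w_inf \<in> adjoin \<iota> {u}" by (simp add: adjoin_inverse)
  moreover have "u \<in> adjoin \<iota> {u}" using subset_adjoin by blast
  ultimately have "w_inf * u ^ (g + 1) \<in> adjoin \<iota> {u}"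
    using subfield_fldD(6,9)[OF subfield_adjoin] by metis
  moreover have "w_inf * u ^ (g + 1) = w"
    using u_nz by (simp add: w_inf_def field_simps)
  ultimately show False using w_notin by simp
qed

sublocale inf: quadratic_field \<iota> "inverse u" w_inf h_inf
  by (intro quadratic_field.intro const_embedding_axioms quadratic_field_axioms.intro
      inverse_not_const u_nc w_inf_notin w_inf_sq)

lemma inf_Q: "inf.Q = Q"
proof
  have "w_inf * inverse (inverse u) ^ (g + 1) \<in> inf.Q"
    by (intro inf.L_closed(6,7,9) inf.w_Q inf.u_Q)
  moreover have "w_inf * inverse (inverse u) ^ (g + 1) = w"
    using u_nz by (simp add: w_inf_def field_simps)
  ultimately have "w \<in> inf.Q" by metis
  moreover have "u \<in> inf.Q" using inf.L_closed(7)[OF inf.u_Q] by simp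
  ultimately show "Q \<subseteq> inf.Q" unfolding adjoin_uw[symmetric] using inf.L inf.const_L by (intro adjoin_least) auto
  have "inverse u \<in> Q" "w_inf \<in> Q" by (auto simp: w_inf_def)
  then show "inf.Q \<subseteq> Q" unfolding inf.adjoin_uw[symmetric] using L const_L by (intro adjoin_least) auto
qed

definition places_inf :: "('k \<Rightarrow> int) set" where
  "places_inf = inf.places_over 0"

lemma places_inf_iff: "V \<in> places_inf \<longleftrightarrow> is_place \<iota> Q V \<and> V (inverse u) > 0"
  by (simp add: places_inf_def inf.places_over_def inf_Q)

lemma places_inf_sum:
  "finite places_inf" "(\<Sum>V\<in>places_inf. V (inverse u)) = 2" "places_inf \<noteq> {}"
  using inf.places_over_sum[OF order_h_inf] by (simp_all add: places_inf_def)

text \<open>A place at which all nonzero polynomials in \<open>u\<close> are units would be trivial: the norm of \<open>p(u) + q(u) w\<close>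
  would be a unit, and with it the conjugate factors, which are both regular.\<close>

lemma place_cases:
  assumes V: "is_place \<iota> Q V"
  shows "V \<in> places_inf \<or> (\<exists>c. V \<in> places_over c)"
proof -
  have "\<exists>p. p \<noteq> 0 \<and> V (ev \<iota> p u) \<noteq> 0"
  proof (rule ccontr)
    assume "\<not> ?thesis"
    then have z: "V (ev \<iota> p u) = 0" for p using place_0[OF V] by (cases "p = 0") auto
    have "2 * V w = 0" using place_power[OF V w_Q, of 2] z[of h] w_sq by simp
    then have w0: "val_ge V 0 w" by (simp add: val_ge_def)
    have ge: "val_ge V 0 (ev \<iota> p u + ev \<iota> q u * w)" for p q
      using val_ge_mult[OF V _ _ _ w0, of "ev \<iota> q u" 0] z by (intro val_ge_add[OF V]) (auto simp: val_ge_def)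
    have lin: "V (ev \<iota> p u + ev \<iota> q u * w) = 0" if nz: "p \<noteq> 0 \<or> q \<noteq> 0" for p q
    proof -
      have N: "(ev \<iota> p u + ev \<iota> q u * w) * (ev \<iota> p u + ev \<iota> (- q) u * w) = ev \<iota> (p * p - q * q * h) u"
        unfolding lin_mult by (simp add: algebra_simps)
      have n: "ev \<iota> p u + ev \<iota> q u * w \<noteq> 0" "ev \<iota> p u + ev \<iota> (- q) u * w \<noteq> 0"
        using nz unfolding lin_eq_0 by auto
      have "V (ev \<iota> p u + ev \<iota> q u * w) + V (ev \<iota> p u + ev \<iota> (- q) u * w) = 0"
        using place_mult[OF V Q_lin Q_lin n] z[of "p * p - q * q * h"] unfolding N by linarith
      moreover have "0 \<le> V (ev \<iota> p u + ev \<iota> q u * w)" using ge[of p q] n(1) unfolding val_ge_def by blast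
      moreover have "0 \<le> V (ev \<iota> p u + ev \<iota> (- q) u * w)" using ge[of p "- q"] n(2) unfolding val_ge_def by blast
      ultimately show ?thesis by linarith
    qed
    obtain f where f: "f \<in> Q" "V f = 1" using V unfolding is_place_def by blast
    have f0: "f \<noteq> 0" using place_0[OF V] f(2) by (metis zero_neq_one)
    obtain p q r where pqr: "f = (ev \<iota> p u + ev \<iota> q u * w) / ev \<iota> r u" "r \<noteq> 0"
      using f(1) unfolding Q_def by blast
    then have pq: "p \<noteq> 0 \<or> q \<noteq> 0" using f0 by auto
    then have "V f = V (ev \<iota> p u + ev \<iota> q u * w) - V (ev \<iota> r u)"
      unfolding pqr(1) using pqr(2) by (intro place_divide[OF V Q_lin]) auto
    then show False using lin[OF pq] z[of r] f(2) by linarith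
  qed
  from place_lies_over_point[OF V u_Q u_nc this] show ?thesis
    using V by (auto simp: places_inf_iff places_over_def)
qed

lemma residue:
  assumes V: "is_place \<iota> Q V" and f: "f \<in> Q" "f \<noteq> 0" "V f = 0"
  shows "\<exists>a. val_ge V 1 (f - \<iota> a)"
  using place_cases[OF V]
proof (elim disjE exE)
  assume "V \<in> places_inf"
  then show ?thesis
    using inf.place_residue[OF order_h_inf, of V f] f by (simp add: places_inf_def inf_Q)
next
  fix c assume "V \<in> places_over c"
  then show ?thesis using place_residue[OF sqfree[of c]] f by blast
qed


lemma place_finite_or_inf:
  assumes "is_place \<iota> Q V"
  shows "V \<in> places_inf \<longleftrightarrow> V u < 0"
  using assms by (simp add: places_inf_iff place_inverse)

lemma val_w: "is_place \<iota> Q V \<Longrightarrow> 2 * V w = V (ev \<iota> h u)"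
  using place_power[OF _ w_Q, of V 2] by (simp add: w_sq)

text \<open>The \<open>N\<close>-fold of the pole divisor of \<open>u\<close>.\<close>

definition pole_div :: "nat \<Rightarrow> ('k \<Rightarrow> int) \<Rightarrow> int" where
  "pole_div N V = (if V \<in> places_inf then int N * V (inverse u) else 0)"

text \<open>Regularity over all finite points cancels the denominator, regularity of \<open>f / u\<^sup>N\<close> at infinity bounds
  the degrees.\<close>

lemma RR_pole_div:
  assumes N: "N \<ge> g"
  shows "RR (pole_div N) = lin_space (N + 1) (N - g)"
proof (intro equalityI subsetI)
  fix f assume f: "f \<in> RR (pole_div N)"
  then have fQ: "f \<in> Q" and fV: "\<And>V. is_place \<iota> Q V \<Longrightarrow> val_ge V (- pole_div N V) f" by (auto simp: RR_iff)
  obtain p q r where pqr: "f = (ev \<iota> p u + ev \<iota> q u * w) / ev \<iota> r u" "r \<noteq> 0"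
    "\<And>c. poly r c = 0 \<Longrightarrow> poly p c \<noteq> 0 \<or> poly q c \<noteq> 0"
    by (rule lowest_terms[OF fQ]) (rule that)
  have "poly r c \<noteq> 0" for c
  proof
    assume rc: "poly r c = 0"
    have "val_ge V 0 f" if V: "V \<in> places_over c" for V
    proof -
      have V': "is_place \<iota> Q V" "V (u - \<iota> c) > 0" using V by (auto simp: places_over_def)
      have "V \<notin> places_inf" using val_ge_of_shift[OF V'(1) u_Q V'(2)] u_nz
        by (simp add: place_finite_or_inf[OF V'(1)] val_ge_def)
      then show ?thesis using fV[OF V'(1)] by (simp add: pole_div_def)
    qed
    then show False using regular_over[OF sqfree pqr(2) _ rc, of p q] pqr(3)[OF rc] unfolding pqr(1) by blast
  qed
  then have "degree r = 0"
    using fundamental_theorem_of_algebra[of r] constant_degree[of r] by blast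
  then obtain a where a: "r = [:a:]" "a \<noteq> 0" using pqr(2) by (metis degree_eq_zeroE pCons_0_0)
  define P where "P = Polynomial.smult (inverse a) p"
  define R where "R = Polynomial.smult (inverse a) q"
  have fPR: "f = ev \<iota> P u + ev \<iota> R u * w"
    unfolding pqr(1) P_def R_def a(1) using a(2) by (simp add: field_simps)
  have fN: "f * inverse u ^ N \<in> inf.Q" unfolding inf_Q using fQ by auto
  obtain p' q' r' where 2: "f * inverse u ^ N = (ev \<iota> p' (inverse u) + ev \<iota> q' (inverse u) * w_inf) / ev \<iota> r' (inverse u)" "r' \<noteq> 0"
    "\<And>c. poly r' c = 0 \<Longrightarrow> poly p' c \<noteq> 0 \<or> poly q' c \<noteq> 0"
    by (rule inf.lowest_terms[OF fN]) (rule that)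
  have r'0: "poly r' 0 \<noteq> 0"
  proof
    assume rc: "poly r' 0 = 0"
    have "val_ge V 0 (f * inverse u ^ N)" if V: "V \<in> inf.places_over 0" for V
    proof -
      have V': "V \<in> places_inf" "is_place \<iota> Q V" using V by (auto simp: places_inf_def inf.places_over_def inf_Q)
      have "val_ge V (- pole_div N V + pole_div N V) (f * inverse u ^ N)"
        using V' place_power[OF V'(2), of "inverse u" N]
        by (intro val_ge_mult[OF V'(2)] fV fQ) (auto simp: val_ge_def pole_div_def)
      then show ?thesis by simp
    qed
    then show False
      using inf.regular_over[OF order_h_inf 2(2) _ rc, of p' q'] 2(3)[OF rc] unfolding 2(1) by blast
  qed
  obtain V where V: "V \<in> places_inf" using places_inf_sum(3) by blast
  then have pl: "is_place \<iota> Q V" and pos: "V (inverse u) > 0" by (simp_all add: places_inf_iff)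
  have neg: "V u < 0" using place_finite_or_inf[OF pl] V by simp
  define e where "e = V (inverse u)"
  have ue: "V u = - e" "e > 0" using place_inverse[OF pl u_Q] pos by (simp_all add: e_def)
  have iu: "inverse u \<in> Q" "V (inverse u - \<iota> 0) > 0" using pos by auto
  have evr: "V (ev \<iota> r' (inverse u)) = 0"
    using place_ev[OF pl iu 2(2)] r'0 by (simp add: order_0I)
  have reg: "val_ge V 0 (ev \<iota> s (inverse u))" for s
    by (rule val_ge_ev[OF pl iu(1)]) (use pos in \<open>simp add: val_ge_def\<close>)
  let ?s = "ev \<iota> r' (inverse u) * inverse u ^ N"
  have s: "?s \<noteq> 0" "?s \<in> Q" using 2(2) u_nz by auto
  have sV: "V ?s = int N * e"
    using place_mult[OF pl, of "ev \<iota> r' (inverse u)" "inverse u ^ N"] place_power[OF pl iu(1), of N] 2(2) u_nz evr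
    by (simp add: e_def)
  (* compare the two representations of f in the basis 1, w *)
  have "(ev \<iota> P u * ?s - ev \<iota> p' (inverse u)) + (ev \<iota> R u * ?s - ev \<iota> q' (inverse u) * inverse u ^ (g + 1)) * w = 0"
  proof -
    have "f * ?s = ev \<iota> p' (inverse u) + ev \<iota> q' (inverse u) * w_inf"
    proof -
      have "f * ?s = ev \<iota> r' (inverse u) * (f * inverse u ^ N)" by simp
      also have "\<dots> = ev \<iota> p' (inverse u) + ev \<iota> q' (inverse u) * w_inf"
        unfolding 2(1) using 2(2) by simp
      finally show ?thesis .
    qed
    then show ?thesis unfolding fPR w_inf_def by (simp add: algebra_simps)
  qed
  moreover have M: "ev \<iota> P u * ?s - ev \<iota> p' (inverse u) \<in> adjoin \<iota> {u}"
    "ev \<iota> R u * ?s - ev \<iota> q' (inverse u) * inverse u ^ (g + 1) \<in> adjoin \<iota> {u}"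
  proof -
    interpret M: field_over_C \<iota> "adjoin \<iota> {u}" by (rule field_over_C_adjoin)
    have "u \<in> adjoin \<iota> {u}" using subset_adjoin by blast
    then show "ev \<iota> P u * ?s - ev \<iota> p' (inverse u) \<in> adjoin \<iota> {u}"
      "ev \<iota> R u * ?s - ev \<iota> q' (inverse u) * inverse u ^ (g + 1) \<in> adjoin \<iota> {u}"
      by (auto intro!: M.L_closed)
  qed
  moreover have "A = 0 \<and> B = 0" if AB: "A + B * w = 0" "A \<in> adjoin \<iota> {u}" "B \<in> adjoin \<iota> {u}" for A B
  proof (cases "B = 0")
    case False
    then have "w = - A / B" using AB(1) by (simp add: field_simps eq_neg_iff_add_eq_0)
    then show ?thesis
      using w_notin subfield_fldD(5,8)[OF subfield_adjoin] AB by metis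
  qed (use AB in simp)
  ultimately have eqs: "ev \<iota> P u * ?s = ev \<iota> p' (inverse u)"
    "ev \<iota> R u * ?s = ev \<iota> q' (inverse u) * inverse u ^ (g + 1)"
    by (metis eq_iff_diff_eq_0)+
  have degP: "degree P \<le> N" if "P \<noteq> 0"
  proof -
    have "V (ev \<iota> P u * ?s) = - int (degree P) * e + int N * e"
      using place_mult[OF pl _ s(2) _ s(1), of "ev \<iota> P u"] place_ev_pole[OF pl u_Q neg that] that sV ue by simp
    moreover have "ev \<iota> P u * ?s \<noteq> 0" using that s by simp
    then have "0 \<le> V (ev \<iota> P u * ?s)"
      using reg[of p'] unfolding eqs(1)[symmetric] val_ge_def by blast
    ultimately have "(int N - int (degree P)) * e \<ge> 0"
      by (simp only: left_diff_distrib)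
    then show ?thesis using ue(2) by (simp add: zero_le_mult_iff)
  qed
  have degR: "degree R < N - g" if "R \<noteq> 0"
  proof -
    have "V (ev \<iota> R u * ?s) = - int (degree R) * e + int N * e"
      using place_mult[OF pl _ s(2) _ s(1), of "ev \<iota> R u"] place_ev_pole[OF pl u_Q neg that] that sV ue by simp
    moreover have "ev \<iota> R u * ?s \<noteq> 0" using that s by simp
    moreover have "val_ge V (0 + int (g + 1) * e) (ev \<iota> q' (inverse u) * inverse u ^ (g + 1))"
      using place_power[OF pl iu(1), of "g + 1"] iu(1)
      by (intro val_ge_mult[OF pl _ _ reg]) (auto simp: val_ge_def e_def)
    ultimately have "0 + int (g + 1) * e \<le> - int (degree R) * e + int N * e"
      unfolding eqs(2)[symmetric] val_ge_def by metis
    then have "(int N - int (degree R) - int (g + 1)) * e \<ge> 0"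
      by (simp only: left_diff_distrib)
    then have "int N - int (degree R) - int (g + 1) \<ge> 0"
      using ue(2) by (simp add: zero_le_mult_iff)
    then show ?thesis by simp
  qed
  show "f \<in> lin_space (N + 1) (N - g)" unfolding fPR
  proof (rule lin_spaceI)
    show "Polynomial.coeff P i = 0" if "i \<ge> N + 1" for i
      using degP that by (cases "P = 0") (auto intro!: coeff_eq_0)
    show "Polynomial.coeff R i = 0" if "i \<ge> N - g" for i
      using degR that by (cases "R = 0") (auto intro!: coeff_eq_0)
  qed
next
  fix f assume "f \<in> lin_space (N + 1) (N - g)"
  then obtain p q where f: "f = ev \<iota> p u + ev \<iota> q u * w"
    "\<forall>i\<ge>N + 1. Polynomial.coeff p i = 0" "\<forall>i\<ge>N - g. Polynomial.coeff q i = 0"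
    unfolding lin_space_def by blast
  have dp: "degree p \<le> N" if "p \<noteq> 0"
    using f(2) that by (metis leading_coeff_0_iff not_less_eq_eq Suc_eq_plus1)
  have dq: "degree q + g + 1 \<le> N" if "q \<noteq> 0"
    using f(3) that N by (metis leading_coeff_0_iff not_le add.commute add_Suc_right Suc_eq_plus1 less_diff_conv Suc_leI)
  have "val_ge V (- pole_div N V) f" if V: "is_place \<iota> Q V" for V
  proof (cases "V u < 0")
    case False
    then have "V \<notin> places_inf" using place_finite_or_inf[OF V] by simp
    moreover have u0: "val_ge V 0 u" using False by (simp add: val_ge_def)
    have "2 * V w \<ge> 0" using val_ge_ev[OF V u_Q u0, of h] h_nz by (simp add: val_w[OF V] val_ge_def)
    then have "val_ge V 0 w" by (simp add: val_ge_def)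
    then have "val_ge V (0 + 0) (ev \<iota> q u * w)"
      by (intro val_ge_mult[OF V] val_ge_ev[OF V u_Q u0]) auto
    then have "val_ge V 0 f" unfolding f(1)
      by (intro val_ge_add[OF V] val_ge_ev[OF V u_Q u0]) auto
    ultimately show ?thesis by (simp add: pole_div_def)
  next
    case True
    then have inf: "V \<in> places_inf" using place_finite_or_inf[OF V] by simp
    define e where "e = V (inverse u)"
    have ue: "V u = - e" "e > 0" using place_inverse[OF V u_Q] True by (simp_all add: e_def)
    have D: "- pole_div N V = - (int N * e)" using inf by (simp add: pole_div_def e_def)
    have 1: "val_ge V (- (int N * e)) (ev \<iota> p u)"
    proof (cases "p = 0")
      case False
      have "int (degree p) * e \<le> int N * e" using dp[OF False] ue(2) by (intro mult_right_mono) auto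
      then show ?thesis using place_ev_pole[OF V u_Q True False] ue by (simp add: val_ge_def)
    qed simp
    have "2 * V w = - (int (degree h) * e)"
      using place_ev_pole[OF V u_Q True h_nz] ue by (simp add: val_w[OF V])
    moreover have "int (degree h) * e \<le> int (2 * g + 2) * e"
      using deg_h ue(2) by (intro mult_right_mono) auto
    moreover define E where "E = int (g + 1) * e"
    moreover have "int (2 * g + 2) * e = 2 * E" by (simp add: E_def algebra_simps)
    ultimately have w: "V w \<ge> - E" by linarith
    have 2: "val_ge V (- (int N * e)) (ev \<iota> q u * w)"
    proof (cases "q = 0")
      case False
      have "int (degree q + g + 1) * e \<le> int N * e" using dq[OF False] ue(2) by (intro mult_right_mono) auto
      moreover have "V (ev \<iota> q u * w) = - (int (degree q) * e) + V w"
        using place_mult[OF V, of "ev \<iota> q u" w] place_ev_pole[OF V u_Q True False] ue w_nz False by simp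
      moreover have "int (degree q + g + 1) * e = int (degree q) * e + E"
        by (simp add: E_def algebra_simps)
      ultimately have "- (int N * e) \<le> V (ev \<iota> q u * w)" using w by linarith
      then show ?thesis unfolding val_ge_def by blast
    qed simp
    show ?thesis unfolding D f(1) by (rule val_ge_add[OF V _ _ 1 2]) auto
  qed
  then show "f \<in> RR (pole_div N)" using Q_lin by (simp add: RR_iff f(1))
qed

end

context hyperelliptic_field
begin

lemma places_over_not_inf: "V \<in> places_over c \<Longrightarrow> V \<notin> places_inf"
  unfolding places_over_def using val_ge_of_shift[OF _ u_Q, of V c] u_nz
  by (auto simp: place_finite_or_inf val_ge_def)

lemma val_linear:
  assumes V: "is_place \<iota> Q V"
  shows "V \<in> places_inf \<Longrightarrow> V (u - \<iota> c) = - V (inverse u)"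
    and "V \<notin> places_inf \<Longrightarrow> V \<notin> places_over c \<Longrightarrow> V (u - \<iota> c) = 0"
proof -
  show "V (u - \<iota> c) = - V (inverse u)" if "V \<in> places_inf"
  proof -
    have neg: "V u < 0" using that place_finite_or_inf[OF V] by simp
    have "V (ev \<iota> [:- c, 1:] u) = int (degree [:- c, 1:]) * V u"
      by (rule place_ev_pole[OF V u_Q neg]) simp
    then show ?thesis using place_inverse[OF V u_Q] by simp
  qed
  show "V (u - \<iota> c) = 0" if "V \<notin> places_inf" "V \<notin> places_over c"
  proof -
    have "val_ge V 0 u" using that(1) place_finite_or_inf[OF V] by (simp add: val_ge_def)
    then have "val_ge V 0 (u - \<iota> c)" by (intro val_ge_diff[OF V] val_ge_const[OF V]) auto
    then have "V (u - \<iota> c) \<ge> 0" using place_0[OF V] by (auto simp: val_ge_def)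
    then show ?thesis using that(2) V by (simp add: places_over_def)
  qed
qed

lemma sum_val_linear:
  assumes S: "finite S" "\<And>V. V \<in> S \<Longrightarrow> is_place \<iota> Q V" "places_inf \<subseteq> S" "places_over c \<subseteq> S"
  shows "(\<Sum>V\<in>S. V (u - \<iota> c)) = 0"
proof -
  have "(\<Sum>V\<in>S. V (u - \<iota> c)) = (\<Sum>V\<in>places_inf \<union> places_over c. V (u - \<iota> c))"
    using S val_linear(2) by (intro sum.mono_neutral_right) auto
  also have "\<dots> = (\<Sum>V\<in>places_inf. V (u - \<iota> c)) + (\<Sum>V\<in>places_over c. V (u - \<iota> c))"
    using S places_over_not_inf finite_subset by (intro sum.union_disjoint) auto
  also have "(\<Sum>V\<in>places_inf. V (u - \<iota> c)) = (\<Sum>V\<in>places_inf. - V (inverse u))"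
    by (intro sum.cong val_linear(1)) (auto simp: places_inf_iff)
  also have "\<dots> = - 2" using places_inf_sum(2) by (simp add: sum_negf)
  finally show ?thesis using places_over_sum(2)[OF sqfree] by simp
qed

text \<open>By induction on the degree it suffices to treat a linear polynomial: its zeros count 2 by
  \<open>places_over_sum\<close>, and so do its poles.\<close>

lemma sum_val_ev:
  assumes S: "finite S" "\<And>V. V \<in> S \<Longrightarrow> is_place \<iota> Q V" "places_inf \<subseteq> S"
  shows "r \<noteq> 0 \<Longrightarrow> (\<And>c. poly r c = 0 \<Longrightarrow> places_over c \<subseteq> S) \<Longrightarrow> (\<Sum>V\<in>S. V (ev \<iota> r u)) = 0"
proof (induction "degree r" arbitrary: r)
  case 0
  then obtain a where "r = [:a:]" by (metis degree_eq_zeroE)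
  then show ?case using S(2) place_const by (intro sum.neutral) auto
next
  case (Suc n)
  then obtain c where c: "poly r c = 0"
    using fundamental_theorem_of_algebra[of r] constant_degree[of r] by auto
  then obtain q where q: "r = [:- c, 1:] * q" by (meson dvd_def poly_eq_0_iff_dvd)
  have q0: "q \<noteq> 0" using Suc(3) unfolding q by auto
  have "degree q = n" using Suc(2) q0 unfolding q by (subst (asm) degree_mult_eq) auto
  moreover have "places_over d \<subseteq> S" if "poly q d = 0" for d
    by (rule Suc(4)) (simp add: q that)
  ultimately have IH: "(\<Sum>V\<in>S. V (ev \<iota> q u)) = 0" using Suc(1) q0 by blast
  have "V (ev \<iota> r u) = V (u - \<iota> c) + V (ev \<iota> q u)" if "V \<in> S" for V
  proof -
    have "ev \<iota> r u = (u - \<iota> c) * ev \<iota> q u" unfolding q ev_mult by simp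
    moreover have "u - \<iota> c \<noteq> 0" using u_nc by auto
    ultimately show ?thesis using place_mult[OF S(2)[OF that], of "u - \<iota> c" "ev \<iota> q u"] q0 by simp
  qed
  then have "(\<Sum>V\<in>S. V (ev \<iota> r u)) = (\<Sum>V\<in>S. V (u - \<iota> c)) + (\<Sum>V\<in>S. V (ev \<iota> q u))"
    unfolding sum.distrib[symmetric] by (intro sum.cong refl)
  then show ?case using IH sum_val_linear[OF S Suc(4)[OF c]] by simp
qed

lemma sum_pole_div:
  assumes S: "finite S" "places_inf \<subseteq> S"
  shows "(\<Sum>V\<in>S. pole_div N V) = 2 * int N"
proof -
  have "(\<Sum>V\<in>S. pole_div N V) = (\<Sum>V\<in>places_inf. int N * V (inverse u))"
    using S by (intro sum.mono_neutral_cong_right) (auto simp: pole_div_def)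
  then show ?thesis using places_inf_sum(2) by (simp flip: sum_distrib_left)
qed

text \<open>Over each finite point, a power of \<open>X - c\<close> with a large exponent takes care of the divisor; the
  poles at infinity that this causes are compensated by a large \<open>N\<close>.\<close>

lemma divisor_bound:
  assumes D: "D \<in> divisors \<iota> Q"
  obtains r N where "r \<noteq> 0" "N \<ge> g" "\<And>V. is_place \<iota> Q V \<Longrightarrow> D V \<le> V (ev \<iota> r u) + pole_div N V"
proof -
  define A where "A = {V. D V \<noteq> 0}"
  have A: "finite A" "\<And>V. V \<in> A \<Longrightarrow> is_place \<iota> Q V" using D by (auto simp: divisors_def A_def)
  define c where "c V = (SOME c. V \<in> places_over c)" for V
  have c: "V \<in> places_over (c V)" if "V \<in> A" "V \<notin> places_inf" for V
    unfolding c_def using place_cases[OF A(2)[OF that(1)]] that(2) by (metis someI_ex)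
  define k where "k V = nat \<bar>D V\<bar>" for V
  define r where "r = (\<Prod>V\<in>A. [:- c V, 1:] ^ k V)"
  define N where "N = g + degree r + (\<Sum>V\<in>A. k V)"
  have r0: "r \<noteq> 0" unfolding r_def using A(1) by simp
  show ?thesis
  proof (rule that[OF r0])
    show "N \<ge> g" by (simp add: N_def)
    fix V assume V: "is_place \<iota> Q V"
    show "D V \<le> V (ev \<iota> r u) + pole_div N V"
    proof (cases "V \<in> places_inf")
      case True
      define e where "e = V (inverse u)"
      have e: "e \<ge> 1" "V u = - e" "V u < 0"
        using True place_finite_or_inf[OF V] place_inverse[OF V u_Q] by (auto simp: e_def places_inf_iff)
      have "D V \<le> int (\<Sum>V\<in>A. k V)"
      proof (cases "V \<in> A")
        case True
        have "k V \<le> (\<Sum>V\<in>A. k V)" by (rule member_le_sum) (use True A in auto)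
        moreover have "D V \<le> int (k V)" by (simp add: k_def)
        ultimately show ?thesis by linarith
      next
        case False
        then have "D V = 0" by (simp add: A_def)
        then show ?thesis by (simp add: sum_nonneg)
      qed
      also have "\<dots> \<le> int (g + (\<Sum>V\<in>A. k V)) * 1" unfolding mult_1_right of_nat_le_iff by simp
      also have "\<dots> \<le> int (g + (\<Sum>V\<in>A. k V)) * e" using e(1) by (intro mult_left_mono of_nat_0_le_iff)
      also have "\<dots> = V (ev \<iota> r u) + pole_div N V"
        using place_ev_pole[OF V u_Q e(3) r0] True e(2) by (simp add: pole_div_def N_def e_def algebra_simps)
      finally show ?thesis .
    next
      case False
      have p0: "pole_div N V = 0" using False by (simp add: pole_div_def)
      show ?thesis
      proof (cases "V \<in> A")
        case True
        from c[OF True False] have Vc: "V (u - \<iota> (c V)) > 0" by (simp add: places_over_def)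
        have "[:- c V, 1:] ^ k V dvd r" unfolding r_def using A(1) True by (intro dvd_prodI) auto
        then have "int (k V) \<le> int (order (c V) r)" using r0 by (simp add: order_divides)
        also have "\<dots> \<le> int (order (c V) r) * V (u - \<iota> (c V))"
          using Vc mult_left_mono[of 1 "V (u - \<iota> (c V))" "int (order (c V) r)"] by simp
        also have "\<dots> = V (ev \<iota> r u)" using place_ev[OF V u_Q Vc r0] by simp
        finally show ?thesis using p0 by (simp add: k_def)
      next
        case nA: False
        have "val_ge V 0 u" using False place_finite_or_inf[OF V] by (simp add: val_ge_def)
        then have "V (ev \<iota> r u) \<ge> 0" using val_ge_ev[OF V u_Q, of r] r0 by (simp add: val_ge_def)
        then show ?thesis using nA p0 by (simp add: A_def)
      qed
    qed
  qed
qed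

text \<open>Pass from \<open>D\<close> to a divisor \<open>D' \<ge> D\<close> that is the sum of a principal divisor and of a multiple of the pole
  divisor of \<open>u\<close>, for which the dimension is known, and bound the change of the dimension by
  the change of the degree.\<close>

lemma riemann_inequality:
  assumes D: "D \<in> divisors \<iota> Q"
  shows "div_degree D - int (div_dim \<iota> Q D) + 1 \<le> int g"
proof -
  obtain r N where r: "r \<noteq> 0" and N: "N \<ge> g"
    and bd: "\<And>V. is_place \<iota> Q V \<Longrightarrow> D V \<le> V (ev \<iota> r u) + pole_div N V"
    using divisor_bound[OF D] by metis
  define S where "S = {V. D V \<noteq> 0} \<union> places_inf \<union> (\<Union>c\<in>{c. poly r c = 0}. places_over c)"
  have S: "finite S" "\<And>V. V \<in> S \<Longrightarrow> is_place \<iota> Q V" "places_inf \<subseteq> S"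
    using D poly_roots_finite[OF r] places_over_sum(1)[OF sqfree] places_inf_sum(1)
    by (auto simp: S_def divisors_def places_inf_iff places_over_def)
  define D' where "D' V = (if is_place \<iota> Q V then V (ev \<iota> r u) + pole_div N V else 0)" for V
  have le: "D V \<le> D' V" for V
  proof (cases "is_place \<iota> Q V")
    case False
    then have "D V = 0" using D unfolding divisors_def by blast
    then show ?thesis using False by (simp add: D'_def)
  qed (simp add: bd D'_def)
  have out: "D' V = D V" if "V \<notin> S" for V
  proof (cases "is_place \<iota> Q V")
    case True
    have "V \<notin> places_inf" "\<And>c. poly r c = 0 \<Longrightarrow> V \<notin> places_over c" "D V = 0" using that by (auto simp: S_def)
    moreover obtain c where c: "V \<in> places_over c" using place_cases[OF True] calculation(1) by blast
    moreover have "order c r = 0" using calculation(2)[of c] c by (auto intro!: order_0I)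
    ultimately show ?thesis
      using True place_ev[OF True u_Q _ r, of c] by (simp add: D'_def pole_div_def places_over_def)
  qed (use D in \<open>auto simp: D'_def divisors_def\<close>)
  have degD': "(\<Sum>V\<in>S. D' V) = 2 * int N"
  proof -
    have "(\<Sum>V\<in>S. D' V) = (\<Sum>V\<in>S. V (ev \<iota> r u)) + (\<Sum>V\<in>S. pole_div N V)"
      unfolding sum.distrib[symmetric] using S(2) by (intro sum.cong) (auto simp: D'_def)
    also have "(\<Sum>V\<in>S. V (ev \<iota> r u)) = 0" by (rule sum_val_ev[OF S r]) (auto simp: S_def)
    finally show ?thesis using sum_pole_div[OF S(1,3)] by simp
  qed
  have degD: "div_degree D = (\<Sum>V\<in>S. D V)" by (rule div_degree_eq_sum[OF S(1)]) (auto simp: S_def)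
  (* multiplication by the polynomial turns the divisor into a multiple of the pole divisor of u *)
  have "RR D' = (*) (inverse (ev \<iota> r u)) ` RR (pole_div N)"
  proof -
    have iff: "f \<in> RR D' \<longleftrightarrow> ev \<iota> r u * f \<in> RR (pole_div N)" if f: "f \<in> Q" for f
    proof -
      have "val_ge V (- D' V) f \<longleftrightarrow> val_ge V (- pole_div N V) (ev \<iota> r u * f)" if V: "is_place \<iota> Q V" for V
        using place_mult[OF V _ f, of "ev \<iota> r u"] r V by (cases "f = 0") (auto simp: val_ge_def D'_def)
      then show ?thesis using f by (auto simp: RR_iff)
    qed
    show ?thesis
    proof (intro equalityI subsetI)
      fix f assume f: "f \<in> RR D'"
      then have "f \<in> Q" by (simp add: RR_iff)
      then show "f \<in> (*) (inverse (ev \<iota> r u)) ` RR (pole_div N)"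
        using iff f r by (intro image_eqI[of _ _ "ev \<iota> r u * f"]) auto
    next
      fix f assume "f \<in> (*) (inverse (ev \<iota> r u)) ` RR (pole_div N)"
      then obtain k where k: "k \<in> RR (pole_div N)" "f = inverse (ev \<iota> r u) * k" by auto
      have kQ: "k \<in> Q" using k(1) by (simp add: RR_iff)
      then have "f \<in> Q" unfolding k(2) by auto
      moreover have "ev \<iota> r u * f = k" unfolding k(2) using r by simp
      ultimately show "f \<in> RR D'" using iff k(1) by metis
    qed
  qed
  then have dimD': "ring.dimension fld (N + 1 + (N - g)) (range \<iota>) (RR D')"
    using dimension_scale[OF dimension_lin_space[of "N + 1" "N - g"], of "inverse (ev \<iota> r u)"] r RR_pole_div[OF N]
    by simp
  have "F.finite_dimension (range \<iota>) (RR D)"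
    by (rule F.subalbegra_incl_imp_finite_dimension[OF subfield_range F.finite_dimensionI[OF dimD'] RR_subalgebra RR_mono[OF le]])
  then obtain n where n: "ring.dimension fld n (range \<iota>) (RR D)" unfolding F.finite_dimension_def by blast
  define k where "k = nat (\<Sum>V\<in>S. D' V - D V)"
  have k: "(\<Sum>V\<in>S. D' V - D V) = int k" unfolding k_def using le by (simp add: sum_nonneg)
  obtain n' where n': "n' \<le> n + k" "ring.dimension fld n' (range \<iota>) (RR D')"
    using RR_chain[OF residue S(1,2) n le out k] by blast
  have "n' = N + 1 + (N - g)" by (rule F.dimension_is_inj[OF subfield_range n'(2) dimD'])
  then show ?thesis
    using n'(1) k degD degD' N unfolding div_dim_eqI[OF n] sum_subtractf by linarith
qed

text \<open>The bound of \<open>riemann_inequality\<close> is attained by the \<open>g\<close>-fold pole divisor of \<open>u\<close>, whose degree is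
  \<open>2 g\<close> and whose functions are the polynomials in \<open>u\<close> of degree at most \<open>g\<close>.\<close>

lemma has_genus_iff: "has_genus \<iota> Q n \<longleftrightarrow> n = g"
proof -
  have D: "pole_div g \<in> divisors \<iota> Q"
  proof -
    have "{V. pole_div g V \<noteq> 0} \<subseteq> places_inf" by (auto simp: pole_div_def)
    then have "finite {V. pole_div g V \<noteq> 0}" using places_inf_sum(1) finite_subset by blast
    moreover have "is_place \<iota> Q V" if "pole_div g V \<noteq> 0" for V
      using that by (auto simp: pole_div_def places_inf_iff split: if_splits)
    ultimately show ?thesis by (simp add: divisors_def)
  qed
  have deg: "div_degree (pole_div g) = 2 * int g"
    using div_degree_eq_sum[OF places_inf_sum(1), of "pole_div g"] sum_pole_div[OF places_inf_sum(1), of g]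
    by (auto simp: pole_div_def)
  have "div_dim \<iota> Q (pole_div g) = g + 1"
    using div_dim_eqI[of "g + 1 + 0" "pole_div g"] dimension_lin_space[of "g + 1" 0] RR_pole_div[of g] by simp
  then have attained: "div_degree (pole_div g) - int (div_dim \<iota> Q (pole_div g)) + 1 = int g"
    using deg by simp
  show ?thesis
  proof
    assume n: "has_genus \<iota> Q n"
    then obtain D' where "D' \<in> divisors \<iota> Q" "div_degree D' - int (div_dim \<iota> Q D') + 1 = int n"
      unfolding has_genus_def by blast
    then have "int n \<le> int g" using riemann_inequality by metis
    moreover have "int g \<le> int n" using n D attained unfolding has_genus_def by metis
    ultimately show "n = g" by simp
  next
    assume "n = g"
    then show "has_genus \<iota> Q n" unfolding has_genus_def using riemann_inequality D attained by blast
  qed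
qed

end

lemma (in quadratic_field) degree_of_genus:
  assumes sqfree: "\<And>c. order c h \<le> 1" and gen: "has_genus \<iota> Q n"
  shows "degree h = 2 * n + 1 \<or> degree h = 2 * n + 2"
proof -
  have "degree h \<noteq> 0"
  proof
    assume "degree h = 0"
    then obtain a where a: "h = [:a:]" by (metis degree_eq_zeroE)
    then have "(w - \<iota> (csqrt a)) * (w + \<iota> (csqrt a)) = 0"
      using w_sq by (simp add: algebra_simps flip: power2_eq_square emb_power)
    then have "w = \<iota> (csqrt a) \<or> w = \<iota> (- csqrt a)" by (simp add: eq_neg_iff_add_eq_0)
    then have "w \<in> range \<iota>" by blast
    then show False using w_notin range_subset_adjoin by blast
  qed
  then obtain g where g: "degree h = 2 * g + 1 \<or> degree h = 2 * g + 2"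
  proof (cases "even (degree h)")
    case True
    then obtain k where "degree h = 2 * k" by blast
    moreover from this have "k \<noteq> 0" using \<open>degree h \<noteq> 0\<close> by auto
    ultimately have "degree h = 2 * (k - 1) + 2" by simp
    then show ?thesis using that by blast
  next
    case False
    then obtain k where "degree h = 2 * k + 1" by (blast elim: oddE)
    then show ?thesis using that[of k] by simp
  qed
  interpret hyperelliptic_field \<iota> u w h g by unfold_locales (use g sqfree in auto)
  show ?thesis using gen has_genus_iff g by simp
qed



section \<open>Extension degrees\<close>

lemma independent_pair:
  assumes M: "subfield M (fld :: 'k::field ring)" and s: "s \<notin> M"
  shows "F.independent M [s, 1]" "F.Span M [s, 1] = {a + b * s | a b. a \<in> M \<and> b \<in> M}"
proof -
  have sp1: "F.Span M [1] = M"
    by (auto simp: F.line_extension_mem_iff)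
  have "F.independent M [1]"
    by (rule F.li_Cons) auto
  then show "F.independent M [s, 1]"
    by (rule F.li_Cons[rotated 2]) (use s in \<open>simp_all add: sp1 del: F.Span.simps\<close>)
  have "F.Span M [s, 1] = F.line_extension M s M" using sp1 by simp
  also have "\<dots> = {a + b * s | a b. a \<in> M \<and> b \<in> M}"
  proof (intro equalityI subsetI)
    fix f assume "f \<in> F.line_extension M s M"
    then obtain k v where "k \<in> M" "v \<in> M" "f = k * s + v" by (auto simp: F.line_extension_mem_iff)
    then show "f \<in> {a + b * s | a b. a \<in> M \<and> b \<in> M}"
      by (intro CollectI exI[of _ v] exI[of _ k]) (auto simp: add.commute)
  next
    fix f assume "f \<in> {a + b * s | a b. a \<in> M \<and> b \<in> M}"
    then obtain a b where "a \<in> M" "b \<in> M" "f = a + b * s" by blast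
    then show "f \<in> F.line_extension M s M" unfolding F.line_extension_mem_iff fld_simps
      by (intro bexI[of _ b] bexI[of _ a]) (auto simp: add.commute)
  qed
  finally show "F.Span M [s, 1] = {a + b * s | a b. a \<in> M \<and> b \<in> M}" .
qed

lemma degree_2_generated:
  assumes M: "subfield M (fld :: 'k::field ring)" and dim: "ext_degree E M 2"
    and s: "s \<in> E" "s \<notin> M" "1 \<in> E"
  shows "E = {a + b * s | a b. a \<in> M \<and> b \<in> M}"
  using F.independent_length_eq_dimension[OF M dim independent_pair(1)[OF M s(2)]] s
    independent_pair(2)[OF M s(2)] by auto

lemma degree_0_iff: "ext_degree E M 0 \<Longrightarrow> E = {0 :: 'k::field}"
  by (erule F.dimension.cases) auto

lemma degree_1_self:
  assumes M: "subfield M (fld :: 'k::field ring)"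
  shows "ext_degree M M 1"
proof -
  have "F.independent M [1]" by (rule F.li_Cons) auto
  moreover have "F.Span M [1] = M" by (auto simp: F.line_extension_mem_iff)
  ultimately show ?thesis using F.dimension_independent[of M "[1]"] by simp
qed

text \<open>The minimal polynomial divides the given one.\<close>

lemma degree_simple_extension_le_5:
  assumes M: "subfield M (fld :: 'k::field ring)" and c: "c0 \<in> M" "c1 \<in> M" "c2 \<in> M" "c3 \<in> M" "c4 \<in> M"
    and root: "x^5 + c4 * x^4 + c3 * x^3 + c2 * x^2 + c1 * x + c0 = 0"
    and E: "subfield E fld" "M \<subseteq> E" "x \<in> E"
    and least: "\<And>E'. subfield E' fld \<Longrightarrow> M \<subseteq> E' \<Longrightarrow> x \<in> E' \<Longrightarrow> E \<subseteq> E'"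
  obtains d where "d \<le> 5" "ext_degree E M d"
proof -
  let ?p = "[1, c4, c3, c2, c1, c0]"
  have M1: "1 \<in> M" using subfield_fldD(1)[OF M] .
  have p: "?p \<in> carrier (univ_poly fld M)"
    using c M1 by (simp add: univ_poly_def polynomial_def)
  have ev: "F.eval ?p x = 0"
    using root by (simp add: algebra_simps numeral_eq_Suc)
  have alg: "(F.algebraic over M) x"
    unfolding over_def using F.algebraicI[OF p _ ] ev by (simp add: over_def)
  have x: "x \<in> carrier fld" by simp
  have irr: "F.Irr M x \<in> carrier (univ_poly fld M)" by (rule F.IrrE(1)[OF M x alg])
  have "F.Irr M x pdivides\<^bsub>fld\<^esub> ?p"
    by (rule F.Irr_minimal[OF M x alg p]) (use ev in simp)
  then have "length (F.Irr M x) - 1 \<le> length ?p - 1"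
    by (rule F.pdivides_imp_degree_le[OF subfieldE(1)[OF M] irr p, rotated]) simp
  then have d: "length (F.Irr M x) - 1 \<le> 5" by simp
  have sub: "subfield (F.simple_extension M x) fld"
    using F.simple_extension_is_subfield[OF M x] alg by simp
  have "F.simple_extension M x = E"
  proof
    show "E \<subseteq> F.simple_extension M x"
      using least[OF sub] F.simple_extension_incl[of M x] F.simple_extension_mem[OF subfieldE(1)[OF M] x] by auto
    show "F.simple_extension M x \<subseteq> E"
      by (rule F.simple_extension_subring_incl[OF subfieldE(1)[OF E(1)] E(2,3)])
  qed
  then show ?thesis using that[OF d] F.dimension_simple_extension[OF M x alg] by simp
qed

lemma square_free_part:
  assumes "H \<noteq> (0::complex poly)"
  obtains R h where "H = R^2 * h" "\<And>c. order c h \<le> 1" "R \<noteq> 0"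
proof -
  have "H \<noteq> 0 \<Longrightarrow> \<exists>R h. H = R^2 * h \<and> (\<forall>c. order c h \<le> 1)" for H :: "complex poly"
  proof (induction "degree H" arbitrary: H rule: less_induct)
    case less
    show ?case
    proof (cases "\<forall>c. order c H \<le> 1")
      case True
      then show ?thesis by (intro exI[of _ 1] exI[of _ H]) auto
    next
      case False
      then obtain c where "2 \<le> order c H" by (metis not_less_eq_eq Suc_1 One_nat_def)
      then have "[:- c, 1:] ^ 2 dvd H" by (simp add: order_divides)
      then obtain H1 where H1: "H = [:- c, 1:] ^ 2 * H1" by (meson dvdE)
      have n: "H1 \<noteq> 0" using less(2) H1 by auto
      have "degree H = 2 + degree H1"
        unfolding H1 by (subst degree_mult_eq) (use n in \<open>auto simp: degree_power_eq\<close>)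
      then obtain R h where "H1 = R^2 * h" "\<forall>c. order c h \<le> 1" using less(1)[of H1] n by auto
      then show ?thesis unfolding H1 by (intro exI[of _ "[:- c, 1:] * R"] exI[of _ h]) (simp only: power_mult_distrib mult.assoc simp_thms)
    qed
  qed
  from this[OF assms] obtain R h where "H = R^2 * h" "\<forall>c. order c h \<le> 1" by blast
  moreover from this have "R \<noteq> 0" using assms by auto
  ultimately show ?thesis using that by blast
qed

context const_embedding
begin

text \<open>Completing the square, clearing denominators and removing square factors: a quadratic
  extension of \<open>\<complex>(u)\<close> is generated by the root of a squarefree polynomial.\<close>

lemma quadratic_generator:
  assumes u: "u \<notin> range \<iota>" and E: "subfield E fld" "adjoin \<iota> {u} \<subseteq> E"
    and dim: "ext_degree E (adjoin \<iota> {u}) 2"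
  obtains w h where "w \<in> E" "w \<notin> adjoin \<iota> {u}" "w^2 = ev \<iota> h u" "\<And>c. order c h \<le> 1"
proof -
  let ?M = "adjoin \<iota> {u}"
  interpret M: field_over_C \<iota> ?M by (rule field_over_C_adjoin)
  interpret E: field_over_C \<iota> E
    by (intro field_over_C.intro const_embedding_axioms field_over_C_axioms.intro E(1))
       (use E(2) range_subset_adjoin in blast)
  have uM: "u \<in> ?M" using subset_adjoin by blast
  have "E \<noteq> ?M"
    using F.dimension_is_inj[OF M.L dim] degree_1_self[OF M.L] by force
  then obtain s where s: "s \<in> E" "s \<notin> ?M" using E(2) by blast
  have "s * s \<in> {a + b * s | a b. a \<in> ?M \<and> b \<in> ?M}"
    using E.L_closed(6)[OF s(1) s(1)] by (subst degree_2_generated[OF M.L dim s E.L_closed(1), symmetric])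
  then obtain a b where ab: "s * s = a + b * s" "a \<in> ?M" "b \<in> ?M" by blast
  define s1 where "s1 = s - b / 2"
  have two: "(2::'k) \<in> ?M" using M.L_closed(11)[of 2] by simp
  have bM: "b / 2 \<in> ?M" using ab(3) two by auto
  have s1: "s1 \<in> E" "s1 \<notin> ?M"
  proof -
    show "s1 \<in> E" using s(1) bM E(2) by (auto simp: s1_def)
    show "s1 \<notin> ?M"
    proof
      assume "s1 \<in> ?M"
      then have "s1 + b / 2 \<in> ?M" using bM by auto
      then show False using s(2) by (simp add: s1_def)
    qed
  qed
  have "s1 ^ 2 = a + (b / 2) ^ 2"
  proof -
    define c where "c = b / 2"
    have "b = 2 * c" using char_0 by (simp add: c_def)
    then have "s * s = a + 2 * c * s" using ab(1) by simp
    then have "(s - c) ^ 2 = a + c ^ 2" by (simp add: power2_eq_square algebra_simps)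
    then show ?thesis by (simp add: s1_def c_def)
  qed
  then have sq: "s1 ^ 2 \<in> ?M" using ab(2) bM by auto
  have "s1 \<noteq> 0" using s1(2) by auto
  then have "s1 ^ 2 \<noteq> 0" by simp
  from adjoin_singletonE[OF u sq this] obtain p q where pq: "s1 ^ 2 = ev \<iota> p u / ev \<iota> q u" "q \<noteq> 0" "p \<noteq> 0" .
  have "p * q \<noteq> 0" using pq by simp
  then obtain R h where h: "p * q = R^2 * h" "\<And>c. order c h \<le> 1" "R \<noteq> 0"
    by (rule square_free_part) (rule that)
  define m where "m = ev \<iota> q u / ev \<iota> R u"
  have m: "m \<in> ?M" "m \<noteq> 0" using uM pq(2) h(3) ev_eq_0_iff[OF u] by (auto simp: m_def)
  show ?thesis
  proof (rule that[of "s1 * m" h])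
    show "s1 * m \<in> E" using s1(1) m(1) E(2) by auto
    show "s1 * m \<notin> ?M"
    proof
      assume "s1 * m \<in> ?M"
      then have "s1 * m / m \<in> ?M" using m(1) by (rule M.L_closed(8))
      then show False using s1(2) m(2) by simp
    qed
    have "(s1 * m) ^ 2 = ev \<iota> (p * q) u / ev \<iota> R u ^ 2"
      unfolding power_mult_distrib pq(1) m_def using pq(2) ev_eq_0_iff[OF u] by (simp add: power2_eq_square)
    also have "\<dots> = ev \<iota> h u" unfolding h(1) using h(3) ev_eq_0_iff[OF u] by simp
    finally show "(s1 * m) ^ 2 = ev \<iota> h u" .
  qed (rule h(2))
qed

lemma quadratic_field_eq:
  assumes u: "u \<notin> range \<iota>" and E: "subfield E fld" "adjoin \<iota> {u} \<subseteq> E"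
    and dim: "ext_degree E (adjoin \<iota> {u}) 2"
    and w: "w \<in> E" "w \<notin> adjoin \<iota> {u}"
  shows "adjoin \<iota> {u, w} = E"
proof
  have "u \<in> E" using E(2) subset_adjoin by blast
  then show "adjoin \<iota> {u, w} \<subseteq> E"
    using E range_subset_adjoin w(1) by (intro adjoin_least) blast+
  interpret A: field_over_C \<iota> "adjoin \<iota> {u, w}" by (rule field_over_C_adjoin)
  have "adjoin \<iota> {u} \<subseteq> adjoin \<iota> {u, w}"
    using subset_adjoin[of "{u, w}"] by (intro adjoin_least A.L A.const_L) auto
  moreover have "w \<in> adjoin \<iota> {u, w}" using subset_adjoin[of "{u, w}"] by auto
  moreover have "E = {a + b * w | a b. a \<in> adjoin \<iota> {u} \<and> b \<in> adjoin \<iota> {u}}"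
    by (rule degree_2_generated[OF subfield_adjoin dim w]) (rule subfield_fldD(1)[OF E(1)])
  ultimately show "E \<subseteq> adjoin \<iota> {u, w}" by auto
qed

end

section \<open>The fibres of the normal form\<close>

lemma poly_F: "poly (F1 a b) c = c^2 + (2 * a + 2 * b + a^2) * c + (2 * a * b + b^2)"
  "poly (F2 a b) c = (2 * a + 1) * c^2 + (a^2 + 2 * a * b + 2 * b) * c + b^2"
  "poly (F3 a b) c = c^2 - (a^2 - 2 * b) * c + b^2"
  "poly (F4 a b) c = (2 * a + 1) * c^2 + (2 * b - 2 * b * a - 2 * a - a^2) * c + (b^2 + 2 * a * b)"
  by (simp_all add: F1_def F2_def F3_def F4_def algebra_simps power2_eq_square)

lemma poly_g3: "poly (g3 a b z) c = g3_coeff3 a b z * c^3 + g3_coeff2 a b z * c^2 + g3_coeff1 a b z * c + g3_coeff0 a b z"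
  by (simp add: g3_def algebra_simps power2_eq_square power3_eq_cube)

lemma F_identity: "[:0, 1:] * F1 a b ^ 2 - F2 a b ^ 2 = [:-1, 1:] * F3 a b ^ 2"
  by (simp add: F1_def F2_def F3_def power2_eq_square algebra_simps)

lemma W_identity: "pderiv ([:0, 1:] * F1 a b ^ 2) * F2 a b - Polynomial.smult 2 ([:0, 1:] * F1 a b ^ 2 * pderiv (F2 a b)) = F1 a b * F3 a b * F4 a b"
  by (simp add: F1_def F2_def F3_def F4_def pderiv_mult pderiv_pCons power2_eq_square algebra_simps)

text \<open>The remainder of \<open>F2\<close> modulo \<open>F1\<close> is \<open>A X + B\<close>. Eliminating the common root gives the resultant of \<open>F1\<close> and
  \<open>F2\<close>, which is \<open>- 4 a^4 b (a + b + 1)\<^sup>2\<close>.\<close>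

lemma F_no_common_root:
  assumes "a \<noteq> 0" "b \<noteq> 0" "a + b \<noteq> -1" and "poly (F1 a b) c = 0" "poly (F2 a b) c = 0"
  shows False
proof -
  define A B where "A = - 2 * a^3 - 4 * a^2 - 2 * a * b - 2 * a" and "B = - 4 * a^2 * b - 2 * a * b^2 - 2 * a * b"
  have "A * c + B = poly (F2 a b) c - (2 * a + 1) * poly (F1 a b) c"
    unfolding poly_F A_def B_def by (simp add: algebra_simps power_numeral_reduce)
  then have B: "A * c = - B" using assms(4,5) by (simp add: add_eq_0_iff2)
  have "0 = A^2 * poly (F1 a b) c" using assms(4) by simp
  also have "\<dots> = (A * c)^2 + (2 * a + 2 * b + a^2) * A * (A * c) + (2 * a * b + b^2) * A^2"
    unfolding poly_F by (simp add: algebra_simps power_numeral_reduce)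
  also have "\<dots> = B^2 - (2 * a + 2 * b + a^2) * A * B + (2 * a * b + b^2) * A^2"
    unfolding B by simp
  also have "\<dots> = - 4 * a^4 * b * (a + b + 1)^2"
    unfolding A_def B_def by (simp add: algebra_simps power_numeral_reduce)
  finally have "a + b + 1 = 0" using assms(1,2) by simp
  then show False using assms(3) by (simp add: add_eq_0_iff2 add.assoc)
qed

lemma sum_order:
  fixes p :: "complex poly"
  assumes "finite S"
  shows "p \<noteq> 0 \<Longrightarrow> {c. poly p c = 0} \<subseteq> S \<Longrightarrow> (\<Sum>c\<in>S. order c p) = degree p"
proof (induction "degree p" arbitrary: p)
  case 0
  then obtain a where "p = [:a:]" "a \<noteq> 0" by (metis degree_eq_zeroE pCons_0_0)
  then show ?case by (simp add: order_0I)
next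
  case (Suc n)
  then obtain c where c: "poly p c = 0"
    using fundamental_theorem_of_algebra[of p] constant_degree[of p] by auto
  then obtain q where q: "p = [:- c, 1:] * q" by (meson dvd_def poly_eq_0_iff_dvd)
  have q0: "q \<noteq> 0" using Suc(3) unfolding q by auto
  have dq: "degree q = n" using Suc(2) q0 unfolding q by (subst (asm) degree_mult_eq) auto
  have "order d p = (if d = c then 1 else 0) + order d q" for d
  proof -
    have "order d [:- c, 1:] = (if d = c then 1 else 0)"
      using order_power_n_n[of c 1] by (auto intro: order_0I)
    moreover have "[:- c, 1:] * q \<noteq> 0" using Suc(3) q by simp
    from order_mult[OF this, of d] have "order d p = order d [:- c, 1:] + order d q"
      by (simp only: q)
    ultimately show ?thesis by (simp only:)
  qed
  then have "(\<Sum>d\<in>S. order d p) = (\<Sum>d\<in>S. if d = c then 1 else 0) + (\<Sum>d\<in>S. order d q)"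
    by (simp only: sum.distrib)
  also have "(\<Sum>d\<in>S. order d q) = n"
    using Suc(1)[of q] Suc(4) dq q0 unfolding q by auto
  also have "(\<Sum>d\<in>S. if d = c then 1 else 0 :: nat) = 1" using assms Suc(4) c by auto
  finally show ?case using Suc(2) by simp
qed

lemma sum_order_roots:
  "p \<noteq> (0::complex poly) \<Longrightarrow> (\<Sum>c | poly p c = 0. order c p) = degree p"
  by (rule sum_order[OF poly_roots_finite]) auto

lemma squarefree_degree:
  assumes "p \<noteq> (0::complex poly)" "\<And>c. order c p \<le> 1"
  shows "degree p = card {c. poly p c = 0}"
proof -
  have "order c p = 1" if "poly p c = 0" for c
    using assms(2)[of c] that order_root[of p c] assms(1) by simp
  then show ?thesis using sum_order_roots[OF assms(1)] by simp
qed

text \<open>The difference of both sides has too many roots for its degree.\<close>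

lemma squarefree_factorization:
  assumes "p \<noteq> (0::complex poly)" "\<And>c. order c p \<le> 1"
  shows "p = Polynomial.smult (lead_coeff p) (\<Prod>c | poly p c = 0. [:- c, 1:])"
proof -
  let ?q = "\<Prod>c | poly p c = 0. [:- c, 1:]"
  have fin: "finite {c. poly p c = 0}" by (rule poly_roots_finite[OF assms(1)])
  have dq: "degree ?q = card {c. poly p c = 0}" 
    by (simp add: degree_prod_eq_sum_degree)
  have lq: "lead_coeff ?q = 1" by (subst lead_coeff_prod) simp
  have r: "poly ?q c = 0" if "poly p c = 0" for c
    unfolding poly_prod by (rule prod_zero[OF fin]) (use that in \<open>auto intro!: bexI[of _ c]\<close>)
  let ?d = "p - Polynomial.smult (lead_coeff p) ?q"
  show ?thesis
  proof (rule ccontr)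
    assume "p \<noteq> Polynomial.smult (lead_coeff p) ?q"
    then have d0: "?d \<noteq> 0" unfolding right_minus_eq .
    have "{c. poly p c = 0} \<subseteq> {c. poly ?d c = 0}"
    proof
      fix c assume c: "c \<in> {c. poly p c = 0}"
      then have "poly ?q c = 0" by (intro r) simp
      then show "c \<in> {c. poly ?d c = 0}" using c unfolding mem_Collect_eq poly_diff poly_smult by (simp only:) simp
    qed
    then have "card {c. poly p c = 0} \<le> card {c. poly ?d c = 0}" by (intro card_mono poly_roots_finite[OF d0])
    also have "\<dots> \<le> degree ?d" by (rule card_poly_roots_bound[OF d0])
    finally have ge: "degree p \<le> degree ?d" using squarefree_degree[OF assms] by simp
    have dp: "degree p = degree ?q" using dq squarefree_degree[OF assms] by simp
    have "degree ?d \<le> degree p"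
      by (rule degree_diff_le[OF order_refl]) (use degree_smult_le[of _ ?q] dp in simp)
    then have "degree ?d = degree p" using ge by simp
    moreover have "Polynomial.coeff ?d (degree p) = 0"
      unfolding coeff_diff coeff_smult using lq unfolding dp[symmetric] by simp
    ultimately have "lead_coeff ?d = 0" by (simp only:)
    then show False using d0 unfolding leading_coeff_0_iff by blast
  qed
qed

lemma order_prod:
  fixes f :: "'a \<Rightarrow> complex poly"
  assumes "finite A" "\<And>i. i \<in> A \<Longrightarrow> f i \<noteq> 0"
  shows "order c (\<Prod>i\<in>A. f i) = (\<Sum>i\<in>A. order c (f i))"
  using assms
proof (induction A rule: finite_induct)
  case (insert i A)
  have nz: "f i * (\<Prod>i\<in>A. f i) \<noteq> 0" using insert.hyps(1) insert.prems by (simp add: prod_zero_iff)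
  have IH: "order c (\<Prod>i\<in>A. f i) = (\<Sum>i\<in>A. order c (f i))"
    by (rule insert.IH) (use insert.prems in simp)
  show ?case unfolding prod.insert[OF insert.hyps(1,2)] sum.insert[OF insert.hyps(1,2)] order_mult[OF nz] IH ..
next
  case empty
  show ?case using order_0I[of 1 c] by simp
qed

definition odd_roots :: "complex poly \<Rightarrow> complex set" where
  "odd_roots p = {c. odd (order c p)}"

lemma odd_roots_subset: "p \<noteq> 0 \<Longrightarrow> odd_roots p \<subseteq> {c. poly p c = 0}"
proof
  fix c assume "c \<in> odd_roots p"
  then have "order c p \<noteq> 0" by (auto simp: odd_roots_def intro!: Nat.gr0I)
  then show "c \<in> {c. poly p c = 0}" by (simp add: order_root)
qed

lemma finite_odd_roots: "p \<noteq> 0 \<Longrightarrow> finite (odd_roots p)"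
  by (rule finite_subset[OF odd_roots_subset poly_roots_finite])

lemma odd_card_odd_roots:
  assumes "p \<noteq> 0" "odd (degree p)" shows "odd (card (odd_roots p))"
proof -
  have "odd (\<Sum>c | poly p c = 0. order c p)" using assms sum_order_roots by simp
  then have "odd (card {c \<in> {c. poly p c = 0}. odd (order c p)})"
    using poly_roots_finite[OF assms(1)] by (simp add: even_sum_iff)
  also have "{c \<in> {c. poly p c = 0}. odd (order c p)} = odd_roots p"
    using odd_roots_subset[OF assms(1)] by (auto simp: odd_roots_def)
  finally show ?thesis .
qed

text \<open>The roots of even order have at least order 2.\<close>

lemma card_roots_le:
  assumes "p \<noteq> 0"
  shows "2 * card {c. poly p c = 0} \<le> degree p + card (odd_roots p)"
proof -
  let ?R = "{c. poly p c = 0}"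
  have fin: "finite ?R" by (rule poly_roots_finite[OF assms])
  have "(\<Sum>c\<in>?R. 2) \<le> (\<Sum>c\<in>?R. order c p + (if c \<in> odd_roots p then 1 else 0))"
  proof (rule sum_mono)
    fix c assume "c \<in> ?R"
    then have "order c p \<noteq> 0" using order_root[of p c] assms by simp
    then show "2 \<le> order c p + (if c \<in> odd_roots p then 1 else 0)"
      unfolding odd_roots_def by (cases "order c p = 1") auto
  qed
  also have "\<dots> = degree p + card (?R \<inter> odd_roots p)"
    using sum.inter_restrict[OF fin, of "\<lambda>_. 1::nat" "odd_roots p"]
    unfolding sum.distrib sum_order_roots[OF assms] by simp
  also have "?R \<inter> odd_roots p = odd_roots p" using odd_roots_subset[OF assms] by auto
  finally show ?thesis by simp
qed

lemma multiple_root_exists: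
  assumes "p \<noteq> 0" "card (odd_roots p) < degree p"
  obtains c where "order c p \<ge> 2"
proof -
  have "\<exists>c. order c p \<ge> 2"
  proof (rule ccontr)
    assume "\<not> ?thesis"
    then have le: "order c p \<le> 1" for c by (metis not_less_eq_eq Suc_1 One_nat_def)
    have "{c. poly p c = 0} \<subseteq> odd_roots p"
    proof
      fix c assume "c \<in> {c. poly p c = 0}"
      then have "order c p = 1" using order_root[of p c] assms(1) le[of c] by simp
      then show "c \<in> odd_roots p" by (simp add: odd_roots_def)
    qed
    then have "degree p \<le> card (odd_roots p)"
      using squarefree_degree[OF assms(1) le] card_mono[OF finite_odd_roots[OF assms(1)]] by simp
    then show False using assms(2) by simp
  qed
  then show ?thesis using that by blast
qed

text \<open>The numerator of \<open>\<phi> - p\<close>; its roots, with their orders, form the fibre of \<open>\<phi>\<close> over \<open>p\<close>.\<close>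

definition fibre :: "complex \<Rightarrow> complex \<Rightarrow> complex \<Rightarrow> complex poly" where
  "fibre a b p = [:0, 1:] * F1 a b ^ 2 - Polynomial.smult p (F2 a b ^ 2)"

lemma fibre_explicit: "\<exists>c0 c1 c2 c3 c4. fibre a b p = [:c0, c1, c2, c3, c4, 1:]"
  unfolding fibre_def by (simp add: F1_def F2_def power2_eq_square)

lemma degree_fibre: "degree (fibre a b p) = 5" and fibre_nz: "fibre a b p \<noteq> 0"
  using fibre_explicit[of a b p] by auto

lemma fibre_0: "fibre a b 0 = [:0, 1:] * F1 a b ^ 2"
  by (simp add: fibre_def)

lemma fibre_1: "fibre a b 1 = [:-1, 1:] * F3 a b ^ 2"
  using F_identity[of a b] by (simp add: fibre_def)

lemma F_nz: "F1 a b \<noteq> 0" "F3 a b \<noteq> 0" "b \<noteq> 0 \<Longrightarrow> F2 a b \<noteq> 0"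
  by (simp_all add: F1_def F3_def F2_def)

lemma poly_fibre: "poly (fibre a b p) c = c * poly (F1 a b) c ^ 2 - p * poly (F2 a b) c ^ 2"
  by (simp add: fibre_def poly_power)

lemma order_linear_square:
  assumes "q \<noteq> (0::complex poly)"
  shows "order d ([:- c, 1:] * q ^ 2) = (if d = c then 1 else 0) + 2 * order d q"
proof -
  have "order d [:- c, 1:] = (if d = c then 1 else 0)"
    using order_power_n_n[of c 1] by (auto intro: order_0I)
  moreover have nz: "[:- c, 1:] * q ^ 2 \<noteq> 0" using assms unfolding mult_eq_0_iff by simp
  moreover have "order d (q ^ 2) = 2 * order d q"
    using assms by (simp add: power2_eq_square order_mult)
  ultimately show ?thesis unfolding order_mult[OF nz] by (simp only:)
qed

lemma odd_roots_linear_square: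
  assumes "q \<noteq> 0" shows "odd_roots ([:- c, 1:] * q ^ 2) = {c}"
  unfolding odd_roots_def order_linear_square[OF assms] by auto

lemma odd_roots_fibre_01: "odd_roots (fibre a b 0) = {0}" "odd_roots (fibre a b 1) = {1}"
  using odd_roots_linear_square[of "F1 a b" 0] odd_roots_linear_square[of "F3 a b" 1] F_nz
  by (simp_all add: fibre_0 fibre_1)

locale normal_form =
  fixes a b :: complex
  assumes a: "a \<noteq> 0" and b: "b \<noteq> 0" and ab: "a + b \<noteq> -1"
begin

lemma no_common_root: "poly (F1 a b) c = 0 \<Longrightarrow> poly (F2 a b) c \<noteq> 0"
  using F_no_common_root[OF a b ab] by blast

text \<open>The points where \<open>F2\<close> vanishes lie over infinity.\<close>

lemma F2_nz_on_fibre: "poly (fibre a b p) c = 0 \<Longrightarrow> poly (F2 a b) c \<noteq> 0"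
proof
  assume *: "poly (fibre a b p) c = 0" "poly (F2 a b) c = 0"
  then have "c = 0 \<or> poly (F1 a b) c = 0" by (simp add: poly_fibre)
  then show False using *(2) no_common_root b by (auto simp: poly_F)
qed

lemma fibre_disjoint: "poly (fibre a b p) c = 0 \<Longrightarrow> poly (fibre a b q) c = 0 \<Longrightarrow> p = q"
  using F2_nz_on_fibre[of p c] by (auto simp: poly_fibre)

lemma F13_nz_on_fibre:
  assumes "poly (fibre a b p) c = 0" "p \<noteq> 0" "p \<noteq> 1"
  shows "poly (F1 a b) c \<noteq> 0" "poly (F3 a b) c \<noteq> 0"
  using fibre_disjoint[OF assms(1), of 0] fibre_disjoint[OF assms(1), of 1] assms(2,3)
  by (auto simp: fibre_0 fibre_1)

lemma F4_nz: "F4 a b \<noteq> 0"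
proof
  assume "F4 a b = 0"
  then have *: "b^2 + 2 * a * b = 0" "2 * b - 2 * b * a - 2 * a - a^2 = 0" "2 * a + 1 = 0"
    by (simp_all add: F4_def)
  have "b * (b + 2 * a) = 0" using *(1) by (simp add: power2_eq_square algebra_simps)
  then have "b = 1" using b *(3) by (simp add: add_eq_0_iff2)
  moreover have "2 * a = - 1" using *(3) by (simp add: add_eq_0_iff2)
  then have "a = - 1 / 2" by (metis nonzero_mult_div_cancel_left zero_neq_numeral)
  ultimately show False using *(2) by (simp add: power2_eq_square)
qed

lemma degree_F4: "degree (F4 a b) \<le> 2"
  by (simp add: F4_def)

text \<open>The derivative of \<open>\<phi> = X F1\<^sup>2 / F2\<^sup>2\<close> has numerator \<open>F1 F3 F4\<close>. A point of multiplicity \<open>m\<close> in a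
  fibre is a zero of order \<open>m - 1\<close> of the derivative, and \<open>F1\<close>, \<open>F3\<close> vanish only over 0 and 1.\<close>

lemma order_fibre_le:
  assumes p: "p \<noteq> 0" "p \<noteq> 1"
  shows "order c (fibre a b p) \<le> order c (F4 a b) + 1"
proof (cases "poly (fibre a b p) c = 0")
  case False
  then show ?thesis by (simp add: order_0I)
next
  case True
  define m where "m = order c (fibre a b p)"
  have "m \<noteq> 0" using True fibre_nz by (simp add: m_def order_root)
  obtain G where G: "fibre a b p = [:- c, 1:] ^ m * G"
    using order_1[of c "fibre a b p"] by (auto simp: m_def elim: dvdE)
  have "pderiv (fibre a b p) * F2 a b - Polynomial.smult 2 (fibre a b p * pderiv (F2 a b))
      = pderiv ([:0, 1:] * F1 a b ^ 2) * F2 a b - Polynomial.smult 2 ([:0, 1:] * F1 a b ^ 2 * pderiv (F2 a b))"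
    unfolding fibre_def pderiv_diff pderiv_smult power2_eq_square[of "F2 a b"] pderiv_mult[of "F2 a b"]
    by (simp add: algebra_simps smult_add_right smult_diff_right numeral_poly)
  then have W: "F1 a b * F3 a b * F4 a b = pderiv (fibre a b p) * F2 a b - Polynomial.smult 2 (fibre a b p * pderiv (F2 a b))"
    using W_identity by metis
  have m1: "[:- c, 1:] ^ (m - 1) dvd fibre a b p" unfolding G by (intro dvd_mult2 le_imp_power_dvd) simp
  have m2: "[:- c, 1:] ^ (m - 1) dvd pderiv (fibre a b p)"
  proof -
    have "[:- c, 1:] ^ (m - 1) dvd [:- c, 1:] ^ m * pderiv G"
      by (intro dvd_mult2 le_imp_power_dvd) simp
    moreover have "[:- c, 1:] ^ (m - 1) dvd pderiv ([:- c, 1:] ^ m)"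
      unfolding pderiv_power by (intro dvd_mult2 dvd_smult) simp
    ultimately show ?thesis unfolding G pderiv_mult by (metis dvd_add dvd_mult)
  qed
  have "[:- c, 1:] ^ (m - 1) dvd F1 a b * F3 a b * F4 a b"
    unfolding W by (intro dvd_diff dvd_smult dvd_mult2 m1 m2)
  moreover have nz: "F1 a b * F3 a b * F4 a b \<noteq> 0" using F_nz F4_nz by simp
  ultimately have "m - 1 \<le> order c (F1 a b * F3 a b * F4 a b)" by (simp add: order_divides)
  also have "\<dots> = order c (F4 a b)"
    using nz F13_nz_on_fibre[OF True p] by (simp add: order_mult order_0I)
  finally show ?thesis by (simp add: m_def)
qed

text \<open>The branch points of the genus 1 field that have a single point of odd multiplicity above them
  contribute at least 2 to the zeros of the derivative; \<open>F4\<close> has degree at most 2, so besides \<open>\<lambda>\<close>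
  there is only room for the points 0 and 1.\<close>

lemma branch_points:
  assumes Z: "finite Z" "card Z = 3 \<or> card Z = 4"
    and sum: "(\<Sum>p\<in>Z. card (odd_roots (fibre a b p))) = 5 \<or> (\<Sum>p\<in>Z. card (odd_roots (fibre a b p))) = 6"
  obtains l z where "Z = {0, 1, l}" "l \<noteq> 0" "l \<noteq> 1" "poly (fibre a b l) z = 0"
    "order z (fibre a b l) \<ge> 2" "poly (F4 a b) z = 0"
proof -
  define k where "k p = (card (odd_roots (fibre a b p)) - 1) div 2" for p
  have k: "card (odd_roots (fibre a b p)) = 2 * k p + 1" for p
    using odd_card_odd_roots[OF fibre_nz, of a b p] degree_fibre[of a b p] by (auto simp: k_def elim!: oddE)
  have "2 * (\<Sum>p\<in>Z. k p) + card Z = (\<Sum>p\<in>Z. card (odd_roots (fibre a b p)))"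
    unfolding k by (simp only: sum.distrib sum_distrib_left[symmetric]) simp
  moreover have "K = 1" if "2 * K + c = S" "c = 3 \<or> c = 4" "S = 5 \<or> S = 6" for K c S :: nat
    using that by presburger
  ultimately have "(\<Sum>p\<in>Z. k p) = 1" using Z(2) sum by blast
  then obtain l where l: "l \<in> Z" "k l = 1" and "\<forall>p\<in>Z. l \<noteq> p \<longrightarrow> k p = 0"
    using sum_eq_1_iff[OF Z(1), of k] by blast
  then have k0: "k p = 0" if "p \<in> Z" "p \<noteq> l" for p using that by auto
  have l01: "l \<noteq> 0" "l \<noteq> 1" using l(2) k[of l] odd_roots_fibre_01[of a b] by auto
  obtain z where z: "order z (fibre a b l) \<ge> 2"
    using multiple_root_exists[OF fibre_nz, of a b l] k[of l] l(2) degree_fibre[of a b l] by auto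
  then have Gz: "poly (fibre a b l) z = 0" using fibre_nz by (simp add: order_root)
  have ordz: "order z (F4 a b) \<ge> 1" using order_fibre_le[OF l01, of z] z by simp
  then have F4z: "poly (F4 a b) z = 0" by (simp add: order_root)
  have "p = 0 \<or> p = 1" if p: "p \<in> Z" "p \<noteq> l" for p
  proof (rule ccontr)
    assume n: "\<not> (p = 0 \<or> p = 1)"
    let ?R = "{c. poly (fibre a b p) c = 0}"
    have fin: "finite ?R" by (rule poly_roots_finite[OF fibre_nz])
    have card: "card ?R \<le> 3"
      using card_roots_le[OF fibre_nz, of a b p] k[of p] k0[OF p] degree_fibre[of a b p] by simp
    have zR: "z \<notin> ?R" using fibre_disjoint[OF Gz, of p] p(2) by auto
    have "5 = (\<Sum>c\<in>?R. order c (fibre a b p))"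
      using sum_order_roots[OF fibre_nz, of a b p] degree_fibre[of a b p] by simp
    also have "\<dots> \<le> (\<Sum>c\<in>?R. order c (F4 a b) + 1)"
      using n by (intro sum_mono order_fibre_le) auto
    also have "\<dots> = (\<Sum>c\<in>?R. order c (F4 a b)) + card ?R" by (simp only: sum.distrib sum_constant) simp
    finally have "2 \<le> (\<Sum>c\<in>?R. order c (F4 a b))" using card by simp
    moreover have "(\<Sum>c\<in>insert z ?R. order c (F4 a b)) \<le> degree (F4 a b)"
    proof -
      let ?S = "insert z ?R \<union> {c. poly (F4 a b) c = 0}"
      have S: "finite ?S" using fin poly_roots_finite[OF F4_nz] by simp
      have "(\<Sum>c\<in>insert z ?R. order c (F4 a b)) \<le> (\<Sum>c\<in>?S. order c (F4 a b))"
        by (rule sum_mono2[OF S]) auto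
      also have "\<dots> = degree (F4 a b)" by (rule sum_order[OF S F4_nz]) blast
      finally show ?thesis .
    qed
    ultimately show False using zR fin ordz degree_F4 by simp
  qed
  then have sub: "Z \<subseteq> {0, 1, l}" by blast
  have "card {0, 1, l} = 3" using l01 by auto
  moreover from this have "card Z \<le> 3" using card_mono[OF _ sub] by simp
  ultimately have "Z = {0, 1, l}" using sub Z(2) by (intro card_subset_eq) auto
  then show ?thesis using that l01 Gz z F4z by blast
qed

end

section \<open>Ramification of rational functions\<close>

context const_embedding
begin

lemma finite_place_ev:
  assumes x: "x \<notin> range \<iota>" and p: "p \<noteq> 0"
  shows "finite_place x c (ev \<iota> p x) = int (order c p)"
proof -
  interpret field_over_C \<iota> "adjoin \<iota> {x}" by (rule field_over_C_adjoin)
  have xN: "x \<in> adjoin \<iota> {x}" using subset_adjoin by blast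
  have pos: "finite_place x c (x - \<iota> c) > 0" using finite_place(2)[OF x] by simp
  show ?thesis using place_ev[OF finite_place(1)[OF x, of c] xN pos p] finite_place(2)[OF x, of c] by simp
qed

lemma infinite_place_ev:
  assumes x: "x \<notin> range \<iota>" and p: "p \<noteq> 0"
  shows "infinite_place x (ev \<iota> p x) = - int (degree p)"
proof -
  interpret field_over_C \<iota> "adjoin \<iota> {x}" by (rule field_over_C_adjoin)
  have xN: "x \<in> adjoin \<iota> {x}" using subset_adjoin by blast
  have "infinite_place x x = - 1"
    using place_inverse[OF infinite_place(1)[OF x] xN] infinite_place(2)[OF x] by simp
  then show ?thesis using place_ev_pole[OF infinite_place(1)[OF x] xN _ p] by simp
qed

lemma finite_place_inj: "x \<notin> range \<iota> \<Longrightarrow> finite_place x c = finite_place x d \<Longrightarrow> c = d"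
proof (rule ccontr)
  assume x: "x \<notin> range \<iota>" and e: "finite_place x c = finite_place x d" and "c \<noteq> d"
  then have "order d [:- c, 1:] = 0" by (intro order_0I) simp
  then have "finite_place x d (x - \<iota> c) = 0" using finite_place_ev[OF x, of "[:- c, 1:]" d] by simp
  then show False using finite_place(2)[OF x, of c] e by simp
qed

lemma finite_infinite_place: "x \<notin> range \<iota> \<Longrightarrow> finite_place x c \<noteq> infinite_place x"
  using infinite_place_ev[of x "[:- c, 1:]"] finite_place(2)[of x c] by auto

text \<open>Above \<open>s = p\<close>, the value of a place at \<open>s - p\<close> is its ramification index.\<close>

lemma ram_type_eq:
  assumes s: "s \<notin> range \<iota>" "adjoin \<iota> {s} = M" and N: "subfield N fld" "range \<iota> \<subseteq> N" "M \<subseteq> N"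
  shows "ram_type \<iota> N M (finite_place s p)
    = image_mset (\<lambda>P. nat (P (s - \<iota> p))) (mset_set {P. is_place \<iota> N P \<and> P (s - \<iota> p) > 1})"
proof -
  let ?q = "finite_place s p"
  have sM: "s \<in> M" using s(2) subset_adjoin by blast
  have sp: "s - \<iota> p \<in> M"
    unfolding s(2)[symmetric] using field_over_C.L_closed(3,11)[OF field_over_C_adjoin] sM s(2) by blast
  have q1: "?q (s - \<iota> p) = 1" by (rule finite_place(2)[OF s(1)])
  have restr: "P f = P (s - \<iota> p) * ?q f" if "is_place \<iota> N P" "P (s - \<iota> p) > 0" "f \<in> M" for P f
    using place_restrict_finite[OF that(1) N(1,2) _ that(2)] sM N(3) that(3) s(2) by blast
  have idx: "ram_index M P ?q = nat (P (s - \<iota> p))" if "is_place \<iota> N P" "P (s - \<iota> p) > 0" for P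
    unfolding ram_index_def
  proof (rule the_equality)
    show "nat (P (s - \<iota> p)) > 0 \<and> (\<forall>f\<in>M. P f = int (nat (P (s - \<iota> p))) * ?q f)"
      using restr that by simp
    fix e assume "e > 0 \<and> (\<forall>f\<in>M. P f = int e * ?q f)"
    then have "P (s - \<iota> p) = int e" using sp q1 by simp
    then show "e = nat (P (s - \<iota> p))" by simp
  qed
  have over: "lies_over M P ?q \<longleftrightarrow> P (s - \<iota> p) > 0" if P: "is_place \<iota> N P" for P
  proof
    assume "lies_over M P ?q"
    then obtain e :: nat where "e > 0" "\<forall>f\<in>M. P f = int e * ?q f" unfolding lies_over_def by blast
    then show "P (s - \<iota> p) > 0" using sp q1 by simp
  next
    assume pos: "P (s - \<iota> p) > 0"
    show "lies_over M P ?q" unfolding lies_over_def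
      by (rule exI[of _ "nat (P (s - \<iota> p))"]) (use restr[OF P pos] pos in simp)
  qed
  have "{P. is_place \<iota> N P \<and> lies_over M P ?q \<and> ram_index M P ?q > 1} = {P. is_place \<iota> N P \<and> P (s - \<iota> p) > 1}"
  proof (rule Collect_cong)
    fix P show "is_place \<iota> N P \<and> lies_over M P ?q \<and> ram_index M P ?q > 1 \<longleftrightarrow> is_place \<iota> N P \<and> P (s - \<iota> p) > 1"
      using over[of P] idx[of P] by (cases "is_place \<iota> N P"; cases "P (s - \<iota> p) > 0") auto
  qed
  then have "ram_type \<iota> N M ?q = image_mset (\<lambda>P. ram_index M P ?q) (mset_set {P. is_place \<iota> N P \<and> P (s - \<iota> p) > 1})"
    unfolding ram_type_def by simp
  also have "\<dots> = image_mset (\<lambda>P. nat (P (s - \<iota> p))) (mset_set {P. is_place \<iota> N P \<and> P (s - \<iota> p) > 1})"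
  proof (rule image_mset_cong)
    fix P assume "P \<in># mset_set {P. is_place \<iota> N P \<and> P (s - \<iota> p) > 1}"
    then have "P \<in> {P. is_place \<iota> N P \<and> P (s - \<iota> p) > 1}" by (metis elem_mset_set infinite_set_mset_mset_set empty_iff)
    then show "ram_index M P ?q = nat (P (s - \<iota> p))" using idx by simp
  qed
  finally show ?thesis .
qed

end

text \<open>A rational map \<open>A / B\<close> with \<open>B\<close> of smaller degree than \<open>A\<close>, so that infinity is mapped to infinity.\<close>

locale rational_map = const_embedding \<iota> for \<iota> :: "complex \<Rightarrow> 'k::field" +
  fixes x t :: 'k and A B :: "complex poly"
  assumes x_nc: "x \<notin> range \<iota>" and t_eq_frac: "t = ev \<iota> A x / ev \<iota> B x" and B_nz: "B \<noteq> 0"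
    and coprime_AB: "poly A c = 0 \<Longrightarrow> poly B c \<noteq> 0" and deg_AB: "degree B < degree A"
begin

lemma fib_nz: "A - Polynomial.smult p B \<noteq> 0" and fib_degree: "degree (A - Polynomial.smult p B) = degree A"
proof -
  have "degree (Polynomial.smult p B) < degree A" using degree_smult_le[of p B] deg_AB by linarith
  then show d: "degree (A - Polynomial.smult p B) = degree A"
    using degree_add_eq_left[of "- Polynomial.smult p B" A] by simp
  then show "A - Polynomial.smult p B \<noteq> 0" using deg_AB by auto
qed

lemma A_nz: "A \<noteq> 0"
  using deg_AB by auto

lemma t_minus: "t - \<iota> p = ev \<iota> (A - Polynomial.smult p B) x / ev \<iota> B x"
  unfolding t_eq_frac using B_nz by (simp add: ev_eq_0_iff[OF x_nc] field_simps)

lemma t_nc: "t \<notin> range \<iota>"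
proof
  assume "t \<in> range \<iota>"
  then obtain p where "t - \<iota> p = 0" by auto
  then show False unfolding t_minus using fib_nz[of p] B_nz by (simp add: ev_eq_0_iff[OF x_nc] del: ev_diff)
qed

lemma t_in: "t \<in> adjoin \<iota> {x}"
  unfolding adjoin_singleton[OF x_nc] t_eq_frac using B_nz by blast

lemma adjoin_t_subset: "adjoin \<iota> {t} \<subseteq> adjoin \<iota> {x}"
  by (rule adjoin_least[OF subfield_adjoin range_subset_adjoin]) (use t_in in simp)

sublocale N: field_over_C \<iota> "adjoin \<iota> {x}" by (rule field_over_C_adjoin)

lemma x_in [simp]: "x \<in> adjoin \<iota> {x}"
  using subset_adjoin by blast

lemma finite_place_frac:
  "p \<noteq> 0 \<Longrightarrow> q \<noteq> 0 \<Longrightarrow> finite_place x c (ev \<iota> p x / ev \<iota> q x) = int (order c p) - int (order c q)"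
  using N.place_divide[OF finite_place(1)[OF x_nc], of "ev \<iota> p x" "ev \<iota> q x" c] finite_place_ev[OF x_nc]
  by (simp add: ev_eq_0_iff[OF x_nc])

lemma infinite_place_frac:
  "p \<noteq> 0 \<Longrightarrow> q \<noteq> 0 \<Longrightarrow> infinite_place x (ev \<iota> p x / ev \<iota> q x) = int (degree q) - int (degree p)"
  using N.place_divide[OF infinite_place(1)[OF x_nc], of "ev \<iota> p x" "ev \<iota> q x"] infinite_place_ev[OF x_nc]
  by (simp add: ev_eq_0_iff[OF x_nc])

lemma ram_type_finite:
  "ram_type \<iota> (adjoin \<iota> {x}) (adjoin \<iota> {t}) (finite_place t p)
    = image_mset (\<lambda>c. order c (A - Polynomial.smult p B))
        (mset_set {c. order c (A - Polynomial.smult p B) > 1})"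
proof -
  let ?G = "A - Polynomial.smult p B"
  let ?C = "{c. order c ?G > 1}"
  have fin: "finite_place x c (t - \<iota> p) = int (order c ?G) - int (order c B)" for c
    unfolding t_minus by (rule finite_place_frac[OF fib_nz B_nz])
  have ord: "finite_place x c (t - \<iota> p) = int (order c ?G)" if "c \<in> ?C" for c
  proof -
    have "order c ?G \<noteq> 0" using that by simp
    then have "poly ?G c = 0" using order_root[of ?G c] by blast
    then have "poly B c \<noteq> 0" using coprime_AB[of c] by auto
    then show ?thesis using fin[of c] by (simp add: order_0I)
  qed
  have inf: "infinite_place x (t - \<iota> p) \<le> 0"
    unfolding t_minus infinite_place_frac[OF fib_nz B_nz] fib_degree using deg_AB by simp
  have "{P. is_place \<iota> (adjoin \<iota> {x}) P \<and> P (t - \<iota> p) > 1} = finite_place x ` ?C"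
  proof (intro equalityI subsetI)
    fix P assume "P \<in> {P. is_place \<iota> (adjoin \<iota> {x}) P \<and> P (t - \<iota> p) > 1}"
    then have P: "is_place \<iota> (adjoin \<iota> {x}) P" "P (t - \<iota> p) > 1" by auto
    from rational_place_cases[OF x_nc P(1)] show "P \<in> finite_place x ` ?C"
    proof cases
      case (1 c)
      then have "c \<in> ?C" using P(2) fin[of c] by simp
      then show ?thesis using 1 by blast
    next
      case 2
      then show ?thesis using inf P(2) by simp
    qed
  next
    fix P assume "P \<in> finite_place x ` ?C"
    then obtain c where "c \<in> ?C" "P = finite_place x c" by blast
    then show "P \<in> {P. is_place \<iota> (adjoin \<iota> {x}) P \<and> P (t - \<iota> p) > 1}"
      using finite_place(1)[OF x_nc] ord[of c] by simp
  qed
  moreover have "inj_on (finite_place x) ?C" using finite_place_inj[OF x_nc] by (auto intro: inj_onI)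
  ultimately have "ram_type \<iota> (adjoin \<iota> {x}) (adjoin \<iota> {t}) (finite_place t p)
      = image_mset (\<lambda>P. nat (P (t - \<iota> p))) (image_mset (finite_place x) (mset_set ?C))"
    using ram_type_eq[OF t_nc refl subfield_adjoin range_subset_adjoin adjoin_t_subset, of p]
    by (simp add: image_mset_mset_set)
  also have "\<dots> = image_mset (\<lambda>c. nat (finite_place x c (t - \<iota> p))) (mset_set ?C)"
    by (simp add: image_mset.compositionality comp_def)
  also have "\<dots> = image_mset (\<lambda>c. order c ?G) (mset_set ?C)"
  proof (rule image_mset_cong)
    fix c assume "c \<in># mset_set ?C"
    then have "c \<in> ?C" by (metis elem_mset_set infinite_set_mset_mset_set empty_iff)
    then show "nat (finite_place x c (t - \<iota> p)) = order c ?G" using ord by simp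
  qed
  finally show ?thesis .
qed

text \<open>Over infinity lie the roots of \<open>B\<close> and infinity itself, where the multiplicity is the difference of the
  degrees.\<close>

lemma ram_type_infinite:
  assumes big: "degree B + 1 < degree A"
  shows "ram_type \<iota> (adjoin \<iota> {x}) (adjoin \<iota> {t}) (infinite_place t)
    = add_mset (degree A - degree B)
        (image_mset (\<lambda>c. order c B) (mset_set {c. order c B > 1}))"
proof -
  let ?C = "{c. order c B > 1}"
  let ?t = "inverse t"
  have it: "?t = ev \<iota> B x / ev \<iota> A x" unfolding t_eq_frac by simp
  have fin: "finite_place x c (?t - \<iota> 0) = int (order c B) - int (order c A)" for c
    unfolding it emb_0 diff_zero by (rule finite_place_frac[OF B_nz A_nz])
  have ord: "finite_place x c (?t - \<iota> 0) = int (order c B)" if "c \<in> ?C" for c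
  proof -
    have "poly B c = 0" using that B_nz by (simp add: order_root)
    then have "poly A c \<noteq> 0" using coprime_AB[of c] by auto
    then show ?thesis using fin[of c] by (simp add: order_0I)
  qed
  have inf: "infinite_place x (?t - \<iota> 0) = int (degree A) - int (degree B)"
    unfolding it emb_0 diff_zero by (rule infinite_place_frac[OF B_nz A_nz])
  have finC: "finite ?C"
    by (rule finite_subset[OF _ poly_roots_finite[OF B_nz]]) (use B_nz in \<open>auto simp: order_root\<close>)
  have "{P. is_place \<iota> (adjoin \<iota> {x}) P \<and> P (?t - \<iota> 0) > 1} = insert (infinite_place x) (finite_place x ` ?C)"
  proof (intro equalityI subsetI)
    fix P assume "P \<in> {P. is_place \<iota> (adjoin \<iota> {x}) P \<and> P (?t - \<iota> 0) > 1}"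
    then have P: "is_place \<iota> (adjoin \<iota> {x}) P" "P (?t - \<iota> 0) > 1" by auto
    from rational_place_cases[OF x_nc P(1)] show "P \<in> insert (infinite_place x) (finite_place x ` ?C)"
    proof cases
      case (1 c)
      then have "c \<in> ?C" using P(2) fin[of c] by simp
      then show ?thesis using 1 by blast
    qed simp
  next
    fix P assume "P \<in> insert (infinite_place x) (finite_place x ` ?C)"
    then consider "P = infinite_place x" | c where "c \<in> ?C" "P = finite_place x c" by blast
    then show "P \<in> {P. is_place \<iota> (adjoin \<iota> {x}) P \<and> P (?t - \<iota> 0) > 1}"
    proof cases
      case 1
      have "infinite_place x (?t - \<iota> 0) > 1" using inf big by linarith
      then show ?thesis using infinite_place(1)[OF x_nc] 1 by simp
    next
      case 2
      have "finite_place x c (?t - \<iota> 0) > 1" using ord[OF 2(1)] 2(1) by simp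
      then show ?thesis using finite_place(1)[OF x_nc] 2(2) by simp
    qed
  qed
  moreover have "inj_on (finite_place x) ?C" using finite_place_inj[OF x_nc] by (auto intro: inj_onI)
  moreover have notin: "infinite_place x \<notin> finite_place x ` ?C" using finite_infinite_place[OF x_nc] by (metis imageE)
  ultimately have "mset_set {P. is_place \<iota> (adjoin \<iota> {x}) P \<and> P (?t - \<iota> 0) > 1}
      = add_mset (infinite_place x) (image_mset (finite_place x) (mset_set ?C))"
    by (simp only: image_mset_mset_set mset_set.insert[OF finite_imageI[OF finC] notin])
  then have "ram_type \<iota> (adjoin \<iota> {x}) (adjoin \<iota> {t}) (finite_place ?t 0)
      = add_mset (nat (infinite_place x (?t - \<iota> 0))) (image_mset (\<lambda>c. nat (finite_place x c (?t - \<iota> 0))) (mset_set ?C))"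
    unfolding ram_type_eq[OF inverse_not_const[OF t_nc] adjoin_inverse subfield_adjoin range_subset_adjoin adjoin_t_subset, of 0]
    by (simp only: image_mset_add_mset image_mset.compositionality comp_def)
  also have "image_mset (\<lambda>c. nat (finite_place x c (?t - \<iota> 0))) (mset_set ?C) = image_mset (\<lambda>c. order c B) (mset_set ?C)"
    by (rule image_mset_cong) (use finC ord in simp)
  also have "nat (infinite_place x (?t - \<iota> 0)) = degree A - degree B"
    unfolding inf using deg_AB by simp
  finally show ?thesis unfolding infinite_place_def .
qed

end

section \<open>The cubic polynomial of the theorem\<close>

text \<open>The cubic \<open>(X F1\<^sup>2 F2(z)\<^sup>2 - z F1(z)\<^sup>2 F2\<^sup>2) / (X - z)\<^sup>2\<close> agrees with \<open>g3\<close>, up to the constant factor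
  \<open>(2 a + 1)\<^sup>2 / (2 a)\<^sup>2\<close>, modulo \<open>F4(z)\<close>. After multiplication by \<open>(X - z)\<^sup>2\<close> and by the denominator,
  the coefficients of \<open>X^0, \<dots>, X^5\<close> of the difference are divisible by \<open>F4(z)\<close>. The quotients
  were found by polynomial division with respect to \<open>b\<close>, in which \<open>F4(z)\<close> is monic.\<close>

lemma g3_certificate_0:
  fixes a b z :: complex
  shows "4 * a^2 * (z^2 * g3_coeff0 a b z) - (2 * a + 1)^2 * (0 - (b^2)^2 * (z * (z^2 + (2 * a + 2 * b +
    a^2) * z + (2 * a * b + b^2))^2)) = (0 - a^2 * z - 2 * a * b * z + 2 * a * b + 2 * a * z^2 - 2
    * a * z + b^2 + 2 * b * z + z^2) * (8 * a^3 * b^5 * z + 4 * a^3 * b^4 * z^2 + 4 * a^2 * b^6 * z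
    + 8 * a^2 * b^5 * z + 11 * a^2 * b^4 * z^2 + 4 * a * b^6 * z + 10 * a * b^5 * z^2 + 2 * a * b^5
    * z + 2 * a * b^4 * z^3 + 6 * a * b^4 * z^2 + b^6 * z + 2 * b^5 * z^2 + b^4 * z^3)"
  by (simp add: g3_coeff0_def g3_coeff1_def g3_coeff2_def g3_coeff3_def algebra_simps power_numeral_reduce)

lemma g3_certificate_1:
  fixes a b z :: complex
  shows "4 * a^2 * (0 - 2 * z * g3_coeff0 a b z + z^2 * g3_coeff1 a b z) - (2 * a + 1)^2 * ((2 * a * b +
    b^2)^2 * (((2 * a + 1) * z^2 + (a^2 + 2 * a * b + 2 * b) * z + (b^2))^2) - 2 * (a^2 + 2 * a * b
    + 2 * b) * (b^2) * (z * (z^2 + (2 * a + 2 * b + a^2) * z + (2 * a * b + b^2))^2)) = (0 - a^2 *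
    z - 2 * a * b * z + 2 * a * b + 2 * a * z^2 - 2 * a * z + b^2 + 2 * b * z + z^2) * (0 - 24 *
    a^5 * b^2 * z^2 + 20 * a^4 * b^4 * z - 16 * a^4 * b^3 * z^2 - 26 * a^4 * b^2 * z^2 + 8 * a^3 *
    b^5 * z - 8 * a^3 * b^5 - 8 * a^3 * b^4 * z^2 + 52 * a^3 * b^4 * z + 32 * a^3 * b^3 * z^2 + 4 *
    a^3 * b^2 * z^3 - 12 * a^3 * b^2 * z^2 - 4 * a^2 * b^6 + 32 * a^2 * b^5 * z - 8 * a^2 * b^5 +
    28 * a^2 * b^4 * z^2 + 23 * a^2 * b^4 * z + 8 * a^2 * b^3 * z^3 + 48 * a^2 * b^3 * z^2 + 2 *
    a^2 * b^2 * z^3 - 4 * a^2 * b^2 * z^2 - 4 * a * b^6 + 6 * a * b^5 * z - 2 * a * b^5 + 42 * a *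
    b^4 * z^2 - 2 * a * b^4 * z + 12 * a * b^3 * z^3 + 20 * a * b^3 * z^2 - b^6 + 2 * b^5 * z + 7 *
    b^4 * z^2 + 4 * b^3 * z^3)"
  by (simp add: g3_coeff0_def g3_coeff1_def g3_coeff2_def g3_coeff3_def algebra_simps power_numeral_reduce)

lemma g3_certificate_2:
  fixes a b z :: complex
  shows "4 * a^2 * (g3_coeff0 a b z - 2 * z * g3_coeff1 a b z + z^2 * g3_coeff2 a b z) - (2 * a + 1)^2 *
    (2 * (2 * a + 2 * b + a^2) * (2 * a * b + b^2) * (((2 * a + 1) * z^2 + (a^2 + 2 * a * b + 2 *
    b) * z + (b^2))^2) - ((a^2 + 2 * a * b + 2 * b)^2 + 2 * (2 * a + 1) * (b^2)) * (z * (z^2 + (2 *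
    a + 2 * b + a^2) * z + (2 * a * b + b^2))^2)) = (0 - a^2 * z - 2 * a * b * z + 2 * a * b + 2 *
    a * z^2 - 2 * a * z + b^2 + 2 * b * z + z^2) * (0 - 8 * a^7 * b * z + 4 * a^7 * z^2 - 20 * a^6
    * b^2 * z - 16 * a^6 * b * z^2 - 8 * a^6 * b * z + 11 * a^6 * z^2 + 28 * a^5 * b^2 * z - 42 *
    a^5 * b * z^2 - 2 * a^5 * b * z + 2 * a^5 * z^3 + 6 * a^5 * z^2 - 20 * a^4 * b^4 + 112 * a^4 *
    b^3 * z + 12 * a^4 * b^2 * z^2 + 47 * a^4 * b^2 * z + 8 * a^4 * b * z^3 - 50 * a^4 * b * z^2 +
    a^4 * z^3 - 8 * a^3 * b^5 + 56 * a^3 * b^4 * z - 56 * a^3 * b^4 + 8 * a^3 * b^3 * z^2 + 96 *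
    a^3 * b^3 * z + 8 * a^3 * b^2 * z^3 + 72 * a^3 * b^2 * z^2 + 24 * a^3 * b^2 * z + 12 * a^3 * b
    * z^3 - 28 * a^3 * b * z^2 - 32 * a^2 * b^5 + 44 * a^2 * b^4 * z - 34 * a^2 * b^4 + 80 * a^2 *
    b^3 * z^2 + 4 * a^2 * b^3 * z + 28 * a^2 * b^2 * z^3 + 72 * a^2 * b^2 * z^2 + 8 * a^2 * b^2 * z
    + 4 * a^2 * b * z^3 - 8 * a^2 * b * z^2 - 16 * a * b^5 - 20 * a * b^4 * z - 4 * a * b^4 + 60 *
    a * b^3 * z^2 - 20 * a * b^3 * z + 24 * a * b^2 * z^3 + 24 * a * b^2 * z^2 - 4 * b^5 - 2 * b^4
    * z + 8 * b^3 * z^2 + 6 * b^2 * z^3)"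
  by (simp add: g3_coeff0_def g3_coeff1_def g3_coeff2_def g3_coeff3_def algebra_simps power_numeral_reduce)

lemma g3_certificate_3:
  fixes a b z :: complex
  shows "4 * a^2 * (g3_coeff1 a b z - 2 * z * g3_coeff2 a b z + z^2 * g3_coeff3 a b z) - (2 * a + 1)^2 *
    (((2 * a + 2 * b + a^2)^2 + 2 * (2 * a * b + b^2)) * (((2 * a + 1) * z^2 + (a^2 + 2 * a * b + 2
    * b) * z + (b^2))^2) - 2 * (2 * a + 1) * (a^2 + 2 * a * b + 2 * b) * (z * (z^2 + (2 * a + 2 * b
    + a^2) * z + (2 * a * b + b^2))^2)) = (0 - a^2 * z - 2 * a * b * z + 2 * a * b + 2 * a * z^2 -
    2 * a * z + b^2 + 2 * b * z + z^2) * (0 - 4 * a^8 * z - 8 * a^7 * b * z + 8 * a^7 * b - 8 * a^7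
    * z^2 - 20 * a^7 * z + 20 * a^6 * b^2 - 16 * a^6 * b * z + 8 * a^6 * b - 28 * a^6 * z^2 - 31 *
    a^6 * z - 4 * a^5 * b^2 + 42 * a^5 * b * z + 2 * a^5 * b - 34 * a^5 * z^2 - 14 * a^5 * z - 96 *
    a^4 * b^3 + 96 * a^4 * b^2 * z - 21 * a^4 * b^2 + 32 * a^4 * b * z^2 + 90 * a^4 * b * z + 8 *
    a^4 * z^3 - 27 * a^4 * z^2 - 48 * a^3 * b^4 + 64 * a^3 * b^3 * z - 128 * a^3 * b^3 + 32 * a^3 *
    b^2 * z^2 + 44 * a^3 * b^2 * z - 12 * a^3 * b^2 + 16 * a^3 * b * z^3 + 56 * a^3 * b * z^2 + 56
    * a^3 * b * z + 8 * a^3 * z^3 - 16 * a^3 * z^2 - 72 * a^2 * b^4 - 24 * a^2 * b^3 * z - 52 * a^2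
    * b^3 + 64 * a^2 * b^2 * z^2 - 40 * a^2 * b^2 * z - 4 * a^2 * b^2 + 32 * a^2 * b * z^3 + 44 *
    a^2 * b * z^2 + 16 * a^2 * b * z + 2 * a^2 * z^3 - 4 * a^2 * z^2 - 24 * a * b^4 - 56 * a * b^3
    * z + 28 * a * b^2 * z^2 - 28 * a * b^2 * z + 20 * a * b * z^3 + 12 * a * b * z^2 - 6 * b^4 - 8
    * b^3 * z + 2 * b^2 * z^2 + 4 * b * z^3)"
  by (simp add: g3_coeff0_def g3_coeff1_def g3_coeff2_def g3_coeff3_def algebra_simps power_numeral_reduce)

lemma g3_certificate_4:
  fixes a b z :: complex
  shows "4 * a^2 * (g3_coeff2 a b z - 2 * z * g3_coeff3 a b z) - (2 * a + 1)^2 * (2 * (2 * a + 2 * b +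
    a^2) * (((2 * a + 1) * z^2 + (a^2 + 2 * a * b + 2 * b) * z + (b^2))^2) - (2 * a + 1)^2 * (z *
    (z^2 + (2 * a + 2 * b + a^2) * z + (2 * a * b + b^2))^2)) = (0 - a^2 * z - 2 * a * b * z + 2 *
    a * b + 2 * a * z^2 - 2 * a * z + b^2 + 2 * b * z + z^2) * (4 * a^8 + 8 * a^7 * b + 8 * a^7 * z
    + 16 * a^7 + 32 * a^6 * b + 28 * a^6 * z + 20 * a^6 + 40 * a^5 * z + 8 * a^5 - 108 * a^4 * b^2
    - 8 * a^4 * b * z - 40 * a^4 * b + 4 * a^4 * z^2 + 46 * a^4 * z - 72 * a^3 * b^3 - 8 * a^3 *
    b^2 * z - 120 * a^3 * b^2 + 8 * a^3 * b * z^2 - 28 * a^3 * b * z - 28 * a^3 * b + 8 * a^3 * z^3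
    + 12 * a^3 * z^2 + 32 * a^3 * z - 64 * a^2 * b^3 - 72 * a^2 * b^2 * z - 34 * a^2 * b^2 - 40 *
    a^2 * b * z - 8 * a^2 * b + 12 * a^2 * z^3 + 9 * a^2 * z^2 + 8 * a^2 * z - 16 * a * b^3 - 48 *
    a * b^2 * z + 4 * a * b^2 - 6 * a * b * z^2 - 14 * a * b * z + 6 * a * z^3 + 2 * a * z^2 - 4 *
    b^3 - 7 * b^2 * z - 2 * b * z^2 + z^3)"
  by (simp add: g3_coeff0_def g3_coeff1_def g3_coeff2_def g3_coeff3_def algebra_simps power_numeral_reduce)

lemma g3_certificate_5:
  fixes a b z :: complex
  shows "4 * a^2 * (g3_coeff3 a b z) - (2 * a + 1)^2 * (1 * (((2 * a + 1) * z^2 + (a^2 + 2 * a * b + 2 *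
    b) * z + (b^2))^2)) = (0 - a^2 * z - 2 * a * b * z + 2 * a * b + 2 * a * z^2 - 2 * a * z + b^2
    + 2 * b * z + z^2) * (0 - 8 * a^5 - 32 * a^4 * b - 12 * a^4 * z - 20 * a^4 - 32 * a^3 * b^2 -
    24 * a^3 * b * z - 40 * a^3 * b - 8 * a^3 * z^2 - 20 * a^3 * z - 16 * a^3 - 20 * a^2 * b^2 - 32
    * a^2 * b * z - 8 * a^2 * b - 12 * a^2 * z^2 - 11 * a^2 * z - 4 * a^2 - 4 * a * b^2 - 14 * a *
    b * z + 2 * a * b - 6 * a * z^2 - 2 * a * z - b^2 - 2 * b * z - z^2)"
  by (simp add: g3_coeff0_def g3_coeff1_def g3_coeff2_def g3_coeff3_def algebra_simps power_numeral_reduce)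

lemma g3_proportional:
  fixes a b z x :: complex
  assumes z: "poly (F4 a b) z = 0"
  shows "4 * a^2 * poly (g3 a b z) x * (x - z)^2
    = (2 * a + 1)^2 * (x * poly (F1 a b) x ^ 2 * poly (F2 a b) z ^ 2 - z * poly (F1 a b) z ^ 2 * poly (F2 a b) x ^ 2)"
proof -
  define P Q E R S where "P = 2 * a + 2 * b + a^2" and "Q = 2 * a * b + b^2" and "E = 2 * a + 1"
    and "R = a^2 + 2 * a * b + 2 * b" and "S = b^2"
  define f1 f2 where "f1 = z * (z^2 + P * z + Q)^2" and "f2 = (E * z^2 + R * z + S)^2"
  note defs = P_def Q_def E_def R_def S_def f1_def f2_def
  have F4: "0 - a^2 * z - 2 * a * b * z + 2 * a * b + 2 * a * z^2 - 2 * a * z + b^2 + 2 * b * z + z^2 = 0" using z by (simp add: poly_F algebra_simps power2_eq_square)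
  have D: "4 * a^2 * (z^2 * g3_coeff0 a b z) - E^2 * (0 - S^2 * f1) = 0"
    "4 * a^2 * (0 - 2 * z * g3_coeff0 a b z + z^2 * g3_coeff1 a b z) - E^2 * (Q^2 * f2 - 2 * R * S * f1) = 0"
    "4 * a^2 * (g3_coeff0 a b z - 2 * z * g3_coeff1 a b z + z^2 * g3_coeff2 a b z) - E^2 * (2 * P * Q * f2 - (R^2 + 2 * E * S) * f1) = 0"
    "4 * a^2 * (g3_coeff1 a b z - 2 * z * g3_coeff2 a b z + z^2 * g3_coeff3 a b z) - E^2 * ((P^2 + 2 * Q) * f2 - 2 * E * R * f1) = 0"
    "4 * a^2 * (g3_coeff2 a b z - 2 * z * g3_coeff3 a b z) - E^2 * (2 * P * f2 - E^2 * f1) = 0"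
    "4 * a^2 * (g3_coeff3 a b z) - E^2 * (1 * f2) = 0"
    unfolding defs
    by (rule trans[OF g3_certificate_0] trans[OF g3_certificate_1] trans[OF g3_certificate_2]
          trans[OF g3_certificate_3] trans[OF g3_certificate_4] trans[OF g3_certificate_5], simp only: F4 mult_zero_left)+
  define g0 g1 g2 g3' where "g0 = g3_coeff0 a b z" and "g1 = g3_coeff1 a b z" and "g2 = g3_coeff2 a b z" and "g3' = g3_coeff3 a b z"
  have "4 * a^2 * (g3' * x^3 + g2 * x^2 + g1 * x + g0) * (x - z)^2
      - E^2 * (x * (x^2 + P * x + Q)^2 * f2 - f1 * (E * x^2 + R * x + S)^2)
    = (4 * a^2 * (z^2 * g0) - E^2 * (0 - S^2 * f1))
      + (4 * a^2 * (0 - 2 * z * g0 + z^2 * g1) - E^2 * (Q^2 * f2 - 2 * R * S * f1)) * x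
      + (4 * a^2 * (g0 - 2 * z * g1 + z^2 * g2) - E^2 * (2 * P * Q * f2 - (R^2 + 2 * E * S) * f1)) * x^2
      + (4 * a^2 * (g1 - 2 * z * g2 + z^2 * g3') - E^2 * ((P^2 + 2 * Q) * f2 - 2 * E * R * f1)) * x^3
      + (4 * a^2 * (g2 - 2 * z * g3') - E^2 * (2 * P * f2 - E^2 * f1)) * x^4
      + (4 * a^2 * (g3') - E^2 * (1 * f2)) * x^5"
    by (simp add: algebra_simps power_numeral_reduce)
  also have "\<dots> = 0" unfolding g0_def g1_def g2_def g3'_def D by simp
  finally show ?thesis
    unfolding poly_F poly_g3 g0_def g1_def g2_def g3'_def defs by (simp add: add.assoc mult.assoc)
qed

section \<open>The degenerate covers with \<open>a = -1/2\<close>\<close>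

lemma monic_quadratic_factor:
  obtains r s :: complex where "r + s = - p" "r * s = q" "[:q, p, 1:] = [:- r, 1:] * [:- s, 1:]"
proof -
  obtain r where r: "poly [:q, p, 1:] r = 0"
    using fundamental_theorem_of_algebra[of "[:q, p, 1:]"] constant_degree[of "[:q, p, 1:]"] by auto
  define s where "s = - p - r"
  have rs: "r * s = q"
    using r by (simp add: s_def algebra_simps) (metis add.commute add_diff_cancel_right' diff_0 diff_diff_eq2 minus_diff_eq)
  have "[:q, p, 1:] = [:- r, 1:] * [:- s, 1:]"
    unfolding rs[symmetric] by (simp add: s_def algebra_simps)
  then show ?thesis using that[of r s] rs by (simp add: s_def)
qed

text \<open>The ramification type of the fibre that is given by the polynomial \<open>G\<close>.\<close>

definition ram_multiset :: "complex poly \<Rightarrow> nat multiset" where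
  "ram_multiset G = image_mset (\<lambda>c. order c G) (mset_set {c. order c G > 1})"

lemma order_linear: "order d [:- c, 1::complex:] = (if d = c then 1 else 0)"
  using order_power_n_n[of c 1] by (auto intro: order_0I)

lemma ram_multiset_two:
  assumes "r \<noteq> s" "r \<noteq> c" "s \<noteq> c"
  shows "ram_multiset ([:- c, 1:] * ([:- r, 1:] * [:- s, 1:]) ^ 2) = {#2, 2#}"
proof -
  have nz: "[:- r, 1:] * [:- s, 1:] \<noteq> 0" unfolding mult_eq_0_iff by simp
  have o: "order d ([:- c, 1:] * ([:- r, 1:] * [:- s, 1:]) ^ 2)
      = (if d = c then 1 else 0) + 2 * ((if d = r then 1 else 0) + (if d = s then 1 else 0))" for d
    unfolding order_linear_square[OF nz] order_mult[OF nz] order_linear ..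
  have S: "{d. order d ([:- c, 1:] * ([:- r, 1:] * [:- s, 1:]) ^ 2) > 1} = {r, s}"
    unfolding o using assms by auto
  show ?thesis unfolding ram_multiset_def S unfolding o using assms by (simp add: numeral_2_eq_2)
qed

context normal_form
begin

context
  fixes l z
  assumes half: "2 * a + 1 = 0" and l: "l \<noteq> 0" "l \<noteq> 1"
    and z: "poly (fibre a b l) z = 0" "order z (fibre a b l) \<ge> 2" "poly (F4 a b) z = 0"
begin

lemma a_half: "a = - 1 / 2"
proof -
  have "2 * a = - 1" using half by (simp add: add_eq_0_iff2)
  then show ?thesis by (metis nonzero_mult_div_cancel_left zero_neq_numeral)
qed

text \<open>For \<open>2 a + 1 = 0\<close> the polynomial \<open>F4\<close> is linear, so that all ramification outside of 0, 1 and infinity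
  is concentrated in the simple root \<open>z\<close>.\<close>

lemma F4_root_unique:
  assumes "poly (F4 a b) c = 0" shows "c = z"
proof -
  let ?B = "2 * b - 2 * b * a - 2 * a - a^2" and ?C = "b^2 + 2 * a * b"
  have eq: "?B * c + ?C = 0" "?B * z + ?C = 0" using assms z(3) unfolding poly_F half by simp_all
  have "?B \<noteq> 0"
  proof
    assume "?B = 0"
    moreover from this have "?C = 0" using eq by simp
    ultimately have "F4 a b = 0" unfolding F4_def using half by simp
    then show False using F4_nz by simp
  qed
  moreover have "B * (c - z) = 0" if "B * c + C = 0" "B * z + C = 0" for B C
    using that by (metis add_diff_cancel_right diff_self right_diff_distrib)
  from this[OF eq] have "?B * (c - z) = 0" .
  ultimately show ?thesis by simp
qed

text \<open>As \<open>z\<close> lies over neither 0 nor 1. The degenerations of the fibres over 0 and 1 would make \<open>F4\<close> vanish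
  at a root of \<open>F1\<close> or \<open>F3\<close>.\<close>

lemma F13_root_not_F4: "poly (F1 a b) c = 0 \<or> poly (F3 a b) c = 0 \<Longrightarrow> poly (F4 a b) c \<noteq> 0"
  using F4_root_unique F13_nz_on_fibre[OF z(1) l] by blast

lemma order_fibre_at_z: "order z (fibre a b l) = 2"
proof -
  have "degree (F4 a b) \<le> 1" using half by (simp add: F4_def)
  then have "order z (F4 a b) \<le> 1" using order_degree[OF F4_nz, of z] by linarith
  then show ?thesis using order_fibre_le[OF l, of z] z(2) by linarith
qed

lemma multiple_point:
  assumes "p \<noteq> 0" "p \<noteq> 1" "order c (fibre a b p) > 1" shows "c = z" "p = l"
proof -
  have "order c (F4 a b) \<noteq> 0" using order_fibre_le[OF assms(1,2), of c] assms(3) by linarith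
  then have "poly (F4 a b) c = 0" by (simp add: order_root)
  then show c: "c = z" by (rule F4_root_unique)
  have "order c (fibre a b p) \<noteq> 0" using assms(3) by simp
  then have "poly (fibre a b p) c = 0" by (simp add: order_root)
  then show "p = l" using fibre_disjoint z(1) c by blast
qed

lemma ram_multiset_l: "ram_multiset (fibre a b l) = {#2#}"
proof -
  have "{c. order c (fibre a b l) > 1} = {z}"
    using multiple_point(1)[OF l] order_fibre_at_z by auto
  then show ?thesis unfolding ram_multiset_def using order_fibre_at_z by simp
qed

lemma ram_multiset_other: "p \<noteq> 0 \<Longrightarrow> p \<noteq> 1 \<Longrightarrow> p \<noteq> l \<Longrightarrow> ram_multiset (fibre a b p) = {#}"
proof -
  assume p: "p \<noteq> 0" "p \<noteq> 1" "p \<noteq> l"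
  have "{c. order c (fibre a b p) > 1} = {}"
    using multiple_point(2)[OF p(1,2)] p(3) by blast
  then show ?thesis unfolding ram_multiset_def by simp
qed

lemma ram_multiset_0: "ram_multiset (fibre a b 0) = {#2, 2#}"
proof -
  obtain r s where rs: "r + s = - (2 * a + 2 * b + a^2)" "r * s = 2 * a * b + b^2" "F1 a b = [:- r, 1:] * [:- s, 1:]"
    using monic_quadratic_factor[of "2 * a + 2 * b + a^2" "2 * a * b + b^2"] unfolding F1_def by metis
  have root: "poly (F1 a b) r = 0" "poly (F1 a b) s = 0" unfolding rs(3) by simp_all
  have nz: "r \<noteq> 0" "s \<noteq> 0"
  proof -
    have "r * s \<noteq> 0"
    proof
      assume "r * s = 0"
      then have *: "r = 0 \<or> s = 0" by simp
      have "poly (F4 a b) 0 = r * s" by (simp add: poly_F rs(2))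
      then show False using F13_root_not_F4 root * \<open>r * s = 0\<close> by auto
    qed
    then show "r \<noteq> 0" "s \<noteq> 0" by auto
  qed
  have "r \<noteq> s"
  proof
    assume e: "r = s"
    have r: "r = 3 / 8 - b" using rs(1) unfolding e a_half by (simp add: power2_eq_square field_simps)
    have "r * r = b^2 - b" using rs(2) unfolding e a_half by simp
    then have rr: "r * r - (b^2 - b) = 0" by (rule right_minus_eq[THEN iffD2])
    have "b + 9 / 16 = 4 * (r * r - (b^2 - b))" unfolding r by (simp add: power2_eq_square algebra_simps)
    also have "\<dots> = 0" unfolding rr by (rule mult_zero_right)
    finally have "b + 9 / 16 = 0" .
    then have b': "b = - (9 / 16)" by (rule eq_neg_iff_add_eq_0[THEN iffD2])
    then have "poly (F4 a b) r = 0" unfolding poly_F r a_half b' by (simp add: power2_eq_square)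
    then show False using F13_root_not_F4 root by blast
  qed
  then show ?thesis using ram_multiset_two[of r s 0] nz by (simp only: fibre_0 rs(3) minus_zero not_False_eq_True)
qed

lemma ram_multiset_1: "ram_multiset (fibre a b 1) = {#2, 2#}"
proof -
  obtain r s where rs: "r + s = a^2 - 2 * b" "r * s = b^2" "F3 a b = [:- r, 1:] * [:- s, 1:]"
    using monic_quadratic_factor[of "- (a^2 - 2 * b)" "b^2"] unfolding F3_def by (metis minus_minus)
  have root: "poly (F3 a b) r = 0" "poly (F3 a b) s = 0" unfolding rs(3) by simp_all
  have "poly (F4 a b) 1 = poly (F3 a b) 1" by (simp add: poly_F)
  then have nz: "r \<noteq> 1" "s \<noteq> 1" using F13_root_not_F4 root by auto
  have "r \<noteq> s"
  proof
    assume e: "r = s"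
    have r: "r = 1 / 8 - b" using rs(1) unfolding e a_half by (simp add: power2_eq_square field_simps)
    have "r * r = b^2" using rs(2) unfolding e by simp
    then have rr: "r * r - b^2 = 0" by (rule right_minus_eq[THEN iffD2])
    have "1 / 16 - b = 4 * (r * r - b^2)" unfolding r by (simp add: power2_eq_square algebra_simps)
    also have "\<dots> = 0" unfolding rr by (rule mult_zero_right)
    finally have b': "b = 1 / 16" by simp
    then have "poly (F4 a b) r = 0" unfolding poly_F r a_half b' by (simp add: power2_eq_square)
    then show False using F13_root_not_F4 root by blast
  qed
  then show ?thesis using ram_multiset_two[of r s 1] nz by (simp only: fibre_1 rs(3) not_False_eq_True)
qed

lemma F2_linear: obtains c e where "F2 a b = Polynomial.smult e [:- c, 1:]" "e \<noteq> 0"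
proof -
  let ?e = "a^2 + 2 * a * b + 2 * b"
  have F2: "F2 a b = [:b^2, ?e:]" unfolding F2_def using half by simp
  have "?e \<noteq> 0"
  proof
    assume "?e = 0"
    moreover have "?e = b + 1 / 4" unfolding a_half by (simp add: power2_eq_square)
    ultimately have "b + 1 / 4 = 0" by simp
    then have b': "b = - (1 / 4)" by (rule eq_neg_iff_add_eq_0[THEN iffD2])
    show False using z(3) unfolding poly_F a_half b' by (simp add: power2_eq_square)
  qed
  then show ?thesis using that[of ?e "- (b^2) / ?e"] F2 by simp
qed

lemma F2_sq: "ram_multiset (F2 a b ^ 2) = {#2#}" "degree (F2 a b ^ 2) = 2"
proof -
  obtain c e where F2: "F2 a b = Polynomial.smult e [:- c, 1:]" "e \<noteq> 0" by (rule F2_linear)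
  have o: "order d (F2 a b ^ 2) = (if d = c then 2 else 0)" for d
  proof -
    have "F2 a b * F2 a b \<noteq> 0" using F_nz(3)[OF b] by simp
    then have "order d (F2 a b ^ 2) = 2 * order d (F2 a b)"
      by (simp add: power2_eq_square order_mult)
    moreover have "order d (F2 a b) = order d [:- c, 1:]"
      unfolding F2(1) using F2(2) by (rule order_smult)
    ultimately show ?thesis by (simp add: order_linear)
  qed
  have "{d. order d (F2 a b ^ 2) > 1} = {c}" unfolding o by auto
  then show "ram_multiset (F2 a b ^ 2) = {#2#}" unfolding ram_multiset_def o by simp
  show "degree (F2 a b ^ 2) = 2" unfolding F2(1) using F2(2) by (simp add: degree_power_eq)
qed

end

end

locale normal_cover = const_embedding \<iota> + normal_form a b
  for \<iota> :: "complex \<Rightarrow> 'k::field" and a b +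
  fixes x t :: 'k
  assumes x_nc: "x \<notin> range \<iota>"
    and t_eq: "t = x * (ev \<iota> (F1 a b) x / ev \<iota> (F2 a b) x)^2"
begin

lemma degree_F1_sq: "degree ([:0, 1:] * F1 a b ^ 2) = 5"
  using degree_fibre[of a b 0] by (simp only: fibre_0)

lemma degree_F2_sq: "degree (F2 a b ^ 2) \<le> 4"
proof -
  have "degree (F2 a b) \<le> 2" by (simp add: F2_def)
  then show ?thesis using degree_power_le[of "F2 a b" 2] by linarith
qed

sublocale rational_map \<iota> x t "[:0, 1:] * F1 a b ^ 2" "F2 a b ^ 2"
proof
  show "x \<notin> range \<iota>" by (rule x_nc)
  show "t = ev \<iota> ([:0, 1:] * F1 a b ^ 2) x / ev \<iota> (F2 a b ^ 2) x"
    unfolding t_eq ev_mult ev_power by (simp add: power_divide)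
  show "F2 a b ^ 2 \<noteq> 0" using F_nz(3)[OF b] by simp
  show "poly (F2 a b ^ 2) c \<noteq> 0" if "poly ([:0, 1:] * F1 a b ^ 2) c = 0" for c
    using F2_nz_on_fibre[of 0 c] that by (simp only: fibre_0 poly_power power_eq_0_iff) simp
  show "degree (F2 a b ^ 2) < degree ([:0, 1:] * F1 a b ^ 2)"
    using degree_F1_sq degree_F2_sq by linarith
qed

lemma fibre_eq: "[:0, 1:] * F1 a b ^ 2 - Polynomial.smult p (F2 a b ^ 2) = fibre a b p"
  by (simp only: fibre_def)

lemma ram_type_fibre:
  "ram_type \<iota> (adjoin \<iota> {x}) (adjoin \<iota> {t}) (finite_place t p) = ram_multiset (fibre a b p)"
  unfolding ram_type_finite fibre_eq ram_multiset_def ..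

text \<open>If \<open>2 a + 1 = 0\<close>, then \<open>F2\<close> is linear and \<open>x = \<infinity>\<close> is a triple point over \<open>t = \<infinity>\<close>.\<close>

lemma exceptional_over_infinity:
  assumes half: "2 * a + 1 = 0" and l: "l \<noteq> 0" "l \<noteq> 1"
    and z: "poly (fibre a b l) z = 0" "order z (fibre a b l) \<ge> 2" "poly (F4 a b) z = 0"
  shows "degenerate_type_II \<iota> (adjoin \<iota> {x}) (adjoin \<iota> {t})"
    and "\<not> ram_type_at \<iota> (adjoin \<iota> {x}) (adjoin \<iota> {t}) t 1 {#2, 3#}"
proof -
  let ?r = "ram_type \<iota> (adjoin \<iota> {x}) (adjoin \<iota> {t})"
  note m0 = ram_multiset_0[OF half l z] and m1 = ram_multiset_1[OF half l z]
    and ml = ram_multiset_l[OF half l z] and mo = ram_multiset_other[OF half l z] and F2s = F2_sq[OF half l z]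
  have rf: "?r (finite_place t 0) = {#2, 2#}" "?r (finite_place t 1) = {#2, 2#}" "?r (finite_place t l) = {#2#}"
    unfolding ram_type_fibre m0 m1 ml by simp_all
  have ri: "?r (infinite_place t) = {#2, 3#}"
  proof -
    have "?r (infinite_place t) = add_mset (5 - 2) (ram_multiset (F2 a b ^ 2))"
      using ram_type_infinite unfolding degree_F1_sq F2s(2) ram_multiset_def by simp
    then show ?thesis unfolding F2s(1) by (simp add: add_mset_commute)
  qed
  have set: "{q. is_place \<iota> (adjoin \<iota> {t}) q \<and> ?r q \<noteq> {#}}
      = {finite_place t 0, finite_place t 1, finite_place t l, infinite_place t}"
  proof (intro equalityI subsetI)
    fix q assume "q \<in> {q. is_place \<iota> (adjoin \<iota> {t}) q \<and> ?r q \<noteq> {#}}"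
    then have q: "is_place \<iota> (adjoin \<iota> {t}) q" "?r q \<noteq> {#}" by auto
    from rational_place_cases[OF t_nc q(1)]
    show "q \<in> {finite_place t 0, finite_place t 1, finite_place t l, infinite_place t}"
    proof cases
      case (1 p)
      then have "p = 0 \<or> p = 1 \<or> p = l" using q(2) mo[of p] unfolding 1 ram_type_fibre by blast
      then show ?thesis using 1 by blast
    qed simp
  next
    fix q assume "q \<in> {finite_place t 0, finite_place t 1, finite_place t l, infinite_place t}"
    then consider "q = finite_place t 0" | "q = finite_place t 1" | "q = finite_place t l" | "q = infinite_place t" by blast
    then show "q \<in> {q. is_place \<iota> (adjoin \<iota> {t}) q \<and> ?r q \<noteq> {#}}"
      by cases (use rf ri finite_place(1)[OF t_nc] infinite_place(1)[OF t_nc] in simp_all)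
  qed
  have dist: "finite_place t 0 \<noteq> finite_place t 1" "finite_place t 0 \<noteq> finite_place t l"
    "finite_place t 1 \<noteq> finite_place t l" "finite_place t 0 \<noteq> infinite_place t"
    "finite_place t 1 \<noteq> infinite_place t" "finite_place t l \<noteq> infinite_place t"
  proof -
    have "finite_place t c = finite_place t d \<longleftrightarrow> c = d" for c d
      using finite_place_inj[OF t_nc, of c d] by blast
    then show "finite_place t 0 \<noteq> finite_place t 1" "finite_place t 0 \<noteq> finite_place t l"
      "finite_place t 1 \<noteq> finite_place t l"
      using l by simp_all
  qed (rule finite_infinite_place[OF t_nc])+
  have "ram_structure \<iota> (adjoin \<iota> {x}) (adjoin \<iota> {t})
      = {# ?r (finite_place t 0), ?r (finite_place t 1), ?r (finite_place t l), ?r (infinite_place t) #}"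
    unfolding ram_structure_def set using dist by simp
  then show "degenerate_type_II \<iota> (adjoin \<iota> {x}) (adjoin \<iota> {t})"
    unfolding degenerate_type_II_def rf ri by (simp add: add_mset_commute)
  show "\<not> ram_type_at \<iota> (adjoin \<iota> {x}) (adjoin \<iota> {t}) t 1 {#2, 3#}"
  proof
    assume "ram_type_at \<iota> (adjoin \<iota> {x}) (adjoin \<iota> {t}) t 1 {#2, 3#}"
    then obtain p where p: "is_place \<iota> (adjoin \<iota> {t}) p" "p (t - \<iota> 1) > 0" "?r p = {#2, 3#}"
      unfolding ram_type_at_def by blast
    have "p = finite_place t 1" by (rule finite_place(3)[OF t_nc p(1,2)])
    then have "{#2, 2#} = ({#2, 3#} :: nat multiset)" using p(3) rf(2) by simp
    then show False by simp
  qed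
qed

end

section \<open>The branch points of the genus 1 field\<close>

text \<open>If \<open>e\<close> is the degree of \<open>E\<close> over \<open>M\<close>, then \<open>5 e = 2 d \<le> 10\<close> with \<open>d > 0\<close>.\<close>

lemma degree_2_of_tower:
  assumes M: "subfield M (fld :: 'k::field ring)" and N: "subfield N fld" and E: "subfield E fld" "M \<subseteq> E"
    and dim: "ext_degree N M d" "d \<le> 5" "ext_degree UNIV N 2" "ext_degree UNIV E 5"
  shows "ext_degree E M 2"
proof -
  have U: "F.dimension (d * 2) M UNIV" by (rule F.telescopic_base[OF M N dim(1,3)])
  have "subalgebra M E fld"
  proof (intro subalgebra.intro subalgebra_axioms.intro F.add.subgroupI)
    show "\<ominus>\<^bsub>fld\<^esub> f \<in> E" if "f \<in> E" for f using subfield_fldD(5)[OF E(1) that] by simp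
  qed (use E(2) subfield_fldD[OF E(1)] in auto)
  then have "F.finite_dimension M E"
    by (rule F.subalbegra_incl_imp_finite_dimension[OF M F.finite_dimensionI[OF U]]) simp
  then obtain e where e: "F.dimension e M E" unfolding F.finite_dimension_def by blast
  have "F.dimension (e * 5) M UNIV" by (rule F.telescopic_base[OF M E(1) e dim(4)])
  then have eq: "e * 5 = d * 2" using F.dimension_is_inj[OF M _ U] by blast
  have "d \<noteq> 0"
  proof
    assume "d = 0"
    then have "N = {0}" using dim(1) degree_0_iff by blast
    then show False using subfield_fldD(1)[OF N] by simp
  qed
  then have "e = 2" using eq dim(2) by presburger
  then show ?thesis using e by simp
qed

context normal_cover
begin

lemma F2_x_nz: "ev \<iota> (F2 a b) x \<noteq> 0"
  using F_nz(3)[OF b] by (simp add: ev_eq_0_iff[OF x_nc])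

text \<open>The equation \<open>x F1(x)\<^sup>2 = t F2(x)\<^sup>2\<close> is monic of degree 5 in \<open>x\<close>.\<close>

lemma degree_x_over_t:
  obtains d where "d \<le> 5" "ext_degree (adjoin \<iota> {x}) (adjoin \<iota> {t}) d"
proof -
  define P Q E R S where "P = \<iota> (2 * a + 2 * b + a^2)" and "Q = \<iota> (2 * a * b + b^2)" and "E = \<iota> (2 * a + 1)"
    and "R = \<iota> (a^2 + 2 * a * b + 2 * b)" and "S = \<iota> (b^2)"
  have F: "ev \<iota> (F1 a b) x = x^2 + P * x + Q" "ev \<iota> (F2 a b) x = E * x^2 + R * x + S"
    unfolding F1_def F2_def P_def Q_def E_def R_def S_def
    by (simp_all only: ev_pCons ev_0 emb_1) (simp_all add: algebra_simps power2_eq_square)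
  interpret M: field_over_C \<iota> "adjoin \<iota> {t}" by (rule field_over_C_adjoin)
  have tM: "t \<in> adjoin \<iota> {t}" using subset_adjoin by blast
  have two: "(2::'k) \<in> adjoin \<iota> {t}" using M.L_closed(11)[of 2] by simp
  have cM: "P \<in> adjoin \<iota> {t}" "Q \<in> adjoin \<iota> {t}" "E \<in> adjoin \<iota> {t}" "R \<in> adjoin \<iota> {t}" "S \<in> adjoin \<iota> {t}"
    unfolding P_def Q_def E_def R_def S_def by (rule M.L_closed(11))+
  have "t * (E * x^2 + R * x + S)^2 = x * (x^2 + P * x + Q)^2"
    using t_eq F2_x_nz unfolding F(1) F(2) by (simp add: power_divide)
  then have root: "x^5 + (2 * P - t * E^2) * x^4 + (P^2 + 2 * Q - t * (2 * E * R)) * x^3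
      + (2 * P * Q - t * (R^2 + 2 * E * S)) * x^2 + (Q^2 - t * (2 * R * S)) * x + (- (t * S^2)) = 0"
    by (simp add: algebra_simps power_numeral_reduce)
  show ?thesis
  proof (rule degree_simple_extension_le_5[OF subfield_adjoin _ _ _ _ _ root subfield_adjoin adjoin_t_subset x_in])
    show "adjoin \<iota> {x} \<subseteq> E'" if "subfield E' fld" "adjoin \<iota> {t} \<subseteq> E'" "x \<in> E'" for E'
      by (rule adjoin_least[OF that(1)]) (use that M.const_L in auto)
  qed (use cM tM two that in \<open>auto intro!: M.L_closed\<close>)
qed

text \<open>Counting branch points: the squarefree polynomials that define \<open>K1\<close> over \<open>\<complex>(t)\<close> and the whole field over
  \<open>\<complex>(x)\<close> have degrees 3 or 4 and 5 or 6. The latter polynomial is the squarefree part of the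
  product of the fibres over the roots of the former, and the fibres have no common points.\<close>

lemma genus_2_cover:
  assumes K1: "subfield K1 fld" "range \<iota> \<subseteq> K1" "has_genus \<iota> K1 1" "ext_degree UNIV K1 5"
    and K2: "has_genus \<iota> (UNIV :: 'k set) 2" "ext_degree UNIV (adjoin \<iota> {x}) 2"
    and inter: "adjoin \<iota> {t} = K1 \<inter> adjoin \<iota> {x}"
  obtains l z s c where "l \<noteq> 0" "l \<noteq> 1" "poly (fibre a b l) z = 0" "order z (fibre a b l) \<ge> 2"
    "poly (F4 a b) z = 0" "s \<notin> adjoin \<iota> {x}" "c \<noteq> 0" "s^2 = \<iota> c * (t * (t - 1) * (t - \<iota> l))"
proof -
  have MK1: "adjoin \<iota> {t} \<subseteq> K1" using inter by blast
  obtain d where d: "d \<le> 5" "ext_degree (adjoin \<iota> {x}) (adjoin \<iota> {t}) d" by (rule degree_x_over_t)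
  have dimK1: "ext_degree K1 (adjoin \<iota> {t}) 2"
    by (rule degree_2_of_tower[OF subfield_adjoin subfield_adjoin K1(1) MK1 d(2,1) K2(2) K1(4)])
  obtain s f where s: "s \<in> K1" "s \<notin> adjoin \<iota> {t}" "s^2 = ev \<iota> f t" and f: "\<And>c. order c f \<le> 1"
    by (rule quadratic_generator[OF t_nc K1(1) MK1 dimK1]) (rule that)
  interpret T: quadratic_field \<iota> t s f
    by (intro quadratic_field.intro const_embedding_axioms quadratic_field_axioms.intro t_nc s(2,3))
  have "T.Q = K1" using quadratic_field_eq[OF t_nc K1(1) MK1 dimK1 s(1,2)] T.adjoin_uw by simp
  then have degf: "degree f = 3 \<or> degree f = 4"
    using T.degree_of_genus[OF f, of 1] K1(3) by simp
  define Z where "Z = {p. poly f p = 0}"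
  define c where "c = lead_coeff f"
  have c0: "c \<noteq> 0" using T.h_nz by (simp add: c_def)
  have Z: "finite Z" "card Z = degree f"
    using poly_roots_finite[OF T.h_nz] squarefree_degree[OF T.h_nz f] by (simp_all add: Z_def)
  have ff: "f = Polynomial.smult c (\<Prod>p\<in>Z. [:- p, 1:])"
    unfolding c_def Z_def by (rule squarefree_factorization[OF T.h_nz f])
  have evf: "s^2 = \<iota> c * (\<Prod>p\<in>Z. t - \<iota> p)"
    unfolding s(3) by (subst ff, subst ev_smult, subst ev_prod) (simp add: algebra_simps)
  (* over the x-line the same square root is that of the product of the fibres *)
  define H where "H = Polynomial.smult c (\<Prod>p\<in>Z. fibre a b p)"
  have H0: "H \<noteq> 0" using c0 Z(1) fibre_nz by (simp add: H_def)
  define y1 where "y1 = s * ev \<iota> (F2 a b) x ^ card Z"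
  have "(\<Prod>p\<in>Z. t - \<iota> p) = (\<Prod>p\<in>Z. ev \<iota> (fibre a b p) x) / (ev \<iota> (F2 a b ^ 2) x) ^ card Z"
    unfolding t_minus fibre_eq by (simp add: prod_dividef)
  then have y1: "y1^2 = ev \<iota> H x"
    unfolding y1_def power_mult_distrib evf H_def ev_smult ev_prod
    using F2_x_nz by (simp add: power_mult[symmetric] mult.commute)
  obtain R h where h: "H = R^2 * h" "R \<noteq> 0" and sqf: "\<And>c. order c h \<le> 1"
    by (rule square_free_part[OF H0]) (rule that)
  define m where "m = ev \<iota> (F2 a b) x ^ card Z / ev \<iota> R x"
  have m: "m \<in> adjoin \<iota> {x}" "m \<noteq> 0"
    using h(2) F2_x_nz by (auto simp: m_def ev_eq_0_iff[OF x_nc] intro!: N.L_closed)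
  have s_notin: "s \<notin> adjoin \<iota> {x}" using s(1,2) inter by blast
  define y0 where "y0 = s * m"
  have y0_sq: "y0^2 = ev \<iota> h x"
  proof -
    have "y0 = y1 / ev \<iota> R x" by (simp add: y0_def y1_def m_def)
    then have "y0^2 = ev \<iota> (R^2 * h) x / ev \<iota> R x ^ 2" using y1 h(1) by (simp add: power_divide)
    then show ?thesis using h(2) by (simp add: ev_eq_0_iff[OF x_nc])
  qed
  have y0_notin: "y0 \<notin> adjoin \<iota> {x}"
  proof
    assume "y0 \<in> adjoin \<iota> {x}"
    then have "y0 / m \<in> adjoin \<iota> {x}" using m(1) by (rule N.L_closed(8))
    then show False using s_notin m(2) by (simp add: y0_def)
  qed
  interpret X: quadratic_field \<iota> x y0 h
    by (intro quadratic_field.intro const_embedding_axioms quadratic_field_axioms.intro x_nc y0_notin y0_sq)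
  have "X.Q = UNIV"
    using quadratic_field_eq[OF x_nc subfield_UNIV _ K2(2) _ y0_notin] X.adjoin_uw by simp
  then have degh: "degree h = 5 \<or> degree h = 6"
    using X.degree_of_genus[OF sqf, of 2] K2(1) by simp
  have roots_h: "{c. poly h c = 0} = odd_roots H"
  proof -
    have "order c H = 2 * order c R + order c h" for c
    proof -
      have "R^2 * h \<noteq> 0" "R * R \<noteq> 0" using H0 h by auto
      then show ?thesis unfolding h(1) by (simp add: order_mult power2_eq_square)
    qed
    moreover have "poly h c = 0 \<longleftrightarrow> odd (order c h)" for c
    proof -
      have "poly h c = 0 \<longleftrightarrow> order c h \<noteq> 0" using order_root[of h c] X.h_nz by blast
      moreover have "order c h = 0 \<or> order c h = 1" using sqf[of c] by linarith
      ultimately show ?thesis by auto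
    qed
    ultimately show ?thesis by (auto simp: odd_roots_def)
  qed
  have odd_H: "odd_roots H = (\<Union>p\<in>Z. odd_roots (fibre a b p))"
  proof -
    have ordH: "order d H = (\<Sum>p\<in>Z. order d (fibre a b p))" for d
      unfolding H_def order_smult[OF c0] by (rule order_prod[OF Z(1) fibre_nz])
    have one: "order d H = order d (fibre a b p)"
      if "p \<in> Z" "poly (fibre a b p) d = 0" for p d
    proof -
      have "order d (fibre a b q) = 0" if q: "q \<in> Z - {p}" for q
        by (rule order_0I) (use q \<open>poly (fibre a b p) d = 0\<close> fibre_disjoint[of p d q] in auto)
      then show ?thesis unfolding ordH using Z(1) that(1) by (simp add: sum.remove)
    qed
    show ?thesis
    proof (intro equalityI subsetI)
      fix d assume d: "d \<in> odd_roots H"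
      then have "order d H \<noteq> 0" by (auto simp: odd_roots_def intro!: Nat.gr0I)
      then obtain p where p: "p \<in> Z" "order d (fibre a b p) \<noteq> 0" unfolding ordH by (metis sum.neutral)
      then have "poly (fibre a b p) d = 0" by (simp add: order_root)
      then show "d \<in> (\<Union>p\<in>Z. odd_roots (fibre a b p))" using d one[OF p(1)] p(1) by (auto simp: odd_roots_def)
    next
      fix d assume "d \<in> (\<Union>p\<in>Z. odd_roots (fibre a b p))"
      then obtain p where p: "p \<in> Z" "d \<in> odd_roots (fibre a b p)" by blast
      then have "poly (fibre a b p) d = 0" using odd_roots_subset[OF fibre_nz] by blast
      then show "d \<in> odd_roots H" using one[OF p(1)] p(2) by (simp add: odd_roots_def)
    qed
  qed
  have "degree h = (\<Sum>p\<in>Z. card (odd_roots (fibre a b p)))"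
    unfolding squarefree_degree[OF X.h_nz sqf] roots_h odd_H
  proof (rule card_UN_disjoint[OF Z(1)])
    show "\<forall>p\<in>Z. finite (odd_roots (fibre a b p))" using finite_odd_roots[OF fibre_nz] by blast
    show "\<forall>p\<in>Z. \<forall>q\<in>Z. p \<noteq> q \<longrightarrow> odd_roots (fibre a b p) \<inter> odd_roots (fibre a b q) = {}"
      using odd_roots_subset[OF fibre_nz] fibre_disjoint by blast
  qed
  then obtain l z where lz: "Z = {0, 1, l}" "l \<noteq> 0" "l \<noteq> 1" "poly (fibre a b l) z = 0"
    "order z (fibre a b l) \<ge> 2" "poly (F4 a b) z = 0"
    using branch_points[OF Z(1)] degf degh Z(2) by metis
  have "s^2 = \<iota> c * (t * (t - 1) * (t - \<iota> l))"
    unfolding evf lz(1) using lz(2,3) by (simp add: mult.assoc)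
  then show ?thesis using that lz(2-) s_notin c0 by blast
qed

end

section \<open>The equation of the genus 2 field\<close>

theorem theorem2:
  fixes \<iota> :: "complex \<Rightarrow> 'k::field" and K1 :: "'k set" and x t :: 'k and a b :: complex
  assumes \<iota>: "\<iota> \<in> ring_hom fld fld"
    and K2: "function_field \<iota> (UNIV :: 'k set)" "has_genus \<iota> (UNIV :: 'k set) 2"
    and K1: "function_field \<iota> K1" "has_genus \<iota> K1 1" "ext_degree UNIV K1 5"
    and ab: "a \<noteq> 0" "b \<noteq> 0" "a + b \<noteq> -1"
    and x: "{M. rational_subfield \<iota> M \<and> ext_degree UNIV M 2} = {adjoin \<iota> {x}}"
    and t: "adjoin \<iota> {t} = K1 \<inter> adjoin \<iota> {x}"
    and t_eq: "t = x * (ev \<iota> (F1 a b) x / ev \<iota> (F2 a b) x)^2"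
    and t1_eq: "t - 1 = (x - 1) * (ev \<iota> (F3 a b) x / ev \<iota> (F2 a b) x)^2"
    and type_I: "degenerate_type_I \<iota> (adjoin \<iota> {x}) (adjoin \<iota> {t}) \<Longrightarrow>
        ram_type_at \<iota> (adjoin \<iota> {x}) (adjoin \<iota> {t}) t 1 {#4#}"
    and type_II: "degenerate_type_II \<iota> (adjoin \<iota> {x}) (adjoin \<iota> {t}) \<Longrightarrow>
        ram_type_at \<iota> (adjoin \<iota> {x}) (adjoin \<iota> {t}) t 1 {#2, 3#}"
  shows "\<exists>z. poly (F4 a b) z = 0 \<and> z \<noteq> 1 \<and>
    (\<exists>y. y^2 = x * (x - 1) * ev \<iota> (g3 a b z) x \<and> adjoin \<iota> {x, y} = UNIV)"
proof -
  interpret const_embedding \<iota> by (rule const_embedding.intro[OF \<iota>])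
  interpret normal_form a b by (rule normal_form.intro[OF ab])
  have x': "rational_subfield \<iota> (adjoin \<iota> {x})" "ext_degree UNIV (adjoin \<iota> {x}) 2" using x by blast+
  have x_nc: "x \<notin> range \<iota>"
  proof
    assume "x \<in> range \<iota>"
    then have sub: "adjoin \<iota> {x} \<subseteq> range \<iota>" by (intro adjoin_least subfield_range) auto
    obtain v where v: "transcendental_over_C \<iota> v" "adjoin \<iota> {x} = adjoin \<iota> {v}"
      using x'(1) unfolding rational_subfield_def by blast
    have "v \<in> range \<iota>" using sub subset_adjoin[of "{v}"] unfolding v(2) by blast
    then have "(F.algebraic over range \<iota>) v"
      by (rule F.algebraic_self[OF subfieldE(1)[OF subfield_range]])
    then show False using v(1) by (simp add: over_def)
  qed
  interpret normal_cover \<iota> a b x t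
    by (intro normal_cover.intro const_embedding_axioms normal_form_axioms normal_cover_axioms.intro x_nc t_eq)
  obtain l z s c where lz: "l \<noteq> 0" "l \<noteq> 1" "poly (fibre a b l) z = 0" "order z (fibre a b l) \<ge> 2"
    "poly (F4 a b) z = 0" and s: "s \<notin> adjoin \<iota> {x}" "c \<noteq> 0" "s^2 = \<iota> c * (t * (t - 1) * (t - \<iota> l))"
    using K1(1) genus_2_cover[OF _ _ K1(2,3) K2(2) x'(2) t] unfolding function_field_def by blast
  have half: "2 * a + 1 \<noteq> 0"
    using exceptional_over_infinity[OF _ lz] type_II by blast
  have F13z: "poly (F1 a b) z \<noteq> 0" "poly (F3 a b) z \<noteq> 0" "poly (F2 a b) z \<noteq> 0"
    using F13_nz_on_fibre[OF lz(3,1,2)] F2_nz_on_fibre[OF lz(3)] by blast+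
  have "z \<noteq> 1"
  proof
    assume "z = 1"
    then have "poly (fibre a b 1) z = 0" by (simp add: fibre_1)
    then show False using fibre_disjoint lz(2,3) by blast
  qed
  define X1 X2 X3 where "X1 = ev \<iota> (F1 a b) x" and "X2 = ev \<iota> (F2 a b) x" and "X3 = ev \<iota> (F3 a b) x"
  define A where "A = \<iota> (poly (F2 a b) z)"
  define E where "E = \<iota> (2 * a + 1)"
  define e where "e = \<iota> (2 * a)"
  have nz: "X1 \<noteq> 0" "X2 \<noteq> 0" "X3 \<noteq> 0" "x - \<iota> z \<noteq> 0" "A \<noteq> 0" "E \<noteq> 0" "e \<noteq> 0"
    using F_nz a b half F13z x_nc by (auto simp: X1_def X2_def X3_def A_def E_def e_def ev_eq_0_iff[OF x_nc] simp del: emb_add emb_mult)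
  have zl: "z * poly (F1 a b) z ^ 2 = l * poly (F2 a b) z ^ 2" using lz(3) by (simp add: poly_fibre)
  (* the certified identity, evaluated at x, says that g3 is a multiple of the fibre over l divided by (X - z)^2 *)
  have g3: "e^2 * ev \<iota> (g3 a b z) x * (x - \<iota> z)^2 = E^2 * A^2 * X2^2 * (t - \<iota> l)"
  proof -
    have "Polynomial.smult ((2 * a)^2) (g3 a b z * [:- z, 1:]^2)
        = Polynomial.smult ((2 * a + 1)^2 * poly (F2 a b) z ^ 2) (fibre a b l)"
    proof (rule poly_eq_poly_eq_iff[THEN iffD1], rule ext)
      fix u
      have "poly (Polynomial.smult ((2 * a)^2) (g3 a b z * [:- z, 1:]^2)) u = 4 * a^2 * poly (g3 a b z) u * (u - z)^2"
        by (simp add: poly_power power_mult_distrib)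
      also have "\<dots> = (2 * a + 1)^2 * (u * poly (F1 a b) u ^ 2 * poly (F2 a b) z ^ 2 - z * poly (F1 a b) z ^ 2 * poly (F2 a b) u ^ 2)"
        by (rule g3_proportional[OF lz(5)])
      also have "\<dots> = (2 * a + 1)^2 * poly (F2 a b) z ^ 2 * poly (fibre a b l) u"
        unfolding zl poly_fibre by (simp add: algebra_simps)
      finally show "poly (Polynomial.smult ((2 * a)^2) (g3 a b z * [:- z, 1:]^2)) u
          = poly (Polynomial.smult ((2 * a + 1)^2 * poly (F2 a b) z ^ 2) (fibre a b l)) u" by simp
    qed
    from arg_cong[OF this, of "\<lambda>p. ev \<iota> p x"]
    have "e^2 * (ev \<iota> (g3 a b z) x * (x - \<iota> z)^2) = E^2 * A^2 * ev \<iota> (fibre a b l) x"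
      unfolding ev_smult ev_mult ev_power emb_mult[of "(2 * a + 1)^2"] emb_power e_def E_def A_def
      by (simp add: algebra_simps del: emb_add emb_mult)
    moreover have "ev \<iota> (fibre a b l) x = X2^2 * (t - \<iota> l)"
      unfolding t_minus fibre_eq ev_power X2_def[symmetric] using nz(2) by simp
    ultimately show ?thesis by (simp add: mult.assoc)
  qed
  have t': "t = x * X1^2 / X2^2" "t - 1 = (x - 1) * X3^2 / X2^2"
    using t_eq t1_eq by (simp_all add: X1_def X2_def X3_def power_divide)
  define r where "r = \<iota> (inverse (csqrt c))"
  have r: "r^2 * \<iota> c = 1" "r \<noteq> 0"
  proof -
    have "inverse (csqrt c) ^ 2 * c = 1" using s(2) by (simp add: power_inverse)
    then have "\<iota> (inverse (csqrt c) ^ 2 * c) = 1" by simp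
    then show "r^2 * \<iota> c = 1" unfolding r_def by (simp only: emb_mult emb_power)
    show "r \<noteq> 0" using s(2) by (simp add: r_def)
  qed
  define m where "m = r * E * A * X2^3 / (e * X1 * X3 * (x - \<iota> z))"
  define y where "y = s * m"
  have m: "m \<in> adjoin \<iota> {x}" "m \<noteq> 0"
  proof -
    show "m \<in> adjoin \<iota> {x}"
      unfolding m_def X1_def X2_def X3_def A_def E_def e_def r_def by (intro N.L_closed x_in)
    show "m \<noteq> 0" using nz r(2) by (simp add: m_def)
  qed
  have "y^2 = (r^2 * \<iota> c) * (t * (t - 1) * (t - \<iota> l)) * (E * A * X2^3 / (e * X1 * X3 * (x - \<iota> z)))^2"
    unfolding y_def m_def power_mult_distrib s(3) by (simp add: power_mult_distrib power_divide)
  also have "\<dots> = x * (x - 1) * (E^2 * A^2 * X2^2 * (t - \<iota> l) / (e^2 * (x - \<iota> z)^2))"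
  proof -
    have "t * (t - 1) = (x * X1^2 / X2^2) * ((x - 1) * X3^2 / X2^2)"
      by (subst t'(2), subst t'(1), rule refl)
    also have "\<dots> = x * (x - 1) * (X1 * X3)^2 / X2^4"
      by (simp add: power_mult_distrib power_numeral_reduce mult_ac)
    finally have "t * (t - 1) = x * (x - 1) * (X1 * X3)^2 / X2^4" .
    moreover have "1 * (W * Y) * (E * A * X2^3 / (e * X1 * X3 * D))^2 = V * (E^2 * A^2 * X2^2 * Y / (e^2 * D^2))"
      if "W = V * (X1 * X3)^2 / X2^4" "D \<noteq> 0" for V W Y D
      using nz that(2) unfolding that(1) by (simp add: field_simps power_numeral_reduce)
    ultimately show ?thesis unfolding r(1) using nz(4) by blast
  qed
  also have "E^2 * A^2 * X2^2 * (t - \<iota> l) / (e^2 * (x - \<iota> z)^2) = ev \<iota> (g3 a b z) x"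
    unfolding g3[symmetric] using nz by simp
  finally have y_sq: "y^2 = x * (x - 1) * ev \<iota> (g3 a b z) x" .
  have "y \<notin> adjoin \<iota> {x}"
  proof
    assume "y \<in> adjoin \<iota> {x}"
    then have "y / m \<in> adjoin \<iota> {x}" using m(1) by (rule N.L_closed(8))
    then show False using s(1) m(2) by (simp add: y_def)
  qed
  then have "adjoin \<iota> {x, y} = UNIV"
    by (intro quadratic_field_eq[OF x_nc subfield_UNIV _ x'(2)]) auto
  then show ?thesis using lz(5) \<open>z \<noteq> 1\<close> y_sq by blast
qed

end
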